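(* For every partition $\xi=(\xi_1\ge\dots\ge\xi_r\ge0)$ there is a canonical surjective homomorphism of $\mathfrak{g}_r$-modules $W(\xi)\to V(\xi)$ sending the cyclic vector of $W(\xi)$ to the cyclic vector of $V(\xi)$.
   Context: $\mathfrak{g}_r=\mathfrak{gl}_r\otimes\mathbb{C}[x,y]$, with matrix units $E_{ij}$. Weyl module: $W(\xi)$ is the maximal finite-dimensional $\mathfrak{g}_r$-module generated by a vector $v_\xi$ (its cyclic vector) such that for all $P\in\mathbb{C}[x,y]$: $(E_{ii}\otimes P)v_\xi=\xi_iP(0,0)v_\xi$ for all $i$, and $(E_{ij}\otimes P)v_\xi=0$ for $1\le i<j\le r$. Module $V(\xi)$: $\mathbb{C}\langle\mathcal{X},\mathcal{Y}\rangle$ is the associative algebra generated by $\mathcal{X},\mathcal{Y}$ with $\mathcal{Y}\mathcal{X}-\mathcal{X}\mathcal{Y}=\mathcal{X}$; it acts on $\mathbb{C}[x,x^{-1}]$ by $\mathcal{X}=x$, $\mathcal{Y}=x\,\partial/\partial x$, preserving each $x^N\mathbb{C}[x]$. $\mathcal{G}_r=\mathfrak{gl}_r\otimes\mathbb{C}\langle\mathcal{X},\mathcal{Y}\rangle$ (Lie algebra of matrices with the commutator). $V_r=\mathbb{C}^r$ with basis $u_1,\dots,u_r$; $V_r^{(N)}=V_r\otimes(\mathbb{C}[x,x^{-1}]/x^N\mathbb{C}[x])$ is a $\mathcal{G}_r$-module with basis $u_j^i=u_j\otimes x^i$, $i<N$. $v_\xi^{(N)}=\bigwedge_{j=1}^r\bigwedge_{i=N-\xi_j}^{N-1}u_j^i\in\bigwedge^{|\xi|}V_r^{(N)}$,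 $\mathcal{V}(\xi,N)=U(\mathcal{G}_r)v_\xi^{(N)}$. $F^n\mathcal{G}_r$ is the span of $g\otimes\mathcal{X}^i\mathcal{Y}^j$ with $g\in\mathfrak{gl}_r$, $j\le n$, so $\operatorname{gr}\mathcal{G}_r=\mathfrak{g}_r$; $U^{\le m}(\mathcal{G}_r)$ is the span of products $a_1\cdots a_k$ with $a_i\in F^{m_i}\mathcal{G}_r$, $\sum m_i\le m$; $F^m\mathcal{V}(\xi,N)=U^{\le m}(\mathcal{G}_r)v_\xi^{(N)}$. Then $V(\xi)=\bigoplus_mF^m\mathcal{V}(\xi,N)/F^{m-1}\mathcal{V}(\xi,N)$, a $\mathfrak{g}_r$-module which up to isomorphism does not depend on $N$; its cyclic vector is the class of $v_\xi^{(N)}$ in $F^0$. *)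

theory Defs
  imports "HOL-Algebra.AbelCoset" "Jordan_Normal_Form.VS_Connect" "HOL-Library.Poly_Mapping"
begin

section \<open>Complex vector spaces with a given basis\<close>

text \<open>
  The space with basis \<open>B\<close> is the set of finitely supported functions on \<open>B\<close>. The fields
  \<open>mult\<close> and \<open>one\<close>, which a record of type \<^typ>\<open>('a, 'b) module\<close> inherits from rings, play no role
  in a module and are left unspecified throughout.
\<close>

abbreviation scale :: "complex \<Rightarrow> ('b \<Rightarrow>\<^sub>0 complex) \<Rightarrow> ('b \<Rightarrow>\<^sub>0 complex)" where
  "scale c \<equiv> Poly_Mapping.map ((*) c)"

definition free_module :: "'b set \<Rightarrow> (complex, 'b \<Rightarrow>\<^sub>0 complex) module" where
  "free_module B = \<lparr>carrier = {t. Poly_Mapping.keys t \<subseteq> B}, mult = undefined, one = undefined,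
     zero = 0, add = (+), smult = scale\<rparr>"

definition lin_ext :: "('b \<Rightarrow> 'c \<Rightarrow>\<^sub>0 complex) \<Rightarrow> ('b \<Rightarrow>\<^sub>0 complex) \<Rightarrow> ('c \<Rightarrow>\<^sub>0 complex)" where
  "lin_ext \<phi> t = (\<Sum>b\<in>Poly_Mapping.keys t. scale (Poly_Mapping.lookup t b) (\<phi> b))"

lemma lookup_scale [simp]:
  "Poly_Mapping.lookup (scale c t) b = c * Poly_Mapping.lookup t b"
  by (simp add: Poly_Mapping.map.rep_eq when_def)

lemma lookup_lin_ext:
  "Poly_Mapping.lookup (lin_ext \<phi> t) x =
     (\<Sum>b\<in>Poly_Mapping.keys t. Poly_Mapping.lookup t b * Poly_Mapping.lookup (\<phi> b) x)"
  by (simp add: lin_ext_def Poly_Mapping.lookup_sum)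

lemma lookup_lin_ext_superset:
  assumes "finite S" "Poly_Mapping.keys t \<subseteq> S"
  shows "Poly_Mapping.lookup (lin_ext \<phi> t) x =
     (\<Sum>b\<in>S. Poly_Mapping.lookup t b * Poly_Mapping.lookup (\<phi> b) x)"
  unfolding lookup_lin_ext
  by (rule sum.mono_neutral_left) (use assms in \<open>auto simp: in_keys_iff\<close>)

lemma lin_ext_add: "lin_ext \<phi> (s + t) = lin_ext \<phi> s + lin_ext \<phi> t"
proof (rule poly_mapping_eqI)
  fix x
  let ?S = "Poly_Mapping.keys s \<union> Poly_Mapping.keys t"
  have f: "finite ?S" "Poly_Mapping.keys (s + t) \<subseteq> ?S" "Poly_Mapping.keys s \<subseteq> ?S"
      "Poly_Mapping.keys t \<subseteq> ?S"
    using Poly_Mapping.keys_add[of s t] by auto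
  show "Poly_Mapping.lookup (lin_ext \<phi> (s + t)) x =
      Poly_Mapping.lookup (lin_ext \<phi> s + lin_ext \<phi> t) x"
    by (simp add: lookup_lin_ext_superset[OF f(1,2)] lookup_lin_ext_superset[OF f(1,3)]
        lookup_lin_ext_superset[OF f(1,4)] lookup_add sum.distrib algebra_simps)
qed

lemma lin_ext_0 [simp]: "lin_ext \<phi> 0 = 0"
  by (simp add: lin_ext_def)

lemma lin_ext_uminus: "lin_ext \<phi> (- t) = - lin_ext \<phi> t"
  using lin_ext_add[of \<phi> t "- t"] by (simp add: eq_neg_iff_add_eq_0 add.commute)

lemma lin_ext_diff: "lin_ext \<phi> (s - t) = lin_ext \<phi> s - lin_ext \<phi> t"
  using lin_ext_add[of \<phi> s "- t"] by (simp add: lin_ext_uminus)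

lemma lin_ext_single: "lin_ext \<phi> (Poly_Mapping.single b c) = scale c (\<phi> b)"
proof (rule poly_mapping_eqI)
  fix x
  show "Poly_Mapping.lookup (lin_ext \<phi> (Poly_Mapping.single b c)) x =
      Poly_Mapping.lookup (scale c (\<phi> b)) x"
    by (subst lookup_lin_ext_superset[of "{b}"]) (auto simp: lookup_single)
qed

section \<open>Quotients and direct sums of modules\<close>

definition quot_module :: "('a, 'b, 'm) module_scheme \<Rightarrow> 'b set \<Rightarrow> ('a, 'b set) module" where
  "quot_module M H = \<lparr>carrier = A_RCOSETS M H, mult = undefined, one = undefined,
     zero = H, add = set_add M, smult = (\<lambda>c X. \<Union>x\<in>X. a_r_coset M H (c \<odot>\<^bsub>M\<^esub> x))\<rparr>"

definition direct_sum_module :: "('i \<Rightarrow> ('a, 'b) module) \<Rightarrow> ('a, 'i \<Rightarrow> 'b) module" where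
  "direct_sum_module M = \<lparr>
     carrier = {f. (\<forall>i. f i \<in> carrier (M i)) \<and> finite {i. f i \<noteq> \<zero>\<^bsub>M i\<^esub>}},
     mult = undefined, one = undefined,
     zero = (\<lambda>i. \<zero>\<^bsub>M i\<^esub>), add = (\<lambda>f g i. f i \<oplus>\<^bsub>M i\<^esub> g i), smult = (\<lambda>c f i. c \<odot>\<^bsub>M i\<^esub> f i)\<rparr>"

section \<open>Exterior powers\<close>

text \<open>
  The \<open>n\<close>-th tensor power of the space with basis \<open>B\<close> has as basis the lists of length \<open>n\<close>
  over \<open>B\<close>; the exterior power is its quotient by the span of the pure tensors with a repeated factor.
\<close>

definition tensor_power :: "'b set \<Rightarrow> nat \<Rightarrow> (complex, 'b list \<Rightarrow>\<^sub>0 complex) module" where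
  "tensor_power B n = free_module {bs. length bs = n \<and> set bs \<subseteq> B}"

primrec pure_tensor :: "('b \<Rightarrow>\<^sub>0 complex) list \<Rightarrow> ('b list \<Rightarrow>\<^sub>0 complex)" where
  "pure_tensor [] = Poly_Mapping.single [] 1"
| "pure_tensor (v # vs) =
     lin_ext (\<lambda>b. lin_ext (\<lambda>bs. Poly_Mapping.single (b # bs) 1) (pure_tensor vs)) v"

definition alt_relations :: "'b set \<Rightarrow> nat \<Rightarrow> ('b list \<Rightarrow>\<^sub>0 complex) set" where
  "alt_relations B n = LinearCombinations.module.span class_ring (tensor_power B n)
     {pure_tensor vs | vs. length vs = n \<and> set vs \<subseteq> carrier (free_module B) \<and> \<not> distinct vs}"

definition ext_power :: "'b set \<Rightarrow> nat \<Rightarrow> (complex, ('b list \<Rightarrow>\<^sub>0 complex) set) module" where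
  "ext_power B n = quot_module (tensor_power B n) (alt_relations B n)"

definition wedge :: "'b set \<Rightarrow> ('b \<Rightarrow>\<^sub>0 complex) list \<Rightarrow> ('b list \<Rightarrow>\<^sub>0 complex) set" where
  "wedge B vs = a_r_coset (tensor_power B (length vs)) (alt_relations B (length vs)) (pure_tensor vs)"

text \<open>The action of a Lie algebra element on the tensor and exterior powers by the Leibniz rule,
  where \<open>\<phi>\<close> is its action on the space with basis \<open>B\<close>.\<close>

definition tensor_der ::
    "(('b \<Rightarrow>\<^sub>0 complex) \<Rightarrow> ('b \<Rightarrow>\<^sub>0 complex)) \<Rightarrow> ('b list \<Rightarrow>\<^sub>0 complex) \<Rightarrow> ('b list \<Rightarrow>\<^sub>0 complex)" where
  "tensor_der \<phi> = lin_ext (\<lambda>bs. \<Sum>k<length bs.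
     pure_tensor ((map (\<lambda>b. Poly_Mapping.single b 1) bs)[k := \<phi> (Poly_Mapping.single (bs ! k) 1)]))"

definition ext_der :: "'b set \<Rightarrow> nat \<Rightarrow> (('b \<Rightarrow>\<^sub>0 complex) \<Rightarrow> ('b \<Rightarrow>\<^sub>0 complex)) \<Rightarrow>
    ('b list \<Rightarrow>\<^sub>0 complex) set \<Rightarrow> ('b list \<Rightarrow>\<^sub>0 complex) set" where
  "ext_der B n \<phi> X = (\<Union>t\<in>X. a_r_coset (tensor_power B n) (alt_relations B n) (tensor_der \<phi> t))"

section \<open>The algebra generated by \<open>X\<close> and \<open>Y\<close> with \<open>YX - XY = X\<close>\<close>

text \<open>The free algebra on two letters is the monoid algebra \<open>word \<Rightarrow>\<^sub>0 complex\<close> of the free monoid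
  (written additively, as \<^theory>\<open>HOL-Library.Poly_Mapping\<close> requires).\<close>

datatype letter = LX | LY

datatype word = Word "letter list"

instantiation word :: monoid_add
begin

definition zero_word :: word where "zero_word = Word []"

fun plus_word :: "word \<Rightarrow> word \<Rightarrow> word" where "plus_word (Word u) (Word v) = Word (u @ v)"

instance
proof
  fix a b c :: word
  show "a + b + c = a + (b + c)" by (cases a; cases b; cases c) simp
  show "0 + a = a" "a + 0 = a" by (cases a; simp add: zero_word_def)+
qed

end

type_synonym free_alg = "word \<Rightarrow>\<^sub>0 complex"

abbreviation free_X :: free_alg where "free_X \<equiv> Poly_Mapping.single (Word [LX]) 1"
abbreviation free_Y :: free_alg where "free_Y \<equiv> Poly_Mapping.single (Word [LY]) 1"

inductive_set rel_ideal :: "free_alg set" where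
  zero: "0 \<in> rel_ideal"
| add: "q \<in> rel_ideal \<Longrightarrow> q + a * (free_Y * free_X - free_X * free_Y - free_X) * b \<in> rel_ideal"

lemma rel_ideal_add: "p \<in> rel_ideal \<Longrightarrow> q \<in> rel_ideal \<Longrightarrow> p + q \<in> rel_ideal"
proof (induction p rule: rel_ideal.induct)
  case zero
  then show ?case by simp
next
  case (add p a b)
  from rel_ideal.add[OF add.IH[OF add.prems], of a b] show ?case
    by (simp add: ac_simps)
qed

lemma rel_ideal_mult: "p \<in> rel_ideal \<Longrightarrow> c * p * d \<in> rel_ideal"
proof (induction p rule: rel_ideal.induct)
  case zero
  then show ?case by (simp add: rel_ideal.zero)
next
  case (add p a b)
  from rel_ideal.add[OF add.IH, of "c * a" "b * d"] show ?case
    by (simp add: distrib_left distrib_right mult.assoc)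
qed

lemma rel_ideal_mult_left: "p \<in> rel_ideal \<Longrightarrow> c * p \<in> rel_ideal"
  using rel_ideal_mult[of p c 1] by simp

lemma rel_ideal_mult_right: "p \<in> rel_ideal \<Longrightarrow> p * d \<in> rel_ideal"
  using rel_ideal_mult[of p 1 d] by simp

lemma rel_ideal_uminus: "p \<in> rel_ideal \<Longrightarrow> - p \<in> rel_ideal"
  using rel_ideal_mult_left[of p "- 1"] by simp

definition rel_cong :: "free_alg \<Rightarrow> free_alg \<Rightarrow> bool" where
  "rel_cong p q \<longleftrightarrow> p - q \<in> rel_ideal"

lemma rel_cong_equivp: "equivp rel_cong"
proof (rule equivpI)
  show "reflp rel_cong" by (simp add: reflp_def rel_cong_def rel_ideal.zero)
  show "symp rel_cong"
    unfolding symp_def rel_cong_def using rel_ideal_uminus by (metis minus_diff_eq)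
  show "transp rel_cong"
    unfolding transp_def rel_cong_def using rel_ideal_add by (metis diff_add_cancel add_diff_eq)
qed

text \<open>The action on \<open>\<complex>[x, x\<^sup>-\<^sup>1] = int \<Rightarrow>\<^sub>0 complex\<close>: \<open>X\<close> is multiplication by \<open>x\<close> and \<open>Y\<close> is
  \<open>x d/dx\<close>, i.e. \<open>x\<^sup>k \<mapsto> k x\<^sup>k\<close>.\<close>

type_synonym laurent = "int \<Rightarrow>\<^sub>0 complex"

fun letter_act :: "letter \<Rightarrow> laurent \<Rightarrow> laurent" where
  "letter_act LX f = Poly_Mapping.single 1 1 * f"
| "letter_act LY f = Poly_Mapping.mapp (\<lambda>k c. of_int k * c) f"

fun word_act :: "word \<Rightarrow> laurent \<Rightarrow> laurent" where
  "word_act (Word ls) f = foldr letter_act ls f"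

definition free_act :: "free_alg \<Rightarrow> laurent \<Rightarrow> laurent" where
  "free_act p f = lin_ext (\<lambda>w. word_act w f) p"

lemma poly_mapping_single_induct [case_names single add]:
  fixes p :: "'a \<Rightarrow>\<^sub>0 'b::monoid_add"
  assumes single: "\<And>k c. P (Poly_Mapping.single k c)"
    and add: "\<And>p q. P p \<Longrightarrow> P q \<Longrightarrow> P (p + q)"
  shows "P p"
proof (induction p rule: update_induct)
  case const
  from single[of undefined 0] show ?case by simp
next
  case (update f k c)
  have "Poly_Mapping.update k c f = Poly_Mapping.single k c + f"
    using update.hyps
    by (intro poly_mapping_eqI)
      (auto simp: lookup_update lookup_add lookup_single in_keys_iff when_def)
  then show ?case using add[OF single update.IH] by simp
qed

lemma scale_add: "scale c (s + t) = scale c s + scale c t"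
  by (rule poly_mapping_eqI) (simp add: lookup_add distrib_left)

lemma scale_scale: "scale c (scale d t) = scale (c * d) t"
  by (rule poly_mapping_eqI) (simp add: mult.assoc)

lemma scale_single: "scale c (Poly_Mapping.single k d) = Poly_Mapping.single k (c * d)"
  by (rule poly_mapping_eqI) (simp add: lookup_single when_def)

lemma scale_one [simp]: "scale 1 t = t"
  by (rule poly_mapping_eqI) simp

lemma letter_act_add: "letter_act l (f + g) = letter_act l f + letter_act l g"
proof (cases l)
  case LX
  then show ?thesis by (simp add: distrib_left)
next
  case LY
  have "Poly_Mapping.lookup (letter_act LY h) k = of_int k * Poly_Mapping.lookup h k" for h k
    by (simp add: lookup_mapp when_def in_keys_iff)
  with LY show ?thesis
    by (intro poly_mapping_eqI) (simp only: lookup_add distrib_left)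
qed

lemma letter_act_scale: "letter_act l (scale c f) = scale c (letter_act l f)"
proof (cases l)
  case LX
  have "Poly_Mapping.single 1 1 * scale c f = scale c (Poly_Mapping.single 1 1 * f)"
    for f :: laurent
  proof (induction f rule: poly_mapping_single_induct)
    case (single k d)
    show ?case by (simp add: scale_single mult_single)
  next
    case (add p q)
    then show ?case by (simp add: scale_add distrib_left)
  qed
  with LX show ?thesis by simp
next
  case LY
  have "Poly_Mapping.lookup (letter_act LY h) k = of_int k * Poly_Mapping.lookup h k" for h k
    by (simp add: lookup_mapp when_def in_keys_iff)
  with LY show ?thesis
    by (intro poly_mapping_eqI) (simp only: lookup_scale mult.left_commute)
qed

lemma word_act_add: "word_act w (f + g) = word_act w f + word_act w g"
proof (cases w)
  case (Word ls)
  have "foldr letter_act ls (f + g) = foldr letter_act ls f + foldr letter_act ls g"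
    by (induction ls) (simp_all add: letter_act_add)
  with Word show ?thesis by simp
qed

lemma word_act_scale: "word_act w (scale c f) = scale c (word_act w f)"
proof (cases w)
  case (Word ls)
  have "foldr letter_act ls (scale c f) = scale c (foldr letter_act ls f)"
    by (induction ls) (simp_all add: letter_act_scale)
  with Word show ?thesis by simp
qed

lemma word_act_plus: "word_act (u + v) f = word_act u (word_act v f)"
  by (cases u; cases v) simp

lemma free_act_single: "free_act (Poly_Mapping.single w c) f = scale c (word_act w f)"
  by (simp add: free_act_def lin_ext_single)

lemma free_act_add: "free_act (p + q) f = free_act p f + free_act q f"
  by (simp add: free_act_def lin_ext_add)

lemma free_act_diff: "free_act (p - q) f = free_act p f - free_act q f"
  by (simp add: free_act_def lin_ext_diff)

lemma free_act_add_right: "free_act p (f + g) = free_act p f + free_act p g"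
proof (induction p rule: poly_mapping_single_induct)
  case (single k c)
  then show ?case by (simp add: free_act_single word_act_add scale_add)
next
  case (add p q)
  then show ?case by (simp add: free_act_add algebra_simps)
qed

lemma free_act_zero_right [simp]: "free_act p 0 = 0"
  using free_act_add_right[of p 0 0] by simp

lemma free_act_scale_right: "free_act p (scale c f) = scale c (free_act p f)"
proof (induction p rule: poly_mapping_single_induct)
  case (single k d)
  then show ?case by (simp only: free_act_single word_act_scale scale_scale mult.commute[of c d])
next
  case (add p q)
  then show ?case by (simp add: free_act_add scale_add)
qed

lemma free_act_mult: "free_act (p * q) f = free_act p (free_act q f)"
proof (induction p rule: poly_mapping_single_induct)
  case (single u c)
  show ?case
  proof (induction q rule: poly_mapping_single_induct)
    case (single v d)
    show ?case
      by (simp add: mult_single free_act_single word_act_plus word_act_scale scale_scale)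
  next
    case (add p q)
    then show ?case by (simp add: distrib_left free_act_add free_act_add_right)
  qed
next
  case (add p q)
  then show ?case by (simp add: distrib_right free_act_add)
qed

lemma free_act_relation:
  "free_act (free_Y * free_X - free_X * free_Y - free_X) f = 0"
proof -
  have "letter_act LY (letter_act LX f) - letter_act LX (letter_act LY f) - letter_act LX f = 0"
  proof (induction f rule: poly_mapping_single_induct)
    case (single k c)
    have X: "letter_act LX (Poly_Mapping.single j d) = Poly_Mapping.single (1 + j) d" for j d
      by (simp add: mult_single)
    have Y: "letter_act LY (Poly_Mapping.single j d) = Poly_Mapping.single j (of_int j * d)" for j d
      by (rule poly_mapping_eqI) (simp add: lookup_mapp when_def in_keys_iff lookup_single)
    show ?case
      unfolding X Y single_diff[symmetric] by (simp add: algebra_simps)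
  next
    case (add p q)
    have "a - b - c = 0 \<Longrightarrow> a' - b' - c' = 0 \<Longrightarrow> (a + a') - (b + b') - (c + c') = 0"
      for a b c a' b' c' :: laurent
      by (simp add: algebra_simps)
    from this[OF add] show ?case by (simp only: letter_act_add)
  qed
  then show ?thesis
    by (simp add: free_act_diff free_act_mult free_act_single)
qed

lemma free_act_rel_ideal: "p \<in> rel_ideal \<Longrightarrow> free_act p f = 0"
proof (induction p rule: rel_ideal.induct)
  case zero
  show ?case by (simp add: free_act_def)
next
  case (add q a b)
  then show ?case by (simp add: free_act_add free_act_mult free_act_relation)
qed

lemma one_not_in_rel_ideal: "1 \<notin> rel_ideal"
proof
  assume "1 \<in> rel_ideal"
  from free_act_rel_ideal[OF this, of 1] have "free_act (Poly_Mapping.single 0 1) (1 :: laurent) = 0"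
    by simp
  then have "(1 :: laurent) = 0"
    unfolding free_act_single by (simp add: zero_word_def)
  then show False by simp
qed

quotient_type xy_alg = free_alg / rel_cong
  by (rule rel_cong_equivp)

instantiation xy_alg :: ring_1
begin

lift_definition zero_xy_alg :: xy_alg is 0 .
lift_definition one_xy_alg :: xy_alg is 1 .
lift_definition plus_xy_alg :: "xy_alg \<Rightarrow> xy_alg \<Rightarrow> xy_alg" is "(+)"
  unfolding rel_cong_def using rel_ideal_add by (metis add_diff_add)
lift_definition minus_xy_alg :: "xy_alg \<Rightarrow> xy_alg \<Rightarrow> xy_alg" is "(-)"
  unfolding rel_cong_def using rel_ideal_add[OF _ rel_ideal_uminus]
  by (metis (no_types, opaque_lifting) add_diff_add diff_conv_add_uminus minus_diff_minus)
lift_definition uminus_xy_alg :: "xy_alg \<Rightarrow> xy_alg" is uminus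
  unfolding rel_cong_def using rel_ideal_uminus by (metis minus_diff_minus)
lift_definition times_xy_alg :: "xy_alg \<Rightarrow> xy_alg \<Rightarrow> xy_alg" is "(*)"
proof -
  fix p p' q q' assume "rel_cong p p'" "rel_cong q q'"
  then have "(p - p') * q \<in> rel_ideal" "p' * (q - q') \<in> rel_ideal"
    by (simp_all add: rel_cong_def rel_ideal_mult_left rel_ideal_mult_right)
  from rel_ideal_add[OF this] show "rel_cong (p * q) (p' * q')"
    by (simp add: rel_cong_def algebra_simps)
qed

instance
proof
  show "(0 :: xy_alg) \<noteq> 1"
  proof (transfer, simp add: rel_cong_def)
    show "- 1 \<notin> rel_ideal" using one_not_in_rel_ideal rel_ideal_uminus by fastforce
  qed
qed (transfer, simp add: rel_cong_def rel_ideal.zero algebra_simps)+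

end

lift_definition gen_X :: xy_alg is free_X .
lift_definition gen_Y :: xy_alg is free_Y .
lift_definition const_xy :: "complex \<Rightarrow> xy_alg" is "\<lambda>c. Poly_Mapping.single 0 c" .

lift_definition laurent_act :: "xy_alg \<Rightarrow> laurent \<Rightarrow> laurent" is free_act
  unfolding rel_cong_def using free_act_rel_ideal by (metis free_act_diff ext eq_iff_diff_eq_0)

lemma gen_relation: "gen_Y * gen_X - gen_X * gen_Y = gen_X"
  by transfer (use rel_ideal.add[OF rel_ideal.zero, of 1 1] in \<open>simp add: rel_cong_def\<close>)

section \<open>The Lie algebras \<open>gl\<^sub>r \<otimes> \<complex>[x,y]\<close> and \<open>gl\<^sub>r \<otimes> \<complex>\<langle>X,Y\<rangle>\<close>\<close>

text \<open>
  Both are realised as Lie algebras of \<open>r \<times> r\<close> matrices under the commutator, with indices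
  \<open>0, \<dots>, r - 1\<close>. The ring \<open>\<complex>[x,y]\<close> is \<open>\<complex>[x][y]\<close>: the coefficient of \<open>x\<^sup>i y\<^sup>j\<close> in \<open>P\<close> is
  \<open>coeff (coeff P j) i\<close>.
\<close>

type_synonym poly2 = "complex poly poly"

definition mat_unit :: "nat \<Rightarrow> nat \<Rightarrow> nat \<Rightarrow> 'a::zero \<Rightarrow> 'a mat" where
  "mat_unit r i j P = mat r r (\<lambda>(k, l). if k = i \<and> l = j then P else 0)"

text \<open>The elements \<open>mat_unit r i j P\<close> are \<open>E\<^sub>i\<^sub>j \<otimes> P\<close>. The span defining \<open>filt_G r n\<close>, which stands for
  \<open>F\<^sup>n(gl\<^sub>r \<otimes> \<complex>\<langle>X,Y\<rangle>)\<close>, needs no explicit scalars because they can be absorbed into \<open>g\<close>.\<close>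

inductive_set filt_G :: "nat \<Rightarrow> nat \<Rightarrow> xy_alg mat set" for r n where
  zero: "0\<^sub>m r r \<in> filt_G r n"
| add: "A \<in> filt_G r n \<Longrightarrow> g \<in> carrier_mat r r \<Longrightarrow> j \<le> n \<Longrightarrow>
    A + map_mat (\<lambda>c. const_xy c * gen_X ^ i * gen_Y ^ j) g \<in> filt_G r n"

locale g_module = vectorspace "class_ring :: complex ring" M
  for r :: nat and M :: "(complex, 'v) module" (structure) and \<rho> :: "poly2 mat \<Rightarrow> 'v \<Rightarrow> 'v" +
  assumes act_closed: "a \<in> carrier_mat r r \<Longrightarrow> v \<in> carrier M \<Longrightarrow> \<rho> a v \<in> carrier M"
    and act_add: "a \<in> carrier_mat r r \<Longrightarrow> v \<in> carrier M \<Longrightarrow> w \<in> carrier M \<Longrightarrow>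
      \<rho> a (v \<oplus> w) = \<rho> a v \<oplus> \<rho> a w"
    and act_smult: "a \<in> carrier_mat r r \<Longrightarrow> v \<in> carrier M \<Longrightarrow> \<rho> a (c \<odot>\<^bsub>M\<^esub> v) = c \<odot>\<^bsub>M\<^esub> \<rho> a v"
    and add_act: "a \<in> carrier_mat r r \<Longrightarrow> b \<in> carrier_mat r r \<Longrightarrow> v \<in> carrier M \<Longrightarrow>
      \<rho> (a + b) v = \<rho> a v \<oplus> \<rho> b v"
    and smult_act: "a \<in> carrier_mat r r \<Longrightarrow> v \<in> carrier M \<Longrightarrow>
      \<rho> ([:[:c:]:] \<cdot>\<^sub>m a) v = c \<odot>\<^bsub>M\<^esub> \<rho> a v"
    and bracket_act: "a \<in> carrier_mat r r \<Longrightarrow> b \<in> carrier_mat r r \<Longrightarrow> v \<in> carrier M \<Longrightarrow>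
      \<rho> (a * b - b * a) v = \<rho> a (\<rho> b v) \<ominus> \<rho> b (\<rho> a v)"

definition g_hom :: "nat \<Rightarrow> (complex, 'v) module \<Rightarrow> (poly2 mat \<Rightarrow> 'v \<Rightarrow> 'v) \<Rightarrow>
    (complex, 'w) module \<Rightarrow> (poly2 mat \<Rightarrow> 'w \<Rightarrow> 'w) \<Rightarrow> ('v \<Rightarrow> 'w) \<Rightarrow> bool" where
  "g_hom r M \<rho> M' \<rho>' f \<longleftrightarrow> g_module r M \<rho> \<and> g_module r M' \<rho>' \<and>
     f \<in> LinearCombinations.module_hom class_ring M M' \<and>
     (\<forall>a\<in>carrier_mat r r. \<forall>v\<in>carrier M. f (\<rho> a v) = \<rho>' a (f v))"

definition generated_by :: "nat \<Rightarrow> (complex, 'v) module \<Rightarrow> (poly2 mat \<Rightarrow> 'v \<Rightarrow> 'v) \<Rightarrow> 'v \<Rightarrow> bool" where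
  "generated_by r M \<rho> v \<longleftrightarrow> v \<in> carrier M \<and>
     (\<forall>S. LinearCombinations.submodule class_ring S M \<and> v \<in> S \<and>
        (\<forall>a\<in>carrier_mat r r. \<forall>w\<in>S. \<rho> a w \<in> S) \<longrightarrow> S = carrier M)"

section \<open>Weyl modules\<close>

text \<open>A partition with \<open>r\<close> parts (zeros allowed) is a weakly decreasing list of length \<open>r\<close>.\<close>

definition fd_hw_module ::
    "nat list \<Rightarrow> (complex, 'v) module \<Rightarrow> (poly2 mat \<Rightarrow> 'v \<Rightarrow> 'v) \<Rightarrow> 'v \<Rightarrow> bool" where
  "fd_hw_module \<xi> M \<rho> v \<longleftrightarrow> (let r = length \<xi> in
     g_module r M \<rho> \<and> vectorspace.fin_dim class_ring M \<and> generated_by r M \<rho> v \<and>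
     (\<forall>i<r. \<forall>P. \<rho> (mat_unit r i i P) v = (of_nat (\<xi> ! i) * poly (poly P 0) 0) \<odot>\<^bsub>M\<^esub> v) \<and>
     (\<forall>i j P. i < j \<and> j < r \<longrightarrow> \<rho> (mat_unit r i j P) v = \<zero>\<^bsub>M\<^esub>))"

text \<open>
  The maximal such module: every other one is a quotient of it, compatibly with the generators.
  The competitors \<open>M\<close> have their carriers in the type \<^typ>\<open>complex vec\<close>; this is no restriction,
  because every finite-dimensional complex vector space is isomorphic to some \<open>\<complex>\<^sup>n\<close>.
\<close>

definition weyl_module ::
    "nat list \<Rightarrow> (complex, 'w) module \<Rightarrow> (poly2 mat \<Rightarrow> 'w \<Rightarrow> 'w) \<Rightarrow> 'w \<Rightarrow> bool" where
  "weyl_module \<xi> W \<rho> w \<longleftrightarrow> fd_hw_module \<xi> W \<rho> w \<and>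
     (\<forall>(M :: (complex, complex vec) module) \<sigma> v. fd_hw_module \<xi> M \<sigma> v \<longrightarrow>
        (\<exists>f. g_hom (length \<xi>) W \<rho> M \<sigma> f \<and> f ` carrier W = carrier M \<and> f w = v))"

section \<open>The module \<open>V(\<xi>)\<close>\<close>

text \<open>
  The space \<open>V\<^sub>r\<^sup>(\<^sup>N\<^sup>) = V\<^sub>r \<otimes> (\<complex>[x, x\<^sup>-\<^sup>1] / x\<^sup>N \<complex>[x])\<close> is given by its basis \<open>u\<^sub>j \<otimes> x\<^sup>i\<close>, \<open>j < r\<close>, \<open>i < N\<close>,
  encoded as the pairs \<open>(j, i)\<close>; passing to the quotient discards the exponents \<open>k \<ge> N\<close>.
  A matrix \<open>a\<close> maps \<open>u\<^sub>q \<otimes> x\<^sup>i\<close> to the sum of all \<open>u\<^sub>p \<otimes> a\<^sub>p\<^sub>q x\<^sup>i\<close>.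
\<close>

definition V_basis :: "nat \<Rightarrow> int \<Rightarrow> (nat \<times> int) set" where
  "V_basis r N = {(j, i). j < r \<and> i < N}"

definition V_act :: "int \<Rightarrow> xy_alg mat \<Rightarrow> (nat \<times> int \<Rightarrow>\<^sub>0 complex) \<Rightarrow> (nat \<times> int \<Rightarrow>\<^sub>0 complex)" where
  "V_act N a = lin_ext (\<lambda>(q, i). \<Sum>p<dim_row a. lin_ext
     (\<lambda>k. if k < N then Poly_Mapping.single (p, k) 1 else 0)
     (laurent_act (a $$ (p, q)) (Poly_Mapping.single i 1)))"

abbreviation wedge_space :: "nat list \<Rightarrow> int \<Rightarrow>
    (complex, ((nat \<times> int) list \<Rightarrow>\<^sub>0 complex) set) module" where
  "wedge_space \<xi> N \<equiv> ext_power (V_basis (length \<xi>) N) (sum_list \<xi>)"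

definition wedge_act :: "nat list \<Rightarrow> int \<Rightarrow> xy_alg mat \<Rightarrow>
    ((nat \<times> int) list \<Rightarrow>\<^sub>0 complex) set \<Rightarrow> ((nat \<times> int) list \<Rightarrow>\<^sub>0 complex) set" where
  "wedge_act \<xi> N a = ext_der (V_basis (length \<xi>) N) (sum_list \<xi>) (V_act N a)"

definition v_vec :: "nat list \<Rightarrow> int \<Rightarrow> ((nat \<times> int) list \<Rightarrow>\<^sub>0 complex) set" where
  "v_vec \<xi> N = wedge (V_basis (length \<xi>) N)
     (concat (map (\<lambda>j. map (\<lambda>i. Poly_Mapping.single (j, i) 1) [N - int (\<xi> ! j)..N - 1])
        [0..<length \<xi>]))"

text \<open>\<open>F\<^sup>m \<V>(\<xi>,N) = U\<^sup>\<le>\<^sup>m v\<close> is spanned by the vectors \<open>a\<^sub>1 \<cdots> a\<^sub>k v\<close> with \<open>a\<^sub>i \<in> F\<^bsup>m\<^sub>i\<^esup>\<close> and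
  \<open>m\<^sub>1 + \<cdots> + m\<^sub>k \<le> m\<close>.\<close>

definition filt_V :: "nat list \<Rightarrow> int \<Rightarrow> nat \<Rightarrow> ((nat \<times> int) list \<Rightarrow>\<^sub>0 complex) set set" where
  "filt_V \<xi> N m = LinearCombinations.module.span class_ring (wedge_space \<xi> N)
     {foldr (wedge_act \<xi> N) as (v_vec \<xi> N) | as ms.
        list_all2 (\<lambda>a k. a \<in> filt_G (length \<xi>) k) as ms \<and> sum_list ms \<le> m}"

definition filt_V_pred :: "nat list \<Rightarrow> int \<Rightarrow> nat \<Rightarrow> ((nat \<times> int) list \<Rightarrow>\<^sub>0 complex) set set" where
  "filt_V_pred \<xi> N m = (case m of 0 \<Rightarrow> {\<zero>\<^bsub>wedge_space \<xi> N\<^esub>} | Suc k \<Rightarrow> filt_V \<xi> N k)"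

definition gr_V :: "nat list \<Rightarrow> int \<Rightarrow> nat \<Rightarrow>
    (complex, ((nat \<times> int) list \<Rightarrow>\<^sub>0 complex) set set) module" where
  "gr_V \<xi> N m = quot_module ((wedge_space \<xi> N)\<lparr>carrier := filt_V \<xi> N m\<rparr>) (filt_V_pred \<xi> N m)"

definition V_module :: "nat list \<Rightarrow> int \<Rightarrow>
    (complex, nat \<Rightarrow> ((nat \<times> int) list \<Rightarrow>\<^sub>0 complex) set set) module" where
  "V_module \<xi> N = direct_sum_module (gr_V \<xi> N)"

text \<open>
  The identification of \<open>\<complex>[x,y]\<close>-matrices with the associated graded Lie algebra sends
  \<open>g \<otimes> x\<^sup>i y\<^sup>b\<close> to the class of \<open>g \<otimes> X\<^sup>i Y\<^sup>b\<close> in degree \<open>b\<close>: \<open>lift_deg b a\<close> represents the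
  component of \<open>a\<close> in degree \<open>b\<close>. It maps the class of \<open>w\<close> in degree \<open>m\<close> to the class of
  \<open>lift_deg b a \<cdot> w\<close> in degree \<open>m + b\<close>.
\<close>

definition lift_deg :: "nat \<Rightarrow> poly2 mat \<Rightarrow> xy_alg mat" where
  "lift_deg b = map_mat (\<lambda>P. \<Sum>i\<le>degree (coeff P b).
     const_xy (coeff (coeff P b) i) * gen_X ^ i * gen_Y ^ b)"

definition V_module_act :: "nat list \<Rightarrow> int \<Rightarrow> poly2 mat \<Rightarrow>
    (nat \<Rightarrow> ((nat \<times> int) list \<Rightarrow>\<^sub>0 complex) set set) \<Rightarrow>
    (nat \<Rightarrow> ((nat \<times> int) list \<Rightarrow>\<^sub>0 complex) set set)" where
  "V_module_act \<xi> N a f = (\<lambda>m. \<Oplus>\<^bsub>gr_V \<xi> N m\<^esub>b\<in>{..m}.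
     (\<Union>w\<in>f (m - b). a_r_coset (wedge_space \<xi> N) (filt_V_pred \<xi> N m) (wedge_act \<xi> N (lift_deg b a) w)))"

definition V_cyclic :: "nat list \<Rightarrow> int \<Rightarrow> nat \<Rightarrow> ((nat \<times> int) list \<Rightarrow>\<^sub>0 complex) set set" where
  "V_cyclic \<xi> N = (\<lambda>m. if m = 0 then a_r_coset (wedge_space \<xi> N) (filt_V_pred \<xi> N 0) (v_vec \<xi> N)
     else \<zero>\<^bsub>gr_V \<xi> N m\<^esub>)"

end

theory Submission
  imports Defs
begin

text \<open>
  By its maximality, the Weyl module maps onto every finite-dimensional \<open>gl\<^sub>r \<otimes> \<complex>[x,y]\<close>-module that is
  generated by a vector satisfying the relations of \<open>v\<^sub>\<xi>\<close>, and the map is determined by the image of the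
  generator. So the statement amounts to four properties of \<open>V(\<xi>)\<close>.

  It is a module (\<open>g_module_V_module\<close>): \<open>\<G>\<^sub>r\<close> acts on the exterior power by derivations, and the
  commutator of \<open>\<G>\<^sub>r\<close> agrees with that of \<open>gl\<^sub>r \<otimes> \<complex>[x,y]\<close> up to terms of lower degree in \<open>Y\<close>, because
  moving \<open>Y\<close> past a polynomial in \<open>X\<close> costs only such terms (\<open>symbol_mult\<close>,
  \<open>act_lift_deg_commutator\<close>). These terms vanish in the associated graded module.

  It is finite-dimensional (\<open>fin_dim_V_module\<close>): \<open>X\<close> and \<open>Y\<close> never lower the exponent of \<open>x\<close>, and
  exponents from \<open>N\<close> on are discarded, so only finitely many basis tensors can be reached from
  \<open>v\<^sub>\<xi>\<close> (\<open>finite_dimensional_stable_subspace\<close>).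

  It is generated by the class of \<open>v\<^sub>\<xi>\<close> (\<open>generated_by_V_cyclic\<close>), since \<open>\<V>(\<xi>,N)\<close> is generated by \<open>v\<^sub>\<xi>\<close>
  and its filtration is induced from that of \<open>\<G>\<^sub>r\<close>.

  The class of \<open>v\<^sub>\<xi>\<close> satisfies the relations (\<open>cartan_act_V_cyclic\<close>, \<open>nilpotent_act_V_cyclic\<close>):
  \<open>E\<^sub>i\<^sub>j \<otimes> X\<^sup>kY\<^sup>b\<close> replaces a factor \<open>u\<^sub>j \<otimes> x\<^sup>s\<close> by a multiple of \<open>u\<^sub>i \<otimes> x\<^sup>s\<^sup>+\<^sup>k\<close>. If \<open>\<xi>\<^sub>j \<le> \<xi>\<^sub>i\<close>, the latter is
  \<open>0\<close> or already a factor of \<open>v\<^sub>\<xi>\<close>, so the wedge product vanishes unless \<open>i = j\<close> and \<open>k = 0\<close>. In that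
  case \<open>v\<^sub>\<xi>\<close> is an eigenvector, with eigenvalue \<open>\<xi>\<^sub>i\<close> for \<open>b = 0\<close>; for \<open>b > 0\<close> its multiples vanish in
  degree \<open>b\<close> of the graded module.

  The maximality of the Weyl module is stated for modules whose carriers lie in one fixed type;
  \<open>weyl_module_surjects\<close> extends it to all types by transport of structure.
\<close>

section \<open>Linear algebra of finitely supported functions\<close>

interpretation pm: vector_space "scale :: complex \<Rightarrow> ('b \<Rightarrow>\<^sub>0 complex) \<Rightarrow> _"
  by unfold_locales
    (auto simp: scale_add scale_scale intro!: poly_mapping_eqI simp: lookup_add algebra_simps)

interpretation pm: vector_space_pair "scale :: complex \<Rightarrow> ('b \<Rightarrow>\<^sub>0 complex) \<Rightarrow> _"
    "scale :: complex \<Rightarrow> ('c \<Rightarrow>\<^sub>0 complex) \<Rightarrow> _"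
  by unfold_locales

abbreviation lin_map :: "(('b \<Rightarrow>\<^sub>0 complex) \<Rightarrow> ('c \<Rightarrow>\<^sub>0 complex)) \<Rightarrow> bool" where
  "lin_map \<equiv> Vector_Spaces.linear scale scale"

abbreviation basis_vec :: "'b \<Rightarrow> ('b \<Rightarrow>\<^sub>0 complex)" where
  "basis_vec b \<equiv> Poly_Mapping.single b 1"

lemma lin_mapI:
  assumes "\<And>s t. \<phi> (s + t) = \<phi> s + \<phi> t" "\<And>c t. \<phi> (scale c t) = scale c (\<phi> t)"
  shows "lin_map \<phi>"
  using assms by (simp add: Vector_Spaces.linear_iff pm.vector_space_axioms)

lemma lin_ext_scale: "lin_ext \<phi> (scale c t) = scale c (lin_ext \<phi> t)"
proof (induction t rule: poly_mapping_single_induct)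
  case (single k d)
  show ?case by (simp add: scale_single lin_ext_single scale_scale)
qed (simp add: scale_add lin_ext_add)

lemma lin_map_lin_ext: "lin_map (lin_ext \<phi>)"
  by (intro lin_mapI lin_ext_add lin_ext_scale)

lemma lin_map_eq_lin_ext:
  assumes "lin_map \<phi>"
  shows "\<phi> t = lin_ext (\<lambda>b. \<phi> (basis_vec b)) t"
proof (induction t rule: poly_mapping_single_induct)
  case (single k d)
  have "\<phi> (Poly_Mapping.single k d) = \<phi> (scale d (basis_vec k))" by (simp add: scale_single)
  also have "\<dots> = scale d (\<phi> (basis_vec k))" by (rule pm.linear_scale[OF assms])
  finally show ?case by (simp add: lin_ext_single)
qed (simp add: lin_ext_add pm.linear_add[OF assms])

lemma lin_map_cong_basis:
  assumes "lin_map \<phi>" "lin_map \<psi>" "\<And>b. b \<in> Poly_Mapping.keys t \<Longrightarrow> \<phi> (basis_vec b) = \<psi> (basis_vec b)"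
  shows "\<phi> t = \<psi> t"
  unfolding lin_map_eq_lin_ext[OF assms(1), of t] lin_map_eq_lin_ext[OF assms(2), of t]
  by (simp add: lin_ext_def assms(3))

lemma lin_map_single:
  assumes "lin_map \<phi>"
  shows "\<phi> (Poly_Mapping.single k c) = scale c (\<phi> (basis_vec k))"
  using pm.linear_scale[OF assms, of c "basis_vec k"] by (simp add: scale_single)

lemma keys_scale: "Poly_Mapping.keys (scale c t) \<subseteq> Poly_Mapping.keys t"
  by (auto simp: in_keys_iff)

lemma keys_lin_ext:
  assumes "\<And>b. b \<in> Poly_Mapping.keys t \<Longrightarrow> Poly_Mapping.keys (\<phi> b) \<subseteq> B"
  shows "Poly_Mapping.keys (lin_ext \<phi> t) \<subseteq> B"
proof -
  have "Poly_Mapping.keys (lin_ext \<phi> t) \<subseteq>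
      (\<Union>b\<in>Poly_Mapping.keys t. Poly_Mapping.keys (scale (Poly_Mapping.lookup t b) (\<phi> b)))"
    unfolding lin_ext_def by (rule Poly_Mapping.keys_sum)
  also have "\<dots> \<subseteq> B"
    by (intro UN_least order_trans[OF keys_scale] assms)
  finally show ?thesis .
qed

section \<open>Tensor powers and derivations\<close>

definition cons_tensor ::
    "('b \<Rightarrow>\<^sub>0 complex) \<Rightarrow> ('b list \<Rightarrow>\<^sub>0 complex) \<Rightarrow> ('b list \<Rightarrow>\<^sub>0 complex)" where
  "cons_tensor v t = lin_ext (\<lambda>b. lin_ext (\<lambda>bs. basis_vec (b # bs)) t) v"

lemma pure_tensor_Cons: "pure_tensor (v # vs) = cons_tensor v (pure_tensor vs)"
  by (simp add: cons_tensor_def)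

lemma cons_tensor_add_left: "cons_tensor (v + w) t = cons_tensor v t + cons_tensor w t"
  by (simp add: cons_tensor_def lin_ext_add)

lemma cons_tensor_scale_left: "cons_tensor (scale c v) t = scale c (cons_tensor v t)"
  by (simp add: cons_tensor_def lin_ext_scale)

lemma cons_tensor_add_right: "cons_tensor v (s + t) = cons_tensor v s + cons_tensor v t"
  by (simp add: cons_tensor_def lin_ext_def[of _ v] lin_ext_add scale_add sum.distrib)

lemma cons_tensor_scale_right: "cons_tensor v (scale c t) = scale c (cons_tensor v t)"
  by (simp add: cons_tensor_def lin_ext_def[of _ v] lin_ext_scale pm.scale_sum_right
      scale_scale mult.commute)

lemma lin_map_cons_tensor_left: "lin_map (\<lambda>v. cons_tensor v t)"
  by (intro lin_mapI cons_tensor_add_left cons_tensor_scale_left)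

lemma lin_map_cons_tensor_right: "lin_map (cons_tensor v)"
  by (intro lin_mapI cons_tensor_add_right cons_tensor_scale_right)

lemmas cons_tensor_zero_right [simp] = pm.linear_0[OF lin_map_cons_tensor_right]
lemmas cons_tensor_diff_left = pm.linear_diff[OF lin_map_cons_tensor_left]
lemmas cons_tensor_diff_right = pm.linear_diff[OF lin_map_cons_tensor_right]
lemmas cons_tensor_sum_right = pm.linear_sum[OF lin_map_cons_tensor_right]

lemma cons_tensor_basis: "cons_tensor (basis_vec b) (basis_vec bs) = basis_vec (b # bs)"
  by (simp add: cons_tensor_def lin_ext_single)

lemma keys_cons_tensor:
  "Poly_Mapping.keys (cons_tensor v t) \<subseteq>
     {b # bs | b bs. b \<in> Poly_Mapping.keys v \<and> bs \<in> Poly_Mapping.keys t}"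
  unfolding cons_tensor_def by (intro keys_lin_ext) auto

lemma keys_pure_tensor:
  assumes "\<And>v. v \<in> set vs \<Longrightarrow> Poly_Mapping.keys v \<subseteq> B"
  shows "Poly_Mapping.keys (pure_tensor vs) \<subseteq> {bs. length bs = length vs \<and> set bs \<subseteq> B}"
  using assms
proof (induction vs)
  case (Cons v vs)
  then have "Poly_Mapping.keys (pure_tensor vs) \<subseteq> {bs. length bs = length vs \<and> set bs \<subseteq> B}"
      "Poly_Mapping.keys v \<subseteq> B" by auto
  then show ?case using keys_cons_tensor[of v "pure_tensor vs"] unfolding pure_tensor_Cons by fastforce
qed simp

lemma pure_tensor_basis: "pure_tensor (map basis_vec bs) = basis_vec bs"
proof (induction bs)
  case (Cons b bs)
  then show ?case using cons_tensor_basis[of b bs] by (simp del: pure_tensor.simps add: pure_tensor_Cons)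
qed simp

lemma pure_tensor_update_add:
  "k < length vs \<Longrightarrow>
     pure_tensor (vs[k := v + w]) = pure_tensor (vs[k := v]) + pure_tensor (vs[k := w])"
proof (induction vs arbitrary: k)
  case (Cons u us)
  then show ?case
    by (cases k) (simp_all del: pure_tensor.simps
        add: pure_tensor_Cons cons_tensor_add_left cons_tensor_add_right)
qed simp

lemma pure_tensor_update_scale:
  "k < length vs \<Longrightarrow> pure_tensor (vs[k := scale c v]) = scale c (pure_tensor (vs[k := v]))"
proof (induction vs arbitrary: k)
  case (Cons u us)
  then show ?case
    by (cases k) (simp_all del: pure_tensor.simps
        add: pure_tensor_Cons cons_tensor_scale_left cons_tensor_scale_right)
qed simp

lemma pure_tensor_update_zero: "k < length vs \<Longrightarrow> pure_tensor (vs[k := 0]) = 0"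
  using pure_tensor_update_scale[of k vs 0 0] by simp

lemma lin_map_tensor_der: "lin_map (tensor_der \<phi>)"
  unfolding tensor_der_def by (rule lin_map_lin_ext)

lemmas tensor_der_add = pm.linear_add[OF lin_map_tensor_der]
lemmas tensor_der_scale = pm.linear_scale[OF lin_map_tensor_der]
lemmas tensor_der_zero = pm.linear_0[OF lin_map_tensor_der]

lemma tensor_der_basis:
  "tensor_der \<phi> (basis_vec bs) =
     (\<Sum>k<length bs. pure_tensor ((map basis_vec bs)[k := \<phi> (basis_vec (bs ! k))]))"
  by (simp add: tensor_der_def lin_ext_single)

lemma tensor_der_Nil [simp]: "tensor_der \<phi> (basis_vec []) = 0"
  by (simp add: tensor_der_basis)

lemma tensor_der_basis_Cons:
  "tensor_der \<phi> (basis_vec (b # bs)) =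
     cons_tensor (\<phi> (basis_vec b)) (basis_vec bs) +
     cons_tensor (basis_vec b) (tensor_der \<phi> (basis_vec bs))"
  unfolding tensor_der_basis
  by (simp del: pure_tensor.simps sum.lessThan_Suc
      add: sum.lessThan_Suc_shift pure_tensor_Cons pure_tensor_basis cons_tensor_sum_right)

text \<open>The Leibniz rule for a single tensor factor: identities between derivations follow from it by
  induction on the number of factors.\<close>

lemma tensor_der_cons_tensor:
  assumes \<phi>: "lin_map \<phi>"
  shows "tensor_der \<phi> (cons_tensor v t) = cons_tensor (\<phi> v) t + cons_tensor v (tensor_der \<phi> t)"
proof (induction v rule: poly_mapping_single_induct)
  case (single b c)
  show ?case
  proof (induction t rule: poly_mapping_single_induct)
    case (single bs d)
    have "cons_tensor (Poly_Mapping.single b c) (Poly_Mapping.single bs d) =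
        scale (c * d) (basis_vec (b # bs))"
      using cons_tensor_basis[of b bs] cons_tensor_scale_left[of c "basis_vec b"]
        cons_tensor_scale_right[of _ d "basis_vec bs"]
      by (simp add: scale_single scale_scale ac_simps)
    moreover have "tensor_der \<phi> (Poly_Mapping.single bs d) = scale d (tensor_der \<phi> (basis_vec bs))"
      by (rule lin_map_single[OF lin_map_tensor_der])
    moreover have "Poly_Mapping.single bs d = scale d (basis_vec bs)"
      "Poly_Mapping.single b c = scale c (basis_vec b)" by (simp_all add: scale_single)
    ultimately show ?case
      by (simp only: tensor_der_scale tensor_der_basis_Cons pm.linear_scale[OF \<phi>]
          cons_tensor_scale_left cons_tensor_scale_right scale_add scale_scale mult.commute)
  qed (simp add: cons_tensor_add_right tensor_der_add algebra_simps)
qed (simp add: cons_tensor_add_left tensor_der_add pm.linear_add[OF \<phi>] algebra_simps)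

lemma tensor_der_pure_tensor:
  assumes \<phi>: "lin_map \<phi>"
  shows "tensor_der \<phi> (pure_tensor vs) = (\<Sum>k<length vs. pure_tensor (vs[k := \<phi> (vs ! k)]))"
proof (induction vs)
  case (Cons v vs)
  then show ?case
    by (simp del: pure_tensor.simps sum.lessThan_Suc
      add: sum.lessThan_Suc_shift pure_tensor_Cons cons_tensor_sum_right tensor_der_cons_tensor[OF \<phi>])
qed simp

lemma keys_tensor_der:
  assumes "\<And>b. b \<in> B \<Longrightarrow> Poly_Mapping.keys (\<phi> (basis_vec b)) \<subseteq> B"
    and "Poly_Mapping.keys t \<subseteq> {bs. length bs = n \<and> set bs \<subseteq> B}"
  shows "Poly_Mapping.keys (tensor_der \<phi> t) \<subseteq> {bs. length bs = n \<and> set bs \<subseteq> B}"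
  unfolding tensor_der_def
proof (rule keys_lin_ext)
  fix bs assume "bs \<in> Poly_Mapping.keys t"
  then have bs: "length bs = n" "set bs \<subseteq> B" using assms(2) by auto
  have "Poly_Mapping.keys (pure_tensor ((map basis_vec bs)[k := \<phi> (basis_vec (bs ! k))]))
      \<subseteq> {bs. length bs = n \<and> set bs \<subseteq> B}" if "k < length bs" for k
  proof -
    let ?vs = "(map basis_vec bs)[k := \<phi> (basis_vec (bs ! k))]"
    have "Poly_Mapping.keys (pure_tensor ?vs) \<subseteq> {cs. length cs = length ?vs \<and> set cs \<subseteq> B}"
    proof (rule keys_pure_tensor)
      fix v assume "v \<in> set ?vs"
      then have "v \<in> insert (\<phi> (basis_vec (bs ! k))) (basis_vec ` set bs)"
        using set_update_subset_insert[of "map basis_vec bs" k "\<phi> (basis_vec (bs ! k))"] by auto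
      moreover have "Poly_Mapping.keys (\<phi> (basis_vec (bs ! k))) \<subseteq> B"
        using assms(1) bs(2) nth_mem[OF that] by blast
      ultimately show "Poly_Mapping.keys v \<subseteq> B" using bs(2) by auto
    qed
    then show ?thesis using bs by simp
  qed
  then show "Poly_Mapping.keys (\<Sum>k<length bs.
      pure_tensor ((map basis_vec bs)[k := \<phi> (basis_vec (bs ! k))])) \<subseteq> {bs. length bs = n \<and> set bs \<subseteq> B}"
    by (intro order_trans[OF Poly_Mapping.keys_sum] UN_least) simp
qed

lemma tensor_der_plus:
  assumes "\<And>b. b \<in> B \<Longrightarrow> \<chi> (basis_vec b) = \<phi> (basis_vec b) + \<psi> (basis_vec b)"
    and "Poly_Mapping.keys t \<subseteq> lists B"
  shows "tensor_der \<chi> t = tensor_der \<phi> t + tensor_der \<psi> t"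
proof (rule lin_map_cong_basis[where \<psi> = "\<lambda>t. tensor_der \<phi> t + tensor_der \<psi> t"])
  show "lin_map (\<lambda>t. tensor_der \<phi> t + tensor_der \<psi> t)"
    by (intro pm.linear_compose_add lin_map_tensor_der)
  fix bs assume "bs \<in> Poly_Mapping.keys t"
  with assms(2) have "bs \<in> lists B" by blast
  then show "tensor_der \<chi> (basis_vec bs) = tensor_der \<phi> (basis_vec bs) + tensor_der \<psi> (basis_vec bs)"
    by (induction bs) (simp_all add: tensor_der_basis_Cons assms(1) cons_tensor_add_left
        cons_tensor_add_right)
qed (rule lin_map_tensor_der)

lemma tensor_der_smult:
  assumes "\<And>b. b \<in> B \<Longrightarrow> \<chi> (basis_vec b) = scale c (\<phi> (basis_vec b))"
    and "Poly_Mapping.keys t \<subseteq> lists B"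
  shows "tensor_der \<chi> t = scale c (tensor_der \<phi> t)"
proof (rule lin_map_cong_basis[where \<psi> = "\<lambda>t. scale c (tensor_der \<phi> t)"])
  show "lin_map (\<lambda>t. scale c (tensor_der \<phi> t))"
    by (intro pm.linear_compose_scale_right lin_map_tensor_der)
  fix bs assume "bs \<in> Poly_Mapping.keys t"
  with assms(2) have "bs \<in> lists B" by blast
  then show "tensor_der \<chi> (basis_vec bs) = scale c (tensor_der \<phi> (basis_vec bs))"
    by (induction bs) (simp_all add: tensor_der_basis_Cons assms(1) cons_tensor_scale_left
        cons_tensor_scale_right scale_add)
qed (rule lin_map_tensor_der)

lemma tensor_der_commutator:
  assumes \<phi>: "lin_map \<phi>" and \<psi>: "lin_map \<psi>"
    and "\<And>b. b \<in> B \<Longrightarrow> \<chi> (basis_vec b) = \<phi> (\<psi> (basis_vec b)) - \<psi> (\<phi> (basis_vec b))"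
    and "Poly_Mapping.keys t \<subseteq> lists B"
  shows "tensor_der \<chi> t = tensor_der \<phi> (tensor_der \<psi> t) - tensor_der \<psi> (tensor_der \<phi> t)"
proof (rule lin_map_cong_basis[where
      \<psi> = "\<lambda>t. tensor_der \<phi> (tensor_der \<psi> t) - tensor_der \<psi> (tensor_der \<phi> t)"])
  show "lin_map (\<lambda>t. tensor_der \<phi> (tensor_der \<psi> t) - tensor_der \<psi> (tensor_der \<phi> t))"
    by (intro lin_mapI) (simp_all add: tensor_der_add tensor_der_scale pm.scale_right_diff_distrib)
  fix bs assume "bs \<in> Poly_Mapping.keys t"
  with assms(4) have "bs \<in> lists B" by blast
  then show "tensor_der \<chi> (basis_vec bs) =
      tensor_der \<phi> (tensor_der \<psi> (basis_vec bs)) - tensor_der \<psi> (tensor_der \<phi> (basis_vec bs))"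
    by (induction bs) (simp_all add: tensor_der_basis_Cons assms(3) tensor_der_add tensor_der_zero
        tensor_der_cons_tensor[OF \<phi>] tensor_der_cons_tensor[OF \<psi>] cons_tensor_diff_left
        cons_tensor_diff_right)
qed (rule lin_map_tensor_der)

section \<open>Quotient modules and direct sums\<close>

abbreviation submod :: "'b set \<Rightarrow> (complex, 'b) module \<Rightarrow> bool" where
  "submod \<equiv> LinearCombinations.submodule class_ring"

lemma submodI:
  assumes "module class_ring M" "H \<subseteq> carrier M" "\<zero>\<^bsub>M\<^esub> \<in> H"
    "\<And>x y. x \<in> H \<Longrightarrow> y \<in> H \<Longrightarrow> x \<oplus>\<^bsub>M\<^esub> y \<in> H" "\<And>c x. x \<in> H \<Longrightarrow> c \<odot>\<^bsub>M\<^esub> x \<in> H"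
  shows "submod H M"
  using assms by (auto simp: LinearCombinations.submodule_def)

lemma submodD:
  assumes "submod H M"
  shows "module class_ring M" "H \<subseteq> carrier M" "\<zero>\<^bsub>M\<^esub> \<in> H"
    "\<And>x y. x \<in> H \<Longrightarrow> y \<in> H \<Longrightarrow> x \<oplus>\<^bsub>M\<^esub> y \<in> H" "\<And>c x. x \<in> H \<Longrightarrow> c \<odot>\<^bsub>M\<^esub> x \<in> H"
  using assms by (auto simp: LinearCombinations.submodule_def)

lemma vectorspace_iff_module: "vectorspace class_ring M \<longleftrightarrow> module (class_ring :: complex ring) M"
  by (simp add: vectorspace_def class_field)

lemma complex_module_simps:
  assumes "module (class_ring :: complex ring) M" "x \<in> carrier M"
  shows "(a * b) \<odot>\<^bsub>M\<^esub> x = a \<odot>\<^bsub>M\<^esub> (b \<odot>\<^bsub>M\<^esub> x)" "(a + b) \<odot>\<^bsub>M\<^esub> x = a \<odot>\<^bsub>M\<^esub> x \<oplus>\<^bsub>M\<^esub> b \<odot>\<^bsub>M\<^esub> x"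
    "1 \<odot>\<^bsub>M\<^esub> x = x" "0 \<odot>\<^bsub>M\<^esub> x = \<zero>\<^bsub>M\<^esub>" "(- 1) \<odot>\<^bsub>M\<^esub> x = \<ominus>\<^bsub>M\<^esub> x"
    "c \<odot>\<^bsub>M\<^esub> x \<in> carrier M"
proof -
  interpret Module.module class_ring M by fact
  show "(a * b) \<odot>\<^bsub>M\<^esub> x = a \<odot>\<^bsub>M\<^esub> (b \<odot>\<^bsub>M\<^esub> x)" "(a + b) \<odot>\<^bsub>M\<^esub> x = a \<odot>\<^bsub>M\<^esub> x \<oplus>\<^bsub>M\<^esub> b \<odot>\<^bsub>M\<^esub> x"
    "1 \<odot>\<^bsub>M\<^esub> x = x" "0 \<odot>\<^bsub>M\<^esub> x = \<zero>\<^bsub>M\<^esub>" "(- 1) \<odot>\<^bsub>M\<^esub> x = \<ominus>\<^bsub>M\<^esub> x"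
    "c \<odot>\<^bsub>M\<^esub> x \<in> carrier M"
    using smult_assoc1[of a b x] smult_l_distr[of a b x] smult_one[of x] lmult_0[of x]
      smult_minus_1[of x] smult_closed[of c x] assms(2)
    by (simp_all add: class_ring_simps)
qed

lemma submod_zero:
  assumes "module class_ring M"
  shows "submod {\<zero>\<^bsub>M\<^esub>} M"
proof -
  interpret Module.module class_ring M by fact
  show ?thesis by (intro submodI) (use assms in auto)
qed

lemma submod_a_inv:
  assumes "submod H M" "x \<in> H"
  shows "\<ominus>\<^bsub>M\<^esub> x \<in> H"
proof -
  have "\<ominus>\<^bsub>M\<^esub> x = (- 1) \<odot>\<^bsub>M\<^esub> x"
    using complex_module_simps(5)[OF submodD(1)[OF assms(1)]] submodD(2)[OF assms(1)] assms(2)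
    by auto
  then show ?thesis using submodD(5)[OF assms] by simp
qed

lemma submod_minus:
  assumes "submod H M" "x \<in> H" "y \<in> H"
  shows "x \<ominus>\<^bsub>M\<^esub> y \<in> H"
  unfolding a_minus_def using submodD(4)[OF assms(1,2) submod_a_inv[OF assms(1,3)]] .

lemma submod_abelian_subgroup:
  assumes "submod H M"
  shows "abelian_subgroup H M"
proof (rule abelian_subgroupI3)
  interpret Module.module class_ring M by (rule submodD[OF assms(1)])
  show "abelian_group M" ..
  show "additive_subgroup H M"
    unfolding additive_subgroup_def
  proof (rule group.subgroupI[OF M.a_group])
    fix x y assume "x \<in> H" "y \<in> H"
    then show "inv\<^bsub>add_monoid M\<^esub> x \<in> H" "x \<otimes>\<^bsub>add_monoid M\<^esub> y \<in> H"
      using submod_a_inv[OF assms] submodD(4)[OF assms] by (simp_all add: a_inv_def)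
  qed (use submodD[OF assms] in auto)
qed

lemma span_minimal:
  assumes "submod H M" "A \<subseteq> H"
  shows "LinearCombinations.module.span class_ring M A \<subseteq> H"
proof -
  interpret Module.module class_ring M by (rule submodD[OF assms(1)])
  show ?thesis using span_is_subset[OF assms(2,1)] .
qed

lemma submod_span:
  assumes "module class_ring M" "A \<subseteq> carrier M"
  shows "submod (LinearCombinations.module.span class_ring M A) M"
  using assms module.span_is_submodule by blast

lemma span_superset:
  assumes "module class_ring M" "A \<subseteq> carrier M"
  shows "A \<subseteq> LinearCombinations.module.span class_ring M A"
  using assms module.in_own_span by blast

text \<open>The graded pieces are quotients of the ambient space restricted to a smaller carrier; their
  elements are still cosets in the ambient space.\<close>

lemma a_r_coset_carrier_update [simp]: "a_r_coset (M\<lparr>carrier := F\<rparr>) H x = a_r_coset M H x"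
  by (simp add: a_r_coset_def')

locale module_quotient = Module.module "class_ring :: complex ring" M
  for M :: "(complex, 'b) module" (structure) and H +
  assumes submod: "submod H M"
begin

sublocale abelian_subgroup H M
  by (rule submod_abelian_subgroup[OF submod])

lemma coset_eq_zero_iff:
  assumes "x \<in> carrier M"
  shows "H +> x = H \<longleftrightarrow> x \<in> H"
  using assms a_coset_join1 a_rcos_const a_subgroup by blast

lemma carrier_quot: "carrier (quot_module M H) = {H +> x | x. x \<in> carrier M}"
  by (auto simp: quot_module_def A_RCOSETS_def')

lemma quot_zero: "\<zero>\<^bsub>quot_module M H\<^esub> = H"
  by (simp add: quot_module_def)

lemma quot_add:
  assumes "x \<in> carrier M" "y \<in> carrier M"
  shows "(H +> x) \<oplus>\<^bsub>quot_module M H\<^esub> (H +> y) = H +> (x \<oplus> y)"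
  using assms a_rcos_sum by (simp add: quot_module_def)

end

text \<open>The operations induced on quotients are unions of cosets over all representatives of a class.
  Such a union is the single coset given by any one representative.\<close>

lemma UN_coset_eq:
  assumes MH: "module_quotient M H" and MH': "module_quotient M' H'"
    and f: "\<And>h. h \<in> H \<Longrightarrow> f (h \<oplus>\<^bsub>M\<^esub> x) = f h \<oplus>\<^bsub>M'\<^esub> f x" "\<And>h. h \<in> H \<Longrightarrow> f h \<in> H'"
    and x: "x \<in> carrier M" "f x \<in> carrier M'"
  shows "(\<Union>t\<in>a_r_coset M H x. a_r_coset M' H' (f t)) = a_r_coset M' H' (f x)"
proof -
  interpret A: module_quotient M H by fact
  interpret B: module_quotient M' H' by fact
  have "a_r_coset M' H' (f t) = a_r_coset M' H' (f x)" if "t \<in> a_r_coset M H x" for t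
  proof -
    from that obtain h where h: "h \<in> H" "t = h \<oplus>\<^bsub>M\<^esub> x" by (auto simp: a_r_coset_def')
    have "f t = f h \<oplus>\<^bsub>M'\<^esub> f x" "f h \<in> H'" using f h by auto
    then show ?thesis
      using B.a_repr_independence'[of "f t" "f x"] x by (auto simp: a_r_coset_def')
  qed
  moreover have "x \<in> a_r_coset M H x" using x A.a_rcos_self by simp
  ultimately show ?thesis by blast
qed

context module_quotient begin

lemma quot_smult:
  assumes "x \<in> carrier M"
  shows "c \<odot>\<^bsub>quot_module M H\<^esub> (H +> x) = H +> (c \<odot> x)"
proof -
  have "(\<Union>t\<in>H +> x. H +> (c \<odot> t)) = H +> (c \<odot> x)"
  proof (rule UN_coset_eq)
    show "module_quotient M H" ..
    then show "module_quotient M H" .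
    fix h assume "h \<in> H"
    then show "c \<odot> (h \<oplus> x) = c \<odot> h \<oplus> c \<odot> x" "c \<odot> h \<in> H"
      using assms a_subset submodD(5)[OF submod] by (auto simp: smult_r_distr)
  qed (use assms in auto)
  then show ?thesis by (simp add: quot_module_def)
qed

lemma module_quot_module: "module class_ring (quot_module M H)"
proof (rule module_criteria)
  let ?Q = "quot_module M H"
  show "cring (class_ring :: complex ring)" by (rule R.is_cring)
  show "\<zero>\<^bsub>?Q\<^esub> \<in> carrier ?Q"
    using quot_zero carrier_quot a_coset_add_zero[OF a_subset] by (metis (mono_tags, lifting) M.zero_closed mem_Collect_eq)
  show "\<forall>v\<in>carrier ?Q. \<exists>neg_v\<in>carrier ?Q. v \<oplus>\<^bsub>?Q\<^esub> neg_v = \<zero>\<^bsub>?Q\<^esub>"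
  proof
    fix v assume "v \<in> carrier ?Q"
    then obtain x where x: "x \<in> carrier M" "v = H +> x" by (auto simp: carrier_quot)
    then have "v \<oplus>\<^bsub>?Q\<^esub> (H +> \<ominus> x) = H" by (simp add: quot_add M.r_neg a_subset)
    then show "\<exists>neg_v\<in>carrier ?Q. v \<oplus>\<^bsub>?Q\<^esub> neg_v = \<zero>\<^bsub>?Q\<^esub>"
      using x by (intro bexI[of _ "H +> \<ominus> x"]) (auto simp: carrier_quot quot_zero)
  qed
  have "(H +> x) \<oplus>\<^bsub>?Q\<^esub> H = H +> x" if "x \<in> carrier M" for x
    using quot_add[OF that M.zero_closed] that by (simp add: a_subset)
  then show "\<forall>v\<in>carrier ?Q. v \<oplus>\<^bsub>?Q\<^esub> \<zero>\<^bsub>?Q\<^esub> = v"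
    by (auto simp: carrier_quot quot_zero)
qed (auto simp: carrier_quot quot_add quot_smult M.a_ac smult_r_distr
    complex_module_simps[OF module_axioms])

end


text \<open>The size of an independent subset of \<open>H\<close> is bounded by the dimension of the span of \<open>A\<close>, and an
  independent subset of \<open>H\<close> of maximal size spans \<open>H\<close>.\<close>

lemma finite_span_subspace:
  assumes M: "module class_ring M" and A: "finite A" "A \<subseteq> carrier M"
    and H: "submod H M" "H \<subseteq> LinearCombinations.module.span class_ring M A"
  obtains B where "finite B" "B \<subseteq> H" "LinearCombinations.module.span class_ring M B = H"
proof -
  interpret V: vectorspace class_ring M using M by (simp add: vectorspace_iff_module)
  let ?W = "M\<lparr>carrier := V.span A\<rparr>" and ?H = "M\<lparr>carrier := H\<rparr>"
  note sA = submod_span[OF M A(2)]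
  interpret W: vectorspace class_ring ?W
    unfolding vectorspace_iff_module by (rule V.submodule_is_module[OF sA])
  interpret H: vectorspace class_ring ?H
    unfolding vectorspace_iff_module by (rule V.submodule_is_module[OF H(1)])
  have W: "W.span S = V.span S" "W.lin_dep S = V.lin_dep S" if "S \<subseteq> V.span A" for S
    using V.span_li_not_depend[OF that sA] by auto
  have HV: "H.span S = V.span S" "H.lin_dep S = V.lin_dep S" if "S \<subseteq> H" for S
    using V.span_li_not_depend[OF that H(1)] by auto
  have sub: "A \<subseteq> V.span A" by (rule span_superset[OF M A(2)])
  have "W.fin_dim"
    unfolding W.fin_dim_def using A sub W(1)[OF sub] by (intro exI[of _ A]) simp
  then have bound: "finite S \<and> card S \<le> W.dim" if "S \<subseteq> carrier ?H \<and> \<not> H.lin_dep S" for S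
    using W.li_le_dim[of S] that W(2)[of S] HV(2)[of S] H(2) by auto
  have "{} \<subseteq> carrier ?H \<and> \<not> H.lin_dep {}" by (auto simp: H.lin_dep_def)
  from maximal_exists[of "\<lambda>S. S \<subseteq> carrier ?H \<and> \<not> H.lin_dep S", OF bound this]
  obtain B where B: "finite B" "maximal B (\<lambda>S. S \<subseteq> carrier ?H \<and> \<not> H.lin_dep S)" by blast
  then have "B \<subseteq> H" by (simp add: maximal_def)
  moreover have "V.span B = H" using H.max_li_is_gen[OF B(2)] HV(1)[OF \<open>B \<subseteq> H\<close>] by simp
  ultimately show thesis using that B(1) by blast
qed

definition summand_inj :: "('i \<Rightarrow> (complex, 'b) module) \<Rightarrow> 'i \<Rightarrow> 'b \<Rightarrow> 'i \<Rightarrow> 'b" where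
  "summand_inj M i x = (\<lambda>j. if j = i then x else \<zero>\<^bsub>M j\<^esub>)"

context
  fixes M :: "'i \<Rightarrow> (complex, 'b) module"
  assumes M: "\<And>i. module class_ring (M i)"
begin

interpretation M: Module.module class_ring "M i" for i by (rule M)

lemma direct_sum_simps:
  "\<zero>\<^bsub>direct_sum_module M\<^esub> = (\<lambda>i. \<zero>\<^bsub>M i\<^esub>)"
  "(f \<oplus>\<^bsub>direct_sum_module M\<^esub> g) = (\<lambda>i. f i \<oplus>\<^bsub>M i\<^esub> g i)"
  "(c \<odot>\<^bsub>direct_sum_module M\<^esub> f) = (\<lambda>i. c \<odot>\<^bsub>M i\<^esub> f i)"
  by (simp_all add: direct_sum_module_def)

lemma carrier_direct_sum:
  "carrier (direct_sum_module M) =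
     {f. (\<forall>i. f i \<in> carrier (M i)) \<and> finite {i. f i \<noteq> \<zero>\<^bsub>M i\<^esub>}}"
  by (simp add: direct_sum_module_def)

lemma module_direct_sum: "module class_ring (direct_sum_module M)"
proof (rule module_criteria)
  let ?S = "direct_sum_module M"
  show "cring (class_ring :: complex ring)" by (rule domain.axioms(1)[OF field.axioms(1)[OF class_field]])
  have fin: "finite {i. h i \<noteq> \<zero>\<^bsub>M i\<^esub>}"
    if "finite {i. f i \<noteq> \<zero>\<^bsub>M i\<^esub>}" "finite {i. g i \<noteq> \<zero>\<^bsub>M i\<^esub>}"
      "\<And>i. f i = \<zero>\<^bsub>M i\<^esub> \<Longrightarrow> g i = \<zero>\<^bsub>M i\<^esub> \<Longrightarrow> h i = \<zero>\<^bsub>M i\<^esub>" for f g h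
    by (rule finite_subset[OF _ finite_UnI[OF that(1,2)]]) (auto simp: that(3))
  show "\<forall>f g. f \<in> carrier ?S \<and> g \<in> carrier ?S \<longrightarrow> f \<oplus>\<^bsub>?S\<^esub> g \<in> carrier ?S"
  proof (intro allI impI)
    fix f g assume fg: "f \<in> carrier ?S \<and> g \<in> carrier ?S"
    from fg have "finite {i. f i \<oplus>\<^bsub>M i\<^esub> g i \<noteq> \<zero>\<^bsub>M i\<^esub>}"
      by - (rule fin[of f g], auto simp: carrier_direct_sum)
    with fg show "f \<oplus>\<^bsub>?S\<^esub> g \<in> carrier ?S" by (auto simp: carrier_direct_sum direct_sum_simps)
  qed
  show "\<forall>c f. c \<in> carrier class_ring \<and> f \<in> carrier ?S \<longrightarrow> c \<odot>\<^bsub>?S\<^esub> f \<in> carrier ?S"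
  proof (intro allI impI)
    fix c :: complex and f assume f: "c \<in> carrier class_ring \<and> f \<in> carrier ?S"
    then have "finite {i. c \<odot>\<^bsub>M i\<^esub> f i \<noteq> \<zero>\<^bsub>M i\<^esub>}"
      by - (rule fin[of f f], auto simp: carrier_direct_sum)
    with f show "c \<odot>\<^bsub>?S\<^esub> f \<in> carrier ?S" by (auto simp: carrier_direct_sum direct_sum_simps)
  qed
  show "\<forall>f\<in>carrier ?S. \<exists>g\<in>carrier ?S. f \<oplus>\<^bsub>?S\<^esub> g = \<zero>\<^bsub>?S\<^esub>"
  proof
    fix f assume f: "f \<in> carrier ?S"
    then have "finite {i. \<ominus>\<^bsub>M i\<^esub> f i \<noteq> \<zero>\<^bsub>M i\<^esub>}"
      by - (rule fin[of f f], auto simp: carrier_direct_sum)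
    with f show "\<exists>g\<in>carrier ?S. f \<oplus>\<^bsub>?S\<^esub> g = \<zero>\<^bsub>?S\<^esub>"
      by (intro bexI[of _ "\<lambda>i. \<ominus>\<^bsub>M i\<^esub> f i"])
        (auto simp: carrier_direct_sum direct_sum_simps M.M.r_neg)
  qed
qed (auto simp: carrier_direct_sum direct_sum_simps M.M.a_ac M.smult_r_distr
    complex_module_simps[OF M])

lemma summand_inj_closed:
  assumes "x \<in> carrier (M i)"
  shows "summand_inj M i x \<in> carrier (direct_sum_module M)"
proof -
  have "finite {j. summand_inj M i x j \<noteq> \<zero>\<^bsub>M j\<^esub>}"
    by (rule finite_subset[of _ "{i}"]) (auto simp: summand_inj_def)
  then show ?thesis using assms by (auto simp: carrier_direct_sum summand_inj_def)
qed

lemma summand_inj_zero: "summand_inj M i \<zero>\<^bsub>M i\<^esub> = \<zero>\<^bsub>direct_sum_module M\<^esub>"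
  by (auto simp: summand_inj_def direct_sum_simps)

lemma summand_inj_add:
  "summand_inj M i (x \<oplus>\<^bsub>M i\<^esub> y) = summand_inj M i x \<oplus>\<^bsub>direct_sum_module M\<^esub> summand_inj M i y"
  by (auto simp: summand_inj_def direct_sum_simps)

lemma summand_inj_smult:
  "summand_inj M i (c \<odot>\<^bsub>M i\<^esub> x) = c \<odot>\<^bsub>direct_sum_module M\<^esub> summand_inj M i x"
  by (auto simp: summand_inj_def direct_sum_simps)

lemma direct_sum_generated_by_summands:
  assumes S: "submod S (direct_sum_module M)"
    and inj: "\<And>i x. x \<in> carrier (M i) \<Longrightarrow> summand_inj M i x \<in> S"
  shows "S = carrier (direct_sum_module M)"
proof
  show "S \<subseteq> carrier (direct_sum_module M)" by (rule submodD[OF S])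
  have "f \<in> S" if "finite I" "f \<in> carrier (direct_sum_module M)" "{i. f i \<noteq> \<zero>\<^bsub>M i\<^esub>} \<subseteq> I" for I f
    using that
  proof (induction I arbitrary: f)
    case empty
    then have "f = \<zero>\<^bsub>direct_sum_module M\<^esub>" by (auto simp: direct_sum_simps)
    then show ?case using submodD(3)[OF S] by simp
  next
    case (insert i I)
    define g where "g = f(i := \<zero>\<^bsub>M i\<^esub>)"
    have f: "\<And>j. f j \<in> carrier (M j)" "finite {j. f j \<noteq> \<zero>\<^bsub>M j\<^esub>}"
      using insert.prems by (auto simp: carrier_direct_sum)
    have "finite {j. g j \<noteq> \<zero>\<^bsub>M j\<^esub>}"
      by (rule finite_subset[OF _ f(2)]) (auto simp: g_def)
    then have "g \<in> S"
      using insert.prems f by (intro insert.IH) (auto simp: carrier_direct_sum g_def)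
    moreover have "f = summand_inj M i (f i) \<oplus>\<^bsub>direct_sum_module M\<^esub> g"
      using f(1) by (auto simp: direct_sum_simps summand_inj_def g_def)
    ultimately show ?case using submodD(4)[OF S inj[OF f(1)]] by metis
  qed
  then show "carrier (direct_sum_module M) \<subseteq> S" by (auto simp: carrier_direct_sum)
qed

lemma direct_sum_fin_dim:
  assumes G: "\<And>i. finite (G i)" "\<And>i. G i \<subseteq> carrier (M i)"
      "\<And>i. carrier (M i) = LinearCombinations.module.span class_ring (M i) (G i)"
    and fin: "finite {i. carrier (M i) \<noteq> {\<zero>\<^bsub>M i\<^esub>}}"
  shows "vectorspace.fin_dim class_ring (direct_sum_module M)"
proof -
  let ?D = "direct_sum_module M" and ?I = "{i. carrier (M i) \<noteq> {\<zero>\<^bsub>M i\<^esub>}}"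
  interpret D: vectorspace class_ring ?D
    using module_direct_sum by (simp add: vectorspace_iff_module)
  define A where "A = (\<Union>i\<in>?I. summand_inj M i ` G i)"
  have A: "finite A" "A \<subseteq> carrier ?D"
    unfolding A_def using G(1) fin summand_inj_closed[OF subsetD[OF G(2)]] by (blast, blast)
  note S = submod_span[OF module_direct_sum A(2)]
  have "D.span A = carrier ?D"
  proof (rule direct_sum_generated_by_summands[OF S])
    fix i x assume x: "x \<in> carrier (M i)"
    show "summand_inj M i x \<in> D.span A"
    proof (cases "i \<in> ?I")
      case False
      then show ?thesis using x submodD(3)[OF S] summand_inj_zero by auto
    next
      case True
      let ?T = "{y \<in> carrier (M i). summand_inj M i y \<in> D.span A}"
      have "submod ?T (M i)"
        using submodD[OF S] by (intro submodI[OF M])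
          (auto simp: summand_inj_zero summand_inj_add summand_inj_smult)
      moreover have "summand_inj M i ` G i \<subseteq> A" using True unfolding A_def by blast
      then have "G i \<subseteq> ?T" using G(2) span_superset[OF module_direct_sum A(2)] by blast
      ultimately show ?thesis using span_minimal x G(3) by blast
    qed
  qed
  then show ?thesis unfolding D.fin_dim_def using A by blast
qed

end

section \<open>Exterior powers\<close>

lemma free_module_simps [simp]:
  "carrier (free_module B) = {t. Poly_Mapping.keys t \<subseteq> B}"
  "\<zero>\<^bsub>free_module B\<^esub> = 0"
  "s \<oplus>\<^bsub>free_module B\<^esub> t = s + t"
  "c \<odot>\<^bsub>free_module B\<^esub> t = scale c t"
  by (simp_all add: free_module_def)

lemma keys_add_subset:
  "Poly_Mapping.keys s \<subseteq> B \<Longrightarrow> Poly_Mapping.keys t \<subseteq> B \<Longrightarrow> Poly_Mapping.keys (s + t) \<subseteq> B"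
  using Poly_Mapping.keys_add[of s t] by blast

lemma module_free_module: "module class_ring (free_module B)"
proof (rule module_criteria)
  show "cring (class_ring :: complex ring)" by (rule domain.axioms(1)[OF field.axioms(1)[OF class_field]])
  show "\<forall>v\<in>carrier (free_module B). \<exists>w\<in>carrier (free_module B). v \<oplus>\<^bsub>free_module B\<^esub> w = \<zero>\<^bsub>free_module B\<^esub>"
  proof
    fix v assume "v \<in> carrier (free_module B)"
    then show "\<exists>w\<in>carrier (free_module B). v \<oplus>\<^bsub>free_module B\<^esub> w = \<zero>\<^bsub>free_module B\<^esub>"
      by (intro bexI[of _ "- v"]) auto
  qed
  show "\<forall>c v. c \<in> carrier class_ring \<and> v \<in> carrier (free_module B) \<longrightarrow>
      c \<odot>\<^bsub>free_module B\<^esub> v \<in> carrier (free_module B)"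
    using keys_scale by fastforce
qed (auto simp: keys_add_subset algebra_simps scale_add scale_scale pm.scale_left_distrib)

abbreviation words :: "'b set \<Rightarrow> nat \<Rightarrow> 'b list set" where
  "words B n \<equiv> {bs. length bs = n \<and> set bs \<subseteq> B}"

lemma module_tensor_power: "module class_ring (tensor_power B n)"
  unfolding tensor_power_def by (rule module_free_module)

lemma tensor_power_simps:
  "carrier (tensor_power B n) = {t. Poly_Mapping.keys t \<subseteq> words B n}"
  "\<zero>\<^bsub>tensor_power B n\<^esub> = 0"
  "s \<oplus>\<^bsub>tensor_power B n\<^esub> t = s + t"
  "c \<odot>\<^bsub>tensor_power B n\<^esub> t = scale c t"
  by (simp_all add: tensor_power_def)

abbreviation alt_generators :: "'b set \<Rightarrow> nat \<Rightarrow> ('b list \<Rightarrow>\<^sub>0 complex) set" where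
  "alt_generators B n \<equiv> {pure_tensor vs | vs. length vs = n \<and> set vs \<subseteq> carrier (free_module B) \<and> \<not> distinct vs}"

lemma alt_generators_subset: "alt_generators B n \<subseteq> carrier (tensor_power B n)"
proof
  fix t assume "t \<in> alt_generators B n"
  then obtain vs where "t = pure_tensor vs" "length vs = n" "\<forall>v\<in>set vs. Poly_Mapping.keys v \<subseteq> B" by auto
  then show "t \<in> carrier (tensor_power B n)"
    using keys_pure_tensor[of vs B] by (auto simp: tensor_power_simps)
qed

lemma submod_alt_relations: "submod (alt_relations B n) (tensor_power B n)"
  unfolding alt_relations_def by (rule submod_span[OF module_tensor_power alt_generators_subset])

lemma alt_relations_closed:
  "0 \<in> alt_relations B n"
  "s \<in> alt_relations B n \<Longrightarrow> t \<in> alt_relations B n \<Longrightarrow> s + t \<in> alt_relations B n"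
  "t \<in> alt_relations B n \<Longrightarrow> scale c t \<in> alt_relations B n"
  "t \<in> alt_relations B n \<Longrightarrow> Poly_Mapping.keys t \<subseteq> words B n"
  using submodD(3-5)[OF submod_alt_relations[of B n]] submodD(2)[OF submod_alt_relations[of B n]]
  by (simp_all add: tensor_power_simps subset_iff)

lemma alt_relations_diff:
  assumes "s \<in> alt_relations B n" "t \<in> alt_relations B n"
  shows "s - t \<in> alt_relations B n"
proof -
  have "s - t = s + scale (- 1) t" by (simp add: pm.scale_minus_left)
  then show ?thesis using assms alt_relations_closed by metis
qed

lemma alt_relations_sum:
  assumes "\<And>k. k \<in> A \<Longrightarrow> f k \<in> alt_relations B n"
  shows "sum f A \<in> alt_relations B n"
  using assms by (induction A rule: infinite_finite_induct) (auto intro: alt_relations_closed)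

lemma pure_tensor_in_alt_relations:
  assumes "length vs = n" "\<And>v. v \<in> set vs \<Longrightarrow> Poly_Mapping.keys v \<subseteq> B" "\<not> distinct vs"
  shows "pure_tensor vs \<in> alt_relations B n"
proof -
  have "pure_tensor vs \<in> alt_generators B n" using assms by auto
  then show ?thesis
    using span_superset[OF module_tensor_power alt_generators_subset] unfolding alt_relations_def
    by blast
qed

definition stable_on :: "'b set \<Rightarrow> (('b \<Rightarrow>\<^sub>0 complex) \<Rightarrow> ('b \<Rightarrow>\<^sub>0 complex)) \<Rightarrow> bool" where
  "stable_on B \<phi> \<longleftrightarrow> lin_map \<phi> \<and> (\<forall>b\<in>B. Poly_Mapping.keys (\<phi> (basis_vec b)) \<subseteq> B)"

lemma stable_on_keys:
  assumes "stable_on B \<phi>" "Poly_Mapping.keys v \<subseteq> B"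
  shows "Poly_Mapping.keys (\<phi> v) \<subseteq> B"
proof -
  have "Poly_Mapping.keys (lin_ext (\<lambda>b. \<phi> (basis_vec b)) v) \<subseteq> B"
    using assms by (intro keys_lin_ext) (auto simp: stable_on_def)
  then show ?thesis using assms(1) lin_map_eq_lin_ext[of \<phi> v] by (simp add: stable_on_def)
qed

text \<open>For a repeated factor \<open>v\<close>, the two summands of the Leibniz rule that hit a copy of \<open>v\<close> add up
  to the polarisation \<open>q (v + \<phi> v) - q v - q (\<phi> v)\<close>, where \<open>q u\<close> is the tensor with both copies
  replaced by \<open>u\<close>; all other summands still contain both copies of \<open>v\<close>.\<close>

lemma tensor_der_alt_relations:
  assumes \<phi>: "stable_on B \<phi>" and t: "t \<in> alt_relations B n"
  shows "tensor_der \<phi> t \<in> alt_relations B n"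
proof -
  have lin: "lin_map \<phi>" using \<phi> by (simp add: stable_on_def)
  let ?H = "{t \<in> alt_relations B n. tensor_der \<phi> t \<in> alt_relations B n}"
  have H: "submod ?H (tensor_power B n)"
  proof (rule submodI[OF module_tensor_power])
    show "?H \<subseteq> carrier (tensor_power B n)" using submodD(2)[OF submod_alt_relations] by blast
  qed (auto simp: tensor_power_simps tensor_der_zero tensor_der_add tensor_der_scale
        intro: alt_relations_closed(1-3))
  have "alt_generators B n \<subseteq> ?H"
  proof clarify
    fix vs :: "('a \<Rightarrow>\<^sub>0 complex) list"
    assume n: "n = length vs" and vs: "set vs \<subseteq> carrier (free_module B)" and nd: "\<not> distinct vs"
    from nd obtain i j where ij: "i < length vs" "j < length vs" "i \<noteq> j" "vs ! i = vs ! j"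
      by (auto simp: distinct_conv_nth)
    define v where "v = vs ! i"
    define q where "q x y = pure_tensor (vs[i := x, j := y])" for x y
    have v: "Poly_Mapping.keys v \<subseteq> B" "vs ! j = v"
      using subsetD[OF vs nth_mem[OF ij(1)]] ij(4) by (simp_all add: v_def)
    have \<phi>v: "Poly_Mapping.keys (\<phi> v) \<subseteq> B" by (rule stable_on_keys[OF \<phi> v(1)])
    let ?T = "\<lambda>k. pure_tensor (vs[k := \<phi> (vs ! k)])"
    have diag: "q x x \<in> alt_relations B (length vs)" if "Poly_Mapping.keys x \<subseteq> B" for x
      unfolding q_def
    proof (rule pure_tensor_in_alt_relations)
      fix u assume "u \<in> set (vs[i := x, j := x])"
      then have "u \<in> insert x (set vs)"
        using set_update_subset_insert[of "vs[i := x]" j x] set_update_subset_insert[of vs i x] by auto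
      then show "Poly_Mapping.keys u \<subseteq> B" using vs that by auto
    next
      show "\<not> distinct (vs[i := x, j := x])"
        using ij nth_eq_iff_index_eq[of "vs[i := x, j := x]" i j] by auto
    qed simp
    have qT: "?T i = q (\<phi> v) v" "?T j = q v (\<phi> v)"
      using ij v(2) list_update_id[of vs i] list_update_id[of "vs[i := \<phi> v]" j]
      by (simp_all add: q_def v_def)
    have add: "q (x + y) z = q x z + q y z" "q z (x + y) = q z x + q z y" for x y z
      using ij pure_tensor_update_add[of i "vs[j := z]" x y]
        pure_tensor_update_add[of j "vs[i := z]" x y]
      by (simp_all add: q_def list_update_swap)
    have "?T i + ?T j = q (v + \<phi> v) (v + \<phi> v) - q v v - q (\<phi> v) (\<phi> v)"
      by (simp add: qT add)
    then have two: "?T i + ?T j \<in> alt_relations B (length vs)"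
      using diag[OF v(1)] diag[OF \<phi>v] diag[OF keys_add_subset[OF v(1) \<phi>v]]
      by (simp add: alt_relations_diff)
    have rest: "?T k \<in> alt_relations B (length vs)" if "k \<in> {..<length vs} - {i, j}" for k
    proof (rule pure_tensor_in_alt_relations)
      fix u assume "u \<in> set (vs[k := \<phi> (vs ! k)])"
      then have "u \<in> insert (\<phi> (vs ! k)) (set vs)"
        using set_update_subset_insert[of vs k] by auto
      moreover have "vs ! k \<in> set vs" using that by simp
      ultimately show "Poly_Mapping.keys u \<subseteq> B"
        using vs stable_on_keys[OF \<phi>, of "vs ! k"] by auto
    next
      show "\<not> distinct (vs[k := \<phi> (vs ! k)])"
        using ij that nth_eq_iff_index_eq[of "vs[k := \<phi> (vs ! k)]" i j] by auto
    qed simp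
    have "(\<Sum>k<length vs. ?T k) = (\<Sum>k\<in>{..<length vs} - {i, j}. ?T k) + (\<Sum>k\<in>{i, j}. ?T k)"
      using ij by (intro sum.subset_diff) auto
    also have "(\<Sum>k\<in>{i, j}. ?T k) = ?T i + ?T j" using ij(3) by simp
    finally have "(\<Sum>k<length vs. ?T k) \<in> alt_relations B (length vs)"
      using alt_relations_closed(2)[OF alt_relations_sum[of "{..<length vs} - {i, j}" ?T, OF rest] two] by simp
    moreover have "pure_tensor vs \<in> alt_relations B (length vs)"
      using vs nd by (intro pure_tensor_in_alt_relations) auto
    ultimately show "pure_tensor vs \<in> alt_relations B (length vs) \<and>
        tensor_der \<phi> (pure_tensor vs) \<in> alt_relations B (length vs)"
      by (simp add: tensor_der_pure_tensor[OF lin])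
  qed
  from span_minimal[OF H this] t show ?thesis unfolding alt_relations_def by blast
qed

abbreviation ext_class :: "'b set \<Rightarrow> nat \<Rightarrow> ('b list \<Rightarrow>\<^sub>0 complex) \<Rightarrow> ('b list \<Rightarrow>\<^sub>0 complex) set" where
  "ext_class B n t \<equiv> a_r_coset (tensor_power B n) (alt_relations B n) t"

interpretation ext: module_quotient "tensor_power B n" "alt_relations B n" for B n
  by (intro module_quotient.intro module_quotient_axioms.intro module_tensor_power submod_alt_relations)

lemma module_ext_power: "module class_ring (ext_power B n)"
  unfolding ext_power_def by (rule ext.module_quot_module)

lemma carrier_ext_power:
  "carrier (ext_power B n) = {ext_class B n t | t. Poly_Mapping.keys t \<subseteq> words B n}"
  unfolding ext_power_def ext.carrier_quot by (simp add: tensor_power_simps)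

lemma ext_class_closed: "Poly_Mapping.keys t \<subseteq> words B n \<Longrightarrow> ext_class B n t \<in> carrier (ext_power B n)"
  by (auto simp: carrier_ext_power)

lemma ext_class_add:
  assumes "Poly_Mapping.keys s \<subseteq> words B n" "Poly_Mapping.keys t \<subseteq> words B n"
  shows "ext_class B n s \<oplus>\<^bsub>ext_power B n\<^esub> ext_class B n t = ext_class B n (s + t)"
  unfolding ext_power_def using assms by (simp add: ext.quot_add tensor_power_simps)

lemma ext_class_smult:
  assumes "Poly_Mapping.keys t \<subseteq> words B n"
  shows "c \<odot>\<^bsub>ext_power B n\<^esub> ext_class B n t = ext_class B n (scale c t)"
  unfolding ext_power_def using assms by (simp add: ext.quot_smult tensor_power_simps)

lemma ext_class_eq_zero_iff:
  assumes "Poly_Mapping.keys t \<subseteq> words B n"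
  shows "ext_class B n t = \<zero>\<^bsub>ext_power B n\<^esub> \<longleftrightarrow> t \<in> alt_relations B n"
  unfolding ext_power_def ext.quot_zero using assms
  by (simp add: ext.coset_eq_zero_iff tensor_power_simps)

lemma ext_class_minus:
  assumes "Poly_Mapping.keys s \<subseteq> words B n" "Poly_Mapping.keys t \<subseteq> words B n"
  shows "ext_class B n s \<ominus>\<^bsub>ext_power B n\<^esub> ext_class B n t = ext_class B n (s - t)"
proof -
  interpret E: Module.module class_ring "ext_power B n" by (rule module_ext_power)
  have t: "Poly_Mapping.keys (scale (- 1) t) \<subseteq> words B n" using assms(2) by simp
  have "\<ominus>\<^bsub>ext_power B n\<^esub> ext_class B n t = ext_class B n (scale (- 1) t)"
    using complex_module_simps(5)[OF module_ext_power ext_class_closed[OF assms(2)]]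
      ext_class_smult[OF assms(2)] by simp
  then show ?thesis
    unfolding a_minus_def using ext_class_add[OF assms(1) t] by simp
qed

lemma ext_der_class:
  assumes \<phi>: "stable_on B \<phi>" and t: "Poly_Mapping.keys t \<subseteq> words B n"
  shows "ext_der B n \<phi> (ext_class B n t) = ext_class B n (tensor_der \<phi> t)"
  unfolding ext_der_def
proof (rule UN_coset_eq)
  show "module_quotient (tensor_power B n) (alt_relations B n)" by unfold_locales
  then show "module_quotient (tensor_power B n) (alt_relations B n)" .
  show "tensor_der \<phi> t \<in> carrier (tensor_power B n)"
    using keys_tensor_der[OF _ t, of \<phi>] \<phi> by (simp add: tensor_power_simps stable_on_def)
qed (use t \<phi> tensor_der_alt_relations in \<open>auto simp: tensor_power_simps tensor_der_add\<close>)

lemma keys_tensor_der_stable: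
  assumes "stable_on B \<phi>" "Poly_Mapping.keys t \<subseteq> words B n"
  shows "Poly_Mapping.keys (tensor_der \<phi> t) \<subseteq> words B n"
  using keys_tensor_der[OF _ assms(2), of \<phi>] assms(1) by (simp add: stable_on_def)

section \<open>The action on truncated Laurent polynomials\<close>

lemma laurent_act_simps:
  "laurent_act 0 f = 0" "laurent_act (p + q) f = laurent_act p f + laurent_act q f"
  "laurent_act (p - q) f = laurent_act p f - laurent_act q f"
  "laurent_act (p * q) f = laurent_act p (laurent_act q f)"
  "laurent_act 1 f = f"
  "laurent_act (const_xy c) f = scale c f"
proof -
  show "laurent_act 0 f = 0" by transfer (simp add: free_act_def)
  show "laurent_act (p + q) f = laurent_act p f + laurent_act q f" by transfer (rule free_act_add)
  show "laurent_act (p - q) f = laurent_act p f - laurent_act q f" by transfer (rule free_act_diff)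
  show "laurent_act (p * q) f = laurent_act p (laurent_act q f)" by transfer (rule free_act_mult)
  show const: "laurent_act (const_xy c) f = scale c f" for c
    by transfer (simp add: free_act_single zero_word_def)
  have "1 = const_xy 1" by transfer (simp add: rel_cong_def rel_ideal.zero)
  from const[of 1, folded this] show "laurent_act 1 f = f" by simp
qed

lemma laurent_act_linear: "lin_map (laurent_act p)"
  by (rule lin_mapI) (transfer, simp add: free_act_add_right free_act_scale_right)+

lemma laurent_act_gen_X: "laurent_act gen_X (basis_vec k) = basis_vec (k + 1)"
  by transfer (simp add: free_act_single mult_single add.commute)

lemma laurent_act_gen_Y:
  "laurent_act gen_Y (Poly_Mapping.single k c) = Poly_Mapping.single k (of_int k * c)"
proof -
  have "letter_act LY (Poly_Mapping.single k c) = Poly_Mapping.single k (of_int k * c)"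
    by (rule poly_mapping_eqI) (simp add: lookup_mapp when_def in_keys_iff lookup_single)
  then show ?thesis by transfer (simp add: free_act_single)
qed

lemma laurent_act_gen_X_power: "laurent_act (gen_X ^ i) (basis_vec k) = basis_vec (k + int i)"
  by (induction i) (simp_all add: laurent_act_simps laurent_act_gen_X algebra_simps)

lemma laurent_act_gen_Y_power:
  "laurent_act (gen_Y ^ j) (basis_vec k) = Poly_Mapping.single k (of_int k ^ j)"
  by (induction j) (simp_all add: laurent_act_simps laurent_act_gen_Y)

lemma keys_laurent_act:
  assumes "Poly_Mapping.keys f \<subseteq> {m..}"
  shows "Poly_Mapping.keys (laurent_act p f) \<subseteq> {m..}"
  using assms
proof (transfer fixing: m)
  fix p :: free_alg and f :: laurent
  assume f: "Poly_Mapping.keys f \<subseteq> {m..}"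
  have letter: "Poly_Mapping.keys (letter_act l g) \<subseteq> {m..}" if g: "Poly_Mapping.keys g \<subseteq> {m..}" for l g
  proof (cases l)
    case LX
    have "Poly_Mapping.keys (Poly_Mapping.single 1 1 * g) \<subseteq> {a + b | a b. a \<in> Poly_Mapping.keys (Poly_Mapping.single (1::int) (1::complex)) \<and> b \<in> Poly_Mapping.keys g}"
      by (rule keys_mult)
    then show ?thesis using LX g by fastforce
  next
    case LY
    then show ?thesis using g keys_mapp_subset by fastforce
  qed
  have word: "Poly_Mapping.keys (word_act w f) \<subseteq> {m..}" for w
  proof (cases w)
    case (Word ls)
    have "Poly_Mapping.keys (foldr letter_act ls f) \<subseteq> {m..}"
      by (induction ls) (use f letter in auto)
    with Word show ?thesis by simp
  qed
  show "Poly_Mapping.keys (free_act p f) \<subseteq> {m..}"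
    unfolding free_act_def by (intro keys_lin_ext word)
qed

text \<open>\<open>truncate N p f\<close> is the class of \<open>u\<^sub>p \<otimes> f\<close>.\<close>

definition truncate :: "int \<Rightarrow> nat \<Rightarrow> laurent \<Rightarrow> (nat \<times> int \<Rightarrow>\<^sub>0 complex)" where
  "truncate N p = lin_ext (\<lambda>k. if k < N then basis_vec (p, k) else 0)"

lemma truncate_linear: "lin_map (truncate N p)"
  unfolding truncate_def by (rule lin_map_lin_ext)

lemmas truncate_add = pm.linear_add[OF truncate_linear]
lemmas truncate_diff = pm.linear_diff[OF truncate_linear]
lemmas truncate_scale = pm.linear_scale[OF truncate_linear]
lemmas truncate_sum = pm.linear_sum[OF truncate_linear]

lemma truncate_basis: "truncate N p (basis_vec k) = (if k < N then basis_vec (p, k) else 0)"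
  by (simp add: truncate_def lin_ext_single)

lemma truncate_eq_0:
  assumes "Poly_Mapping.keys f \<subseteq> {N..}"
  shows "truncate N p f = 0"
  unfolding truncate_def lin_ext_def using assms by (intro sum.neutral) auto

lemma keys_truncate:
  assumes "Poly_Mapping.keys f \<subseteq> {m..}"
  shows "Poly_Mapping.keys (truncate N p f) \<subseteq> {(p, k) | k. m \<le> k \<and> k < N}"
  unfolding truncate_def using assms by (intro keys_lin_ext) auto

lemma V_act_linear: "lin_map (V_act N a)"
  unfolding V_act_def by (rule lin_map_lin_ext)

lemma V_act_basis:
  "V_act N a (basis_vec (q, i)) =
     (\<Sum>p<dim_row a. truncate N p (laurent_act (a $$ (p, q)) (basis_vec i)))"
  by (simp add: V_act_def lin_ext_single truncate_def)

lemma V_act_truncate: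
  "V_act N a (truncate N q f) = (\<Sum>p<dim_row a. truncate N p (laurent_act (a $$ (p, q)) f))"
proof (rule lin_map_cong_basis[where \<phi> = "\<lambda>f. V_act N a (truncate N q f)" and
      \<psi> = "\<lambda>f. \<Sum>p<dim_row a. truncate N p (laurent_act (a $$ (p, q)) f)"])
  show "lin_map (\<lambda>f. V_act N a (truncate N q f))"
    by (rule lin_mapI) (simp_all add: truncate_add truncate_scale pm.linear_add[OF V_act_linear]
        pm.linear_scale[OF V_act_linear])
  show "lin_map (\<lambda>f. \<Sum>p<dim_row a. truncate N p (laurent_act (a $$ (p, q)) f))"
    by (rule lin_mapI) (simp_all add: truncate_add truncate_scale
        pm.linear_add[OF laurent_act_linear] pm.linear_scale[OF laurent_act_linear] sum.distrib
        pm.scale_sum_right)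
  fix k
  show "V_act N a (truncate N q (basis_vec k)) =
      (\<Sum>p<dim_row a. truncate N p (laurent_act (a $$ (p, q)) (basis_vec k)))"
  proof (cases "k < N")
    case True
    then show ?thesis by (simp add: truncate_basis V_act_basis)
  next
    case False
    then have "truncate N p (laurent_act (a $$ (p, q)) (basis_vec k)) = 0" for p
      by (intro truncate_eq_0 keys_laurent_act) auto
    with False show ?thesis by (simp add: truncate_basis pm.linear_0[OF V_act_linear])
  qed
qed

lemma keys_V_act:
  assumes "a \<in> carrier_mat r r"
  shows "Poly_Mapping.keys (V_act N a (basis_vec (q, i))) \<subseteq> {(p, k). p < r \<and> i \<le> k \<and> k < N}"
proof -
  have "Poly_Mapping.keys (truncate N p (laurent_act (a $$ (p, q)) (basis_vec i))) \<subseteq>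
      {(p, k) | k. i \<le> k \<and> k < N}" for p
    by (intro keys_truncate keys_laurent_act) auto
  then show ?thesis
    using assms unfolding V_act_basis by (intro order_trans[OF Poly_Mapping.keys_sum]) fastforce
qed

lemma stable_V_act:
  assumes "a \<in> carrier_mat r r"
  shows "stable_on (V_basis r N) (V_act N a)"
  unfolding stable_on_def V_basis_def using V_act_linear keys_V_act[OF assms, of N] by fastforce

lemma V_act_plus:
  assumes "a \<in> carrier_mat r r" "b \<in> carrier_mat r r" "e \<in> V_basis r N"
  shows "V_act N (a + b) (basis_vec e) = V_act N a (basis_vec e) + V_act N b (basis_vec e)"
  using assms by (cases e) (simp add: V_basis_def V_act_basis laurent_act_simps truncate_add sum.distrib)

lemma V_act_smult:
  assumes "a \<in> carrier_mat r r" "e \<in> V_basis r N"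
  shows "V_act N (const_xy c \<cdot>\<^sub>m a) (basis_vec e) = scale c (V_act N a (basis_vec e))"
  using assms by (cases e)
    (simp add: V_basis_def V_act_basis laurent_act_simps truncate_scale pm.scale_sum_right)

lemma V_act_mult:
  assumes "a \<in> carrier_mat r r" "b \<in> carrier_mat r r" "e \<in> V_basis r N"
  shows "V_act N (a * b) (basis_vec e) = V_act N a (V_act N b (basis_vec e))"
proof (cases e)
  case (Pair q i)
  then have q: "q < r" using assms(3) by (simp add: V_basis_def)
  have sum_act: "laurent_act (sum g S) f = (\<Sum>s\<in>S. laurent_act (g s) f)" if "finite S" for g and S :: "nat set" and f
    using that by (induction S) (simp_all add: laurent_act_simps)
  have "V_act N a (V_act N b (basis_vec e)) =
      (\<Sum>s<r. \<Sum>p<r. truncate N p (laurent_act (a $$ (p, s)) (laurent_act (b $$ (s, q)) (basis_vec i))))"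
    using assms by (simp add: Pair V_act_basis pm.linear_sum[OF V_act_linear] V_act_truncate)
  also have "\<dots> = (\<Sum>p<r. \<Sum>s<r. truncate N p (laurent_act (a $$ (p, s)) (laurent_act (b $$ (s, q)) (basis_vec i))))"
    by (rule sum.swap)
  also have "\<dots> = V_act N (a * b) (basis_vec e)"
    using assms q by (simp add: Pair V_act_basis scalar_prod_def sum_act laurent_act_simps truncate_sum
        atLeast0LessThan)
  finally show ?thesis ..
qed

lemma V_act_commutator:
  assumes "a \<in> carrier_mat r r" "b \<in> carrier_mat r r" "e \<in> V_basis r N"
  shows "V_act N (a * b - b * a) (basis_vec e) =
     V_act N a (V_act N b (basis_vec e)) - V_act N b (V_act N a (basis_vec e))"
proof -
  have "V_act N (a * b - b * a) (basis_vec e) = V_act N (a * b) (basis_vec e) - V_act N (b * a) (basis_vec e)"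
    using assms(1,2,3) by (cases e) (simp add: V_basis_def V_act_basis laurent_act_simps truncate_diff
        sum_subtractf del: index_mult_mat(1))
  then show ?thesis using assms by (simp add: V_act_mult)
qed

section \<open>The filtration of the algebra by the degree in \<open>Y\<close>\<close>

lemma const_xy_simps:
  "const_xy 0 = 0" "const_xy 1 = 1" "const_xy (c + d) = const_xy c + const_xy d"
  "const_xy (c * d) = const_xy c * const_xy d" "const_xy (- c) = - const_xy c"
proof -
  show "const_xy 0 = 0" "const_xy 1 = 1" "const_xy (c + d) = const_xy c + const_xy d"
    by (transfer, simp add: rel_cong_def rel_ideal.zero single_add)+
  show "const_xy (c * d) = const_xy c * const_xy d"
    by transfer (simp add: rel_cong_def rel_ideal.zero mult_single)
  show "const_xy (- c) = - const_xy c"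
    by transfer (simp add: rel_cong_def rel_ideal.zero single_uminus)
qed

lemma const_xy_central: "const_xy c * q = q * const_xy c"
proof transfer
  fix c :: complex and q :: free_alg
  have "Poly_Mapping.single 0 c * q = q * Poly_Mapping.single 0 c"
    by (induction q rule: poly_mapping_single_induct)
      (simp_all add: mult_single distrib_left distrib_right mult.commute)
  then show "rel_cong (Poly_Mapping.single 0 c * q) (q * Poly_Mapping.single 0 c)"
    by (simp add: rel_cong_def rel_ideal.zero)
qed

definition poly_X :: "complex poly \<Rightarrow> xy_alg" where
  "poly_X p = (\<Sum>i\<le>degree p. const_xy (coeff p i) * gen_X ^ i)"

lemma poly_X_eq_sum:
  assumes "degree p \<le> d"
  shows "poly_X p = (\<Sum>i\<le>d. const_xy (coeff p i) * gen_X ^ i)"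
  unfolding poly_X_def using assms
  by (intro sum.mono_neutral_left) (auto simp: coeff_eq_0 const_xy_simps)

lemma poly_X_0 [simp]: "poly_X 0 = 0"
  by (simp add: poly_X_def const_xy_simps)

lemma poly_X_add: "poly_X (p + q) = poly_X p + poly_X q"
proof -
  let ?d = "max (degree p) (degree q)"
  have "degree (p + q) \<le> ?d" by (simp add: degree_add_le_max)
  then show ?thesis
    by (simp add: poly_X_eq_sum[of _ ?d] const_xy_simps distrib_right sum.distrib)
qed

lemma poly_X_smult: "poly_X (Polynomial.smult c p) = const_xy c * poly_X p"
  using poly_X_eq_sum[OF degree_smult_le[of c p]]
  by (simp add: poly_X_def const_xy_simps sum_distrib_left mult.assoc)

lemma poly_X_pCons: "poly_X (pCons c p) = const_xy c + gen_X * poly_X p"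
proof -
  have X: "const_xy d * (gen_X * q) = gen_X * (const_xy d * q)" for d q
    using const_xy_central[of d gen_X] by (simp flip: mult.assoc)
  have "poly_X (pCons c p) = (\<Sum>i\<le>Suc (degree p). const_xy (coeff (pCons c p) i) * gen_X ^ i)"
    by (intro poly_X_eq_sum) (simp add: degree_pCons_le)
  also have "\<dots> = const_xy c + (\<Sum>i\<le>degree p. const_xy (coeff p i) * gen_X ^ Suc i)"
    by (subst sum.atMost_Suc_shift) simp
  also have "(\<Sum>i\<le>degree p. const_xy (coeff p i) * gen_X ^ Suc i) = gen_X * poly_X p"
    by (simp add: X poly_X_def sum_distrib_left)
  finally show ?thesis .
qed

lemma poly_X_monom: "poly_X (monom c i) = const_xy c * gen_X ^ i"
proof (induction i)
  case 0
  show ?case by (simp add: monom_0 poly_X_pCons)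
next
  case (Suc i)
  then show ?case
    by (simp add: monom_Suc poly_X_pCons const_xy_simps flip: mult.assoc const_xy_central[of c gen_X])
qed

lemma poly_X_uminus: "poly_X (- p) = - poly_X p"
  using poly_X_add[of p "- p"] by (simp add: eq_neg_iff_add_eq_0 add.commute)

lemma poly_X_sum: "poly_X (sum f A) = (\<Sum>x\<in>A. poly_X (f x))"
  by (induction A rule: infinite_finite_induct) (simp_all add: poly_X_add)

lemma poly_X_mult: "poly_X (p * q) = poly_X p * poly_X q"
proof (induction p)
  case (pCons c p)
  then show ?case
    by (simp add: mult_pCons_left poly_X_add poly_X_smult poly_X_pCons const_xy_simps distrib_right
        mult.assoc)
qed simp

lemma gen_Y_poly_X: "gen_Y * poly_X p = poly_X p * gen_Y + poly_X (pCons 0 (pderiv p))"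
proof (induction p)
  case (pCons c p)
  have YX: "gen_Y * (gen_X * q) = gen_X * (gen_Y * q) + gen_X * q" for q
    using arg_cong[OF gen_relation, of "\<lambda>z. z * q"] by (simp add: algebra_simps)
  show ?case
    by (simp add: poly_X_pCons pderiv_pCons distrib_left distrib_right YX pCons.IH const_xy_simps
        poly_X_add const_xy_central mult.assoc)
qed (simp add: const_xy_simps poly_X_pCons)

text \<open>Elements of degree \<open>n\<close> with the same leading term differ by an element of \<open>xy_below n\<close>. As the bound
  is strict, this includes degree \<open>0\<close> without a case distinction.\<close>

definition xy_below :: "nat \<Rightarrow> xy_alg set" where
  "xy_below n = {\<Sum>j<n. poly_X (f j) * gen_Y ^ j | f. True}"

lemma xy_belowI: "q = (\<Sum>j<n. poly_X (f j) * gen_Y ^ j) \<Longrightarrow> q \<in> xy_below n"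
  by (auto simp: xy_below_def)

lemma xy_below_0: "xy_below 0 = {0}"
  by (auto simp: xy_below_def)

lemma zero_in_xy_below [simp]: "0 \<in> xy_below n"
  by (auto simp: xy_below_def intro!: exI[of _ "\<lambda>_. 0"])

lemma xy_below_add:
  assumes "p \<in> xy_below n" "q \<in> xy_below n"
  shows "p + q \<in> xy_below n"
proof -
  from assms obtain f g where "p = (\<Sum>j<n. poly_X (f j) * gen_Y ^ j)" "q = (\<Sum>j<n. poly_X (g j) * gen_Y ^ j)"
    by (auto simp: xy_below_def)
  then have "p + q = (\<Sum>j<n. poly_X (f j + g j) * gen_Y ^ j)"
    by (simp add: poly_X_add distrib_right sum.distrib)
  then show ?thesis by (rule xy_belowI)
qed

lemma xy_below_sum:
  assumes "\<And>x. x \<in> A \<Longrightarrow> f x \<in> xy_below n"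
  shows "sum f A \<in> xy_below n"
  using assms by (induction A rule: infinite_finite_induct) (auto intro: xy_below_add)

lemma xy_below_poly_X_mult:
  assumes "q \<in> xy_below n"
  shows "poly_X p * q \<in> xy_below n"
proof -
  from assms obtain f where "q = (\<Sum>j<n. poly_X (f j) * gen_Y ^ j)" by (auto simp: xy_below_def)
  then have "poly_X p * q = (\<Sum>j<n. poly_X (p * f j) * gen_Y ^ j)"
    by (simp add: poly_X_mult sum_distrib_left mult.assoc)
  then show ?thesis by (rule xy_belowI)
qed

lemma xy_below_uminus:
  assumes "q \<in> xy_below n"
  shows "- q \<in> xy_below n"
  using xy_below_poly_X_mult[OF assms, of "- 1"]
  by (simp add: poly_X_uminus one_pCons poly_X_pCons const_xy_simps)

lemma xy_below_diff: "p \<in> xy_below n \<Longrightarrow> q \<in> xy_below n \<Longrightarrow> p - q \<in> xy_below n"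
  using xy_below_add[OF _ xy_below_uminus] by (metis diff_conv_add_uminus)

lemma poly_X_gen_Y_in_xy_below:
  assumes "j < n"
  shows "poly_X p * gen_Y ^ j \<in> xy_below n"
proof -
  have "(\<Sum>i<n. poly_X (if i = j then p else 0) * gen_Y ^ i) =
      (\<Sum>i\<in>{j}. poly_X (if i = j then p else 0) * gen_Y ^ i)"
    using assms by (intro sum.mono_neutral_right) auto
  then have "poly_X p * gen_Y ^ j = (\<Sum>i<n. poly_X (if i = j then p else 0) * gen_Y ^ i)" by simp
  then show ?thesis by (rule xy_belowI)
qed

lemma xy_below_mult_gen_Y_power:
  assumes "q \<in> xy_below n"
  shows "q * gen_Y ^ l \<in> xy_below (n + l)"
proof -
  from assms obtain f where "q = (\<Sum>j<n. poly_X (f j) * gen_Y ^ j)" by (auto simp: xy_below_def)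
  then have "q * gen_Y ^ l = (\<Sum>j<n. poly_X (f j) * gen_Y ^ (j + l))"
    by (simp add: sum_distrib_right mult.assoc power_add)
  moreover have "(\<Sum>j<n. poly_X (f j) * gen_Y ^ (j + l)) \<in> xy_below (n + l)"
    by (rule xy_below_sum) (simp add: poly_X_gen_Y_in_xy_below)
  ultimately show ?thesis by simp
qed

lemma xy_below_gen_Y_mult:
  assumes "q \<in> xy_below n"
  shows "gen_Y * q \<in> xy_below (Suc n)"
proof -
  from assms obtain f where f: "q = (\<Sum>j<n. poly_X (f j) * gen_Y ^ j)" by (auto simp: xy_below_def)
  have "gen_Y * (poly_X (f j) * gen_Y ^ j) =
      poly_X (f j) * gen_Y ^ Suc j + poly_X (pCons 0 (pderiv (f j))) * gen_Y ^ j" for j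
    by (simp add: gen_Y_poly_X distrib_right mult.assoc flip: mult.assoc[of gen_Y])
  then have "gen_Y * q = (\<Sum>j<n. poly_X (f j) * gen_Y ^ Suc j +
      poly_X (pCons 0 (pderiv (f j))) * gen_Y ^ j)"
    by (simp only: f sum_distrib_left)
  moreover have "\<dots> \<in> xy_below (Suc n)"
    by (intro xy_below_sum xy_below_add poly_X_gen_Y_in_xy_below) auto
  ultimately show ?thesis by simp
qed

lemma gen_Y_power_poly_X: "gen_Y ^ j * poly_X p - poly_X p * gen_Y ^ j \<in> xy_below j"
proof (induction j)
  case (Suc j)
  let ?z = "gen_Y ^ j * poly_X p - poly_X p * gen_Y ^ j"
  have "gen_Y ^ Suc j * poly_X p - poly_X p * gen_Y ^ Suc j =
      gen_Y * ?z + poly_X (pCons 0 (pderiv p)) * gen_Y ^ j"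
    using arg_cong[OF gen_Y_poly_X[of p], of "\<lambda>q. q * gen_Y ^ j"]
    by (simp add: algebra_simps)
  then show ?case
    using xy_below_gen_Y_mult[OF Suc] poly_X_gen_Y_in_xy_below by (auto intro!: xy_below_add)
qed simp

text \<open>Up to lower degree, powers of \<open>Y\<close> commute with polynomials in \<open>X\<close>. Hence the leading terms multiply
  like polynomials in two commuting variables.\<close>

lemma symbol_mult:
  "poly_X p * gen_Y ^ j * (poly_X q * gen_Y ^ l) - poly_X (p * q) * gen_Y ^ (j + l) \<in> xy_below (j + l)"
proof -
  have "poly_X p * gen_Y ^ j * (poly_X q * gen_Y ^ l) - poly_X (p * q) * gen_Y ^ (j + l) =
      poly_X p * ((gen_Y ^ j * poly_X q - poly_X q * gen_Y ^ j) * gen_Y ^ l)"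
    by (simp add: poly_X_mult power_add algebra_simps)
  then show ?thesis
    by (simp add: xy_below_poly_X_mult xy_below_mult_gen_Y_power gen_Y_power_poly_X)
qed

lemma lift_deg_eq: "lift_deg b = map_mat (\<lambda>P. poly_X (coeff P b) * gen_Y ^ b)"
  by (simp add: lift_deg_def poly_X_def sum_distrib_right)

lemma lift_deg_carrier [simp]: "a \<in> carrier_mat r r \<Longrightarrow> lift_deg b a \<in> carrier_mat r r"
  by (simp add: lift_deg_eq)

definition mats_below :: "nat \<Rightarrow> nat \<Rightarrow> xy_alg mat set" where
  "mats_below r n = {A \<in> carrier_mat r r. \<forall>k<r. \<forall>l<r. A $$ (k, l) \<in> xy_below n}"

lemma lift_deg_in_mats_below: "a \<in> carrier_mat r r \<Longrightarrow> lift_deg b a \<in> mats_below r (Suc b)"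
  by (auto simp: mats_below_def lift_deg_eq intro: poly_X_gen_Y_in_xy_below)

lemma filt_G_carrier: "A \<in> filt_G r n \<Longrightarrow> A \<in> carrier_mat r r"
  by (induction rule: filt_G.induct) auto

lemma filt_G_mono: "A \<in> filt_G r n \<Longrightarrow> n \<le> m \<Longrightarrow> A \<in> filt_G r m"
  by (induction rule: filt_G.induct) (auto intro: filt_G.intros)

lemma filt_G_plus:
  assumes "B \<in> filt_G r n" "A \<in> filt_G r n"
  shows "A + B \<in> filt_G r n"
  using assms
proof (induction rule: filt_G.induct)
  case zero
  then show ?case using filt_G_carrier right_add_zero_mat by metis
next
  case (add B g j i)
  let ?C = "map_mat (\<lambda>c. const_xy c * gen_X ^ i * gen_Y ^ j) g"
  have "A + (B + ?C) = (A + B) + ?C"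
    using filt_G_carrier add by (intro assoc_add_mat[symmetric]) auto
  then show ?case using filt_G.add add by metis
qed

lemma filt_G_symbols:
  fixes P :: "nat \<Rightarrow> nat \<Rightarrow> complex poly"
  assumes "j \<le> n"
  shows "mat r r (\<lambda>(k, l). poly_X (P k l) * gen_Y ^ j) \<in> filt_G r n"
proof -
  \<comment> \<open>a common bound for the degrees of the entries\<close>
  define d where "d = (\<Sum>k<r. \<Sum>l<r. degree (P k l))"
  have deg: "degree (P k l) \<le> d" if "k < r" "l < r" for k l
  proof -
    have "degree (P k l) \<le> (\<Sum>l<r. degree (P k l))" using that(2) by (intro member_le_sum) auto
    also have "\<dots> \<le> d" unfolding d_def using that(1) by (intro member_le_sum) auto
    finally show ?thesis .
  qed
  have partial: "mat r r (\<lambda>(k, l). (\<Sum>i<e. const_xy (coeff (P k l) i) * gen_X ^ i) * gen_Y ^ j) \<in> filt_G r n" for e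
  proof (induction e)
    case 0
    have "mat r r (\<lambda>(k, l). (\<Sum>i<0. const_xy (coeff (P k l) i) * gen_X ^ i) * gen_Y ^ j) = 0\<^sub>m r r"
      by (intro eq_matI) auto
    then show ?case by (simp only: filt_G.zero)
  next
    case (Suc e)
    have "mat r r (\<lambda>(k, l). (\<Sum>i<Suc e. const_xy (coeff (P k l) i) * gen_X ^ i) * gen_Y ^ j) =
        mat r r (\<lambda>(k, l). (\<Sum>i<e. const_xy (coeff (P k l) i) * gen_X ^ i) * gen_Y ^ j) +
        map_mat (\<lambda>c. const_xy c * gen_X ^ e * gen_Y ^ j) (mat r r (\<lambda>(k, l). coeff (P k l) e))"
      by (intro eq_matI) (auto simp: distrib_right)
    then show ?case using filt_G.add[OF Suc _ assms] by simp
  qed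
  have "mat r r (\<lambda>(k, l). poly_X (P k l) * gen_Y ^ j) =
      mat r r (\<lambda>(k, l). (\<Sum>i<Suc d. const_xy (coeff (P k l) i) * gen_X ^ i) * gen_Y ^ j)"
    by (intro eq_matI) (auto simp: poly_X_eq_sum[OF deg] lessThan_Suc_atMost)
  then show ?thesis by (simp only: partial)
qed

lemma mats_below_Suc: "mats_below r (Suc n) \<subseteq> filt_G r n"
proof
  fix A assume "A \<in> mats_below r (Suc n)"
  then have A: "A \<in> carrier_mat r r" "\<forall>k l. \<exists>f. k < r \<longrightarrow> l < r \<longrightarrow> A $$ (k, l) = (\<Sum>j<Suc n. poly_X (f j) * gen_Y ^ j)"
    by (auto simp: mats_below_def xy_below_def)
  from A(2) obtain f where f: "\<And>k l. k < r \<Longrightarrow> l < r \<Longrightarrow> A $$ (k, l) = (\<Sum>j<Suc n. poly_X (f k l j) * gen_Y ^ j)"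
    by metis
  have "mat r r (\<lambda>(k, l). \<Sum>j<e. poly_X (f k l j) * gen_Y ^ j) \<in> filt_G r n" if "e \<le> Suc n" for e
    using that
  proof (induction e)
    case 0
    have "mat r r (\<lambda>(k, l). \<Sum>j<0. poly_X (f k l j) * gen_Y ^ j) = 0\<^sub>m r r" by (intro eq_matI) auto
    then show ?case by (simp only: filt_G.zero)
  next
    case (Suc e)
    have "mat r r (\<lambda>(k, l). \<Sum>j<Suc e. poly_X (f k l j) * gen_Y ^ j) =
        mat r r (\<lambda>(k, l). \<Sum>j<e. poly_X (f k l j) * gen_Y ^ j) +
        mat r r (\<lambda>(k, l). poly_X (f k l e) * gen_Y ^ e)"
      by (intro eq_matI) auto
    then show ?case using filt_G_plus Suc filt_G_symbols[of e n r "\<lambda>k l. f k l e"] by simp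
  qed
  from this[of "Suc n"] have "mat r r (\<lambda>(k, l). \<Sum>j<Suc n. poly_X (f k l j) * gen_Y ^ j) \<in> filt_G r n" by simp
  moreover have "A = mat r r (\<lambda>(k, l). \<Sum>j<Suc n. poly_X (f k l j) * gen_Y ^ j)"
    using A(1) f by (intro eq_matI) auto
  ultimately show "A \<in> filt_G r n" by simp
qed

text \<open>The coefficient of \<open>y\<^sup>n\<close> in a product of matrices is a convolution of coefficients, and each of
  its summands is a product of symbols up to lower degree.\<close>

lemma lift_deg_mult:
  assumes "a \<in> carrier_mat r r" "b \<in> carrier_mat r r" "k < r" "l < r"
  shows "(\<Sum>c\<le>n. (lift_deg c a * lift_deg (n - c) b) $$ (k, l)) - lift_deg n (a * b) $$ (k, l) \<in> xy_below n"
proof -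
  let ?S = "\<lambda>s c. poly_X (coeff (a $$ (k, s)) c) * gen_Y ^ c *
      (poly_X (coeff (b $$ (s, l)) (n - c)) * gen_Y ^ (n - c))"
  let ?T = "\<lambda>s c. poly_X (coeff (a $$ (k, s)) c * coeff (b $$ (s, l)) (n - c)) * gen_Y ^ n"
  have "(lift_deg c a * lift_deg (n - c) b) $$ (k, l) = (\<Sum>s<r. ?S s c)" for c
    using assms by (simp add: lift_deg_eq scalar_prod_def atLeast0LessThan)
  moreover have "lift_deg n (a * b) $$ (k, l) = (\<Sum>s<r. \<Sum>c\<le>n. ?T s c)"
    using assms by (simp add: lift_deg_eq scalar_prod_def atLeast0LessThan coeff_sum coeff_mult
        poly_X_sum sum_distrib_right)
  ultimately have "(\<Sum>c\<le>n. (lift_deg c a * lift_deg (n - c) b) $$ (k, l)) - lift_deg n (a * b) $$ (k, l) =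
      (\<Sum>c\<le>n. \<Sum>s<r. ?S s c - ?T s c)"
    by (simp add: sum_subtractf sum.swap[of _ "{..<r}"])
  moreover have "?S s c - ?T s c \<in> xy_below n" if "c \<le> n" for s c
    using symbol_mult[of "coeff (a $$ (k, s)) c" c "coeff (b $$ (s, l)) (n - c)" "n - c"] that by simp
  moreover have "(\<Sum>c\<le>n. \<Sum>s<r. ?S s c - ?T s c) \<in> xy_below n"
    by (intro xy_below_sum) (simp add: calculation(2))
  ultimately show ?thesis by simp
qed

section \<open>Sums and matrix units\<close>

lemma (in abelian_monoid) finsum_triangle:
  assumes "\<And>i j. g i j \<in> carrier G"
  shows "(\<Oplus>i\<in>{..m::nat}. \<Oplus>j\<in>{..m - i}. g i j) = (\<Oplus>n\<in>{..m}. \<Oplus>i\<in>{..n}. g i (n - i))"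
proof (induction m)
  case 0
  show ?case using assms by simp
next
  case (Suc m)
  have "(\<Oplus>i\<in>{..m}. \<Oplus>j\<in>{..Suc m - i}. g i j) =
      (\<Oplus>i\<in>{..m}. g i (Suc m - i) \<oplus> (\<Oplus>j\<in>{..m - i}. g i j))"
    using assms by (intro finsum_cong') (auto simp: Suc_diff_le Pi_def)
  also have "\<dots> = (\<Oplus>i\<in>{..m}. g i (Suc m - i)) \<oplus> (\<Oplus>i\<in>{..m}. \<Oplus>j\<in>{..m - i}. g i j)"
    using assms by (intro finsum_addf) (auto simp: Pi_def)
  finally show ?case
    using assms Suc.IH by (simp add: Pi_def a_ac)
qed

lemma (in abelian_monoid) finsum_atMost_rev:
  assumes "\<And>i. g i \<in> carrier G"
  shows "(\<Oplus>i\<in>{..n::nat}. g (n - i)) = (\<Oplus>i\<in>{..n}. g i)"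
proof -
  have "inj_on (\<lambda>i. n - i) {..n}" by (auto simp: inj_on_def)
  moreover have "(\<lambda>i. n - i) ` {..n} = {..n}"
  proof safe
    fix i assume "i \<le> n"
    then show "i \<in> (\<lambda>i. n - i) ` {..n}" by (intro image_eqI[of _ _ "n - i"]) auto
  qed auto
  ultimately show ?thesis using finsum_reindex[of g "\<lambda>i. n - i" "{..n}"] assms by simp
qed

lemma module_minus_eq:
  assumes "module (class_ring :: complex ring) M" "y \<in> carrier M"
  shows "x \<ominus>\<^bsub>M\<^esub> y = x \<oplus>\<^bsub>M\<^esub> (- 1) \<odot>\<^bsub>M\<^esub> y"
  by (simp add: a_minus_def complex_module_simps(5)[OF assms])

lemma mat_unit_carrier [simp]: "mat_unit r i j P \<in> carrier_mat r r"
  by (simp add: mat_unit_def)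

lemma mat_unit_add: "mat_unit r i j (p + q :: xy_alg) = mat_unit r i j p + mat_unit r i j q"
  by (intro eq_matI) (auto simp: mat_unit_def)

lemma mat_unit_const_xy: "mat_unit r i j (const_xy c * q) = const_xy c \<cdot>\<^sub>m mat_unit r i j q"
  by (intro eq_matI) (auto simp: mat_unit_def)

lemma lift_deg_mat_unit:
  "lift_deg b (mat_unit r i j P) = mat_unit r i j (poly_X (coeff P b) * gen_Y ^ b)"
  by (intro eq_matI) (auto simp: lift_deg_eq mat_unit_def)

lemma V_act_mat_unit:
  assumes "i < r" "q < r"
  shows "V_act N (mat_unit r i j (gen_X ^ k * gen_Y ^ b)) (basis_vec (q, s)) =
    (if q = j \<and> s + int k < N then scale (of_int s ^ b) (basis_vec (i, s + int k)) else 0)"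
proof -
  have monomial: "laurent_act (gen_X ^ k * gen_Y ^ b) (basis_vec s) = scale (of_int s ^ b) (basis_vec (s + int k))"
    using pm.linear_scale[OF laurent_act_linear, of "gen_X ^ k" "of_int s ^ b" "basis_vec s"]
    by (simp add: laurent_act_simps laurent_act_gen_Y_power laurent_act_gen_X_power scale_single)
  have "V_act N (mat_unit r i j (gen_X ^ k * gen_Y ^ b)) (basis_vec (q, s)) =
      (\<Sum>p<r. if p = i then (if q = j then truncate N i (scale (of_int s ^ b) (basis_vec (s + int k))) else 0) else 0)"
    unfolding V_act_basis using assms
    by (intro sum.cong) (auto simp: mat_unit_def monomial laurent_act_simps(1) pm.linear_0[OF truncate_linear])
  also have "\<dots> = (if q = j then truncate N i (scale (of_int s ^ b) (basis_vec (s + int k))) else 0)"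
    using assms by (simp add: sum.delta)
  finally show ?thesis by (simp only: truncate_scale truncate_basis) auto
qed

text \<open>Replacing a factor of a basis tensor by another one of its factors gives a repetition.\<close>

lemma pure_tensor_repeated_basis:
  assumes "set bs \<subseteq> B" "t < length bs" "e \<in> set bs" "e \<noteq> bs ! t"
  shows "pure_tensor ((map basis_vec bs)[t := basis_vec e]) \<in> alt_relations B (length bs)"
proof -
  from assms(3) obtain t' where t': "t' < length bs" "bs ! t' = e" by (auto simp: in_set_conv_nth)
  then have "t' \<noteq> t" using assms(4) by auto
  let ?vs = "(map basis_vec bs)[t := basis_vec e]"
  have "\<not> distinct ?vs"
    using nth_eq_iff_index_eq[of ?vs t t'] assms(2) t' \<open>t' \<noteq> t\<close> by auto
  moreover have "Poly_Mapping.keys u \<subseteq> B" if "u \<in> set ?vs" for u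
  proof -
    have "u \<in> insert (basis_vec e) (set (map basis_vec bs))"
      using set_update_subset_insert[of "map basis_vec bs" t "basis_vec e"] that by blast
    then show ?thesis using assms(1,3) by auto
  qed
  ultimately show ?thesis by (intro pure_tensor_in_alt_relations) auto
qed

section \<open>The representation generated by a wedge product\<close>

context
  fixes \<xi> :: "nat list" and N :: int
begin

private abbreviation (input) "r \<equiv> length \<xi>"
private abbreviation (input) "boxes \<equiv> sum_list \<xi>"
private abbreviation (input) "B \<equiv> V_basis (length \<xi>) N"


lemma wedge_space_cases:
  assumes "w \<in> carrier (wedge_space \<xi> N)"
  obtains t where "w = ext_class B boxes t" "Poly_Mapping.keys t \<subseteq> words B boxes"
  using assms by (auto simp: carrier_ext_power)

lemma wedge_act_class:
  assumes "a \<in> carrier_mat r r" "Poly_Mapping.keys t \<subseteq> words B boxes"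
  shows "wedge_act \<xi> N a (ext_class B boxes t) = ext_class B boxes (tensor_der (V_act N a) t)"
  unfolding wedge_act_def by (rule ext_der_class[OF stable_V_act[OF assms(1)] assms(2)])

lemma keys_tensor_der_V_act:
  assumes "a \<in> carrier_mat r r" "Poly_Mapping.keys t \<subseteq> words B boxes"
  shows "Poly_Mapping.keys (tensor_der (V_act N a) t) \<subseteq> words B boxes"
  by (rule keys_tensor_der_stable[OF stable_V_act[OF assms(1)] assms(2)])

lemma wedge_act_closed:
  assumes "a \<in> carrier_mat r r" "w \<in> carrier (wedge_space \<xi> N)"
  shows "wedge_act \<xi> N a w \<in> carrier (wedge_space \<xi> N)"
  using assms(2) by (elim wedge_space_cases)
    (simp add: wedge_act_class assms(1) keys_tensor_der_V_act ext_class_closed)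

lemma wedge_act_add:
  assumes "a \<in> carrier_mat r r" "w \<in> carrier (wedge_space \<xi> N)" "w' \<in> carrier (wedge_space \<xi> N)"
  shows "wedge_act \<xi> N a (w \<oplus>\<^bsub>wedge_space \<xi> N\<^esub> w') =
     wedge_act \<xi> N a w \<oplus>\<^bsub>wedge_space \<xi> N\<^esub> wedge_act \<xi> N a w'"
  using assms(2,3) by (elim wedge_space_cases)
    (simp add: wedge_act_class assms(1) keys_tensor_der_V_act ext_class_add keys_add_subset
      tensor_der_add)

lemma keys_scale_subset: "Poly_Mapping.keys t \<subseteq> A \<Longrightarrow> Poly_Mapping.keys (scale c t) \<subseteq> A"
  using keys_scale by (rule order_trans)

lemma wedge_act_smult:
  assumes "a \<in> carrier_mat r r" "w \<in> carrier (wedge_space \<xi> N)"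
  shows "wedge_act \<xi> N a (c \<odot>\<^bsub>wedge_space \<xi> N\<^esub> w) = c \<odot>\<^bsub>wedge_space \<xi> N\<^esub> wedge_act \<xi> N a w"
  using assms(2) by (elim wedge_space_cases)
    (simp add: wedge_act_class assms(1) keys_tensor_der_V_act ext_class_smult keys_scale_subset
      tensor_der_scale)

lemma words_subset_lists: "Poly_Mapping.keys t \<subseteq> words A m \<Longrightarrow> Poly_Mapping.keys t \<subseteq> lists A"
  by (auto simp: in_lists_conv_set)

lemma wedge_plus_act:
  assumes "a \<in> carrier_mat r r" "b \<in> carrier_mat r r" "w \<in> carrier (wedge_space \<xi> N)"
  shows "wedge_act \<xi> N (a + b) w = wedge_act \<xi> N a w \<oplus>\<^bsub>wedge_space \<xi> N\<^esub> wedge_act \<xi> N b w"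
  using assms(3)
proof (rule wedge_space_cases)
  fix t assume t: "w = ext_class B boxes t" "Poly_Mapping.keys t \<subseteq> words B boxes"
  have "tensor_der (V_act N (a + b)) t = tensor_der (V_act N a) t + tensor_der (V_act N b) t"
    by (rule tensor_der_plus[where \<phi> = "V_act N a" and \<psi> = "V_act N b" and B = B, OF V_act_plus[OF assms(1,2)] words_subset_lists[OF t(2)]])
  with t assms(1,2) show ?thesis
    by (simp add: wedge_act_class keys_tensor_der_V_act ext_class_add)
qed

lemma wedge_smult_act:
  assumes "a \<in> carrier_mat r r" "w \<in> carrier (wedge_space \<xi> N)"
  shows "wedge_act \<xi> N (const_xy c \<cdot>\<^sub>m a) w = c \<odot>\<^bsub>wedge_space \<xi> N\<^esub> wedge_act \<xi> N a w"
  using assms(2)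
proof (rule wedge_space_cases)
  fix t assume t: "w = ext_class B boxes t" "Poly_Mapping.keys t \<subseteq> words B boxes"
  have "tensor_der (V_act N (const_xy c \<cdot>\<^sub>m a)) t = scale c (tensor_der (V_act N a) t)"
    by (rule tensor_der_smult[where \<phi> = "V_act N a" and B = B, OF V_act_smult[OF assms(1)] words_subset_lists[OF t(2)]])
  with t assms(1) show ?thesis
    by (simp add: wedge_act_class keys_tensor_der_V_act ext_class_smult)
qed

lemma wedge_commutator_act:
  assumes "a \<in> carrier_mat r r" "b \<in> carrier_mat r r" "w \<in> carrier (wedge_space \<xi> N)"
  shows "wedge_act \<xi> N (a * b - b * a) w =
     wedge_act \<xi> N a (wedge_act \<xi> N b w) \<ominus>\<^bsub>wedge_space \<xi> N\<^esub> wedge_act \<xi> N b (wedge_act \<xi> N a w)"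
  using assms(3)
proof (rule wedge_space_cases)
  fix t assume t: "w = ext_class B boxes t" "Poly_Mapping.keys t \<subseteq> words B boxes"
  have "tensor_der (V_act N (a * b - b * a)) t =
      tensor_der (V_act N a) (tensor_der (V_act N b) t) - tensor_der (V_act N b) (tensor_der (V_act N a) t)"
    by (rule tensor_der_commutator[OF V_act_linear V_act_linear V_act_commutator[OF assms(1,2)]
        words_subset_lists[OF t(2)]])
  moreover have "a * b - b * a \<in> carrier_mat r r"
    using assms(1,2) by (intro minus_carrier_mat mult_carrier_mat)
  ultimately show ?thesis using t assms(1,2)
    by (simp add: wedge_act_class keys_tensor_der_V_act ext_class_minus)
qed

text \<open>The factors of the wedge product \<open>v\<^sub>\<xi>\<close>, in the order in which it is formed.\<close>

definition v_word :: "(nat \<times> int) list" where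
  "v_word = concat (map (\<lambda>j. map (Pair j) [N - int (\<xi> ! j)..N - 1]) [0..<r])"

lemma set_v_word: "set v_word = {(j, i). j < r \<and> N - int (\<xi> ! j) \<le> i \<and> i < N}"
  by (auto simp: v_word_def)

lemma length_v_word: "length v_word = boxes"
proof -
  have "map (\<lambda>j. length (map (Pair j) [N - int (\<xi> ! j)..N - 1])) [0..<r] = map ((!) \<xi>) [0..<r]"
    by simp
  then show ?thesis by (simp add: v_word_def length_concat o_def map_nth)
qed

lemma v_word_in_words: "v_word \<in> words B boxes"
  using set_v_word length_v_word by (auto simp: V_basis_def)

lemma v_vec_eq: "v_vec \<xi> N = ext_class B boxes (basis_vec v_word)"
proof -
  let ?vs = "concat (map (\<lambda>j. map (\<lambda>i. basis_vec (j, i)) [N - int (\<xi> ! j)..N - 1]) [0..<r])"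
  have "?vs = map basis_vec v_word"
    by (simp add: v_word_def map_concat o_def)
  then have "pure_tensor ?vs = basis_vec v_word" "length ?vs = boxes"
    by (simp_all only: pure_tensor_basis length_map length_v_word)
  then show ?thesis unfolding v_vec_def wedge_def by (simp only:)
qed

text \<open>The action never lowers the exponents of \<open>x\<close>, which are bounded above by \<open>N\<close>. Hence everything that
  \<open>v\<^sub>\<xi>\<close> generates lives on the finitely many words whose exponents are not below those in \<open>v\<^sub>\<xi>\<close>.\<close>

lemma finite_dimensional_stable_subspace:
  obtains A where "finite A" "A \<subseteq> carrier (wedge_space \<xi> N)"
    "v_vec \<xi> N \<in> LinearCombinations.module.span class_ring (wedge_space \<xi> N) A"
    "\<And>a w. a \<in> carrier_mat r r \<Longrightarrow> w \<in> LinearCombinations.module.span class_ring (wedge_space \<xi> N) A \<Longrightarrow>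
       wedge_act \<xi> N a w \<in> LinearCombinations.module.span class_ring (wedge_space \<xi> N) A"
proof -
  let ?W = "wedge_space \<xi> N"
  let ?span = "LinearCombinations.module.span class_ring ?W"
  define B' where "B' = {..<r} \<times> {N - int boxes..<N}"
  define A where "A = (\<lambda>bs. ext_class B boxes (basis_vec bs)) ` words B' boxes"
  have B': "B' \<subseteq> B" by (auto simp: B'_def V_basis_def)
  then have words: "words B' boxes \<subseteq> words B boxes" by auto
  have "finite (words B' boxes)"
    using finite_lists_length_eq[of B' boxes] by (simp add: B'_def conj_commute)
  then have finA: "finite A" by (simp add: A_def)
  have A: "A \<subseteq> carrier ?W" 
    unfolding A_def using B' by (intro image_subsetI ext_class_closed) auto
  note S = submod_span[OF module_ext_power A]
  have class_in: "ext_class B boxes t \<in> ?span A" if t: "Poly_Mapping.keys t \<subseteq> words B' boxes" for t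
  proof -
    have "ext_class B boxes (\<Sum>bs\<in>F. scale (Poly_Mapping.lookup t bs) (basis_vec bs)) \<in> ?span A \<and>
        Poly_Mapping.keys (\<Sum>bs\<in>F. scale (Poly_Mapping.lookup t bs) (basis_vec bs)) \<subseteq> words B boxes"
      if "finite F" "F \<subseteq> words B' boxes" for F
      using that
    proof (induction F)
      case empty
      then show ?case using submodD(3)[OF S] ext_class_eq_zero_iff[of 0 boxes B] alt_relations_closed(1)[of B boxes] by simp
    next
      case (insert bs F)
      let ?s = "scale (Poly_Mapping.lookup t bs) (basis_vec bs)"
      have bs: "Poly_Mapping.keys (basis_vec bs) \<subseteq> words B boxes" using insert.prems words by auto
      then have s: "Poly_Mapping.keys ?s \<subseteq> words B boxes" by (rule keys_scale_subset)
      have "ext_class B boxes (basis_vec bs) \<in> ?span A"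
        using span_superset[OF module_ext_power A] insert.prems by (auto simp: A_def)
      from submodD(5)[OF S this] have s_in: "ext_class B boxes ?s \<in> ?span A"
        unfolding ext_class_smult[OF bs] .
      let ?t = "\<Sum>bs\<in>F. scale (Poly_Mapping.lookup t bs) (basis_vec bs)"
      have t: "ext_class B boxes ?t \<in> ?span A" "Poly_Mapping.keys ?t \<subseteq> words B boxes"
        using insert.IH insert.prems by blast+
      have "ext_class B boxes (?s + ?t) \<in> ?span A"
        using submodD(4)[OF S s_in t(1)] unfolding ext_class_add[OF s t(2)] .
      then show ?case
        unfolding sum.insert[OF insert.hyps] using keys_add_subset[OF s t(2)] by blast
    qed
    from this[OF finite_keys t] have "ext_class B boxes (lin_ext basis_vec t) \<in> ?span A"
      by (simp add: lin_ext_def)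
    moreover have "lin_map (\<lambda>t. t)" by (rule lin_mapI) auto
    then have "lin_ext basis_vec t = t" using lin_map_eq_lin_ext[of "\<lambda>t. t" t] by metis
    ultimately show ?thesis by simp
  qed
  have le: "\<xi> ! j \<le> boxes" if "j < r" for j by (rule elem_le_sum_list[OF that])
  have "v_word \<in> words B' boxes"
  proof -
    have "set v_word \<subseteq> B'" using le by (force simp: set_v_word B'_def)
    then show ?thesis by (simp add: length_v_word)
  qed
  then have "v_vec \<xi> N \<in> ?span A" unfolding v_vec_eq by (intro class_in) simp
  moreover have "wedge_act \<xi> N a w \<in> ?span A" if a: "a \<in> carrier_mat r r" and w: "w \<in> ?span A" for a w
  proof -
    let ?H = "{w \<in> carrier ?W. wedge_act \<xi> N a w \<in> ?span A}"
    have zero: "wedge_act \<xi> N a \<zero>\<^bsub>?W\<^esub> = \<zero>\<^bsub>?W\<^esub>"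
      using wedge_act_class[OF a, of 0] ext_class_eq_zero_iff[of 0 boxes B] alt_relations_closed(1)[of B boxes]
      by (simp add: tensor_der_zero)
    interpret W: Module.module class_ring ?W by (rule module_ext_power)
    have "submod ?H ?W"
      by (rule submodI[OF module_ext_power])
        (use submodD[OF S] in \<open>auto simp: zero wedge_act_add[OF a] wedge_act_smult[OF a]\<close>)
    moreover have "A \<subseteq> ?H"
    proof
      fix w assume "w \<in> A"
      then obtain bs where w: "w = ext_class B boxes (basis_vec bs)" "bs \<in> words B' boxes" by (auto simp: A_def)
      then have bs: "Poly_Mapping.keys (basis_vec bs) \<subseteq> words B boxes" using words by auto
      have "Poly_Mapping.keys (V_act N a (basis_vec b)) \<subseteq> B'" if "b \<in> B'" for b
        using keys_V_act[OF a, of N "fst b" "snd b"] that by (force simp: B'_def)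
      then have "Poly_Mapping.keys (tensor_der (V_act N a) (basis_vec bs)) \<subseteq> words B' boxes"
        using w by (intro keys_tensor_der) auto
      then have "wedge_act \<xi> N a w \<in> ?span A"
        using class_in wedge_act_class[OF a bs] w by simp
      then show "w \<in> ?H" using A \<open>w \<in> A\<close> by blast
    qed
    ultimately show ?thesis using span_minimal w by blast
  qed
  ultimately show thesis by (intro that[OF finA A])
qed

section \<open>The filtered module and its associated graded module\<close>

private abbreviation (input) "W \<equiv> wedge_space \<xi> N"
private abbreviation (input) "act \<equiv> wedge_act \<xi> N"
private abbreviation (input) "F \<equiv> filt_V \<xi> N"
private abbreviation (input) "Fp \<equiv> filt_V_pred \<xi> N"
private abbreviation (input) "v \<equiv> v_vec \<xi> N"
private abbreviation (input) "gr \<equiv> gr_V \<xi> N"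
private abbreviation (input) "cls m \<equiv> a_r_coset W (Fp m)"

interpretation W: Module.module class_ring W
  by (rule module_ext_power)

lemma v_vec_closed: "v \<in> carrier W"
  unfolding v_vec_eq by (rule ext_class_closed) (use v_word_in_words in simp)

lemma wedge_act_zero_right: "a \<in> carrier_mat r r \<Longrightarrow> act a \<zero>\<^bsub>W\<^esub> = \<zero>\<^bsub>W\<^esub>"
  using wedge_act_smult[of a "\<zero>\<^bsub>W\<^esub>" 0] wedge_act_closed[of a "\<zero>\<^bsub>W\<^esub>"]
  by (simp add: complex_module_simps[OF module_ext_power])

lemma wedge_act_zero_left:
  assumes "w \<in> carrier W"
  shows "act (0\<^sub>m r r) w = \<zero>\<^bsub>W\<^esub>"
proof -
  have "const_xy 0 \<cdot>\<^sub>m 0\<^sub>m r r = (0\<^sub>m r r :: xy_alg mat)" by (intro eq_matI) auto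
  then show ?thesis
    using wedge_smult_act[of "0\<^sub>m r r" w 0] assms wedge_act_closed[of "0\<^sub>m r r" w]
    by (simp add: complex_module_simps[OF module_ext_power])
qed

private abbreviation (input) "gens m \<equiv> {foldr act as v | as ms.
  list_all2 (\<lambda>a k. a \<in> filt_G r k) as ms \<and> sum_list ms \<le> m}"

lemma foldr_wedge_act_closed:
  "list_all2 (\<lambda>a k. a \<in> filt_G r k) as ms \<Longrightarrow> foldr act as v \<in> carrier W"
  by (induction rule: list_all2_induct) (auto simp: v_vec_closed wedge_act_closed filt_G_carrier)

lemma gens_subset: "gens m \<subseteq> carrier W"
  using foldr_wedge_act_closed by blast

lemma submod_filt_V: "submod (F m) W"
  unfolding filt_V_def by (rule submod_span[OF module_ext_power gens_subset])

lemma filt_V_generator: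
  "list_all2 (\<lambda>a k. a \<in> filt_G r k) as ms \<Longrightarrow> sum_list ms \<le> m \<Longrightarrow> foldr act as v \<in> F m"
  unfolding filt_V_def using span_superset[OF module_ext_power gens_subset] by blast

lemma filt_V_closed: "w \<in> F m \<Longrightarrow> w \<in> carrier W"
  using submodD(2)[OF submod_filt_V] by blast

lemma v_vec_in_filt_V: "v \<in> F m"
  using filt_V_generator[of "[]" "[]" m] by simp

lemma filt_V_mono:
  assumes "m \<le> m'"
  shows "F m \<subseteq> F m'"
proof -
  have "gens m \<subseteq> F m'" using filt_V_generator assms by (blast intro: order_trans)
  from span_minimal[OF submod_filt_V this] show ?thesis unfolding filt_V_def .
qed

lemma submod_filt_V_pred: "submod (Fp m) W"
  by (cases m) (simp_all add: filt_V_pred_def submod_filt_V submod_zero[OF module_ext_power])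

lemma filt_V_pred_subset: "Fp m \<subseteq> F m"
  using submodD(3)[OF submod_filt_V, of m] filt_V_mono[of "m - 1" m]
  by (cases m) (auto simp: filt_V_pred_def)

lemma wedge_act_filt_V:
  assumes a: "a \<in> filt_G r k" and w: "w \<in> F m"
  shows "act a w \<in> F (k + m)"
proof -
  let ?H = "{w \<in> carrier W. act a w \<in> F (k + m)}"
  have "submod ?H W"
    by (rule submodI[OF module_ext_power])
      (use submodD[OF submod_filt_V] filt_G_carrier[OF a]
        in \<open>auto simp: wedge_act_zero_right wedge_act_add wedge_act_smult\<close>)
  moreover have "gens m \<subseteq> ?H"
  proof clarify
    fix as ms assume as: "list_all2 (\<lambda>a k. a \<in> filt_G r k) as ms" "sum_list ms \<le> m"
    then have "foldr act (a # as) v \<in> F (k + m)"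
      using a by (intro filt_V_generator[of _ "k # ms"]) auto
    then show "foldr act as v \<in> carrier W \<and> act a (foldr act as v) \<in> F (k + m)"
      using foldr_wedge_act_closed[OF as(1)] by simp
  qed
  ultimately have "F m \<subseteq> ?H" unfolding filt_V_def[of \<xi> N m] by (rule span_minimal)
  then show ?thesis using w by blast
qed

lemma wedge_act_filt_V_pred:
  assumes a: "a \<in> filt_G r k" and w: "w \<in> Fp m"
  shows "act a w \<in> Fp (k + m)"
proof (cases m)
  case 0
  then have "act a w = \<zero>\<^bsub>W\<^esub>"
    using w wedge_act_zero_right[OF filt_G_carrier[OF a]] by (simp add: filt_V_pred_def)
  then show ?thesis using submodD(3)[OF submod_filt_V_pred] by metis
next
  case (Suc m')
  then show ?thesis using wedge_act_filt_V[OF a, of w m'] w by (simp add: filt_V_pred_def)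
qed

text \<open>For \<open>k = 0\<close> the only such matrix is \<open>0\<close>, in accordance with the convention that nothing but \<open>0\<close>
  lies below degree \<open>0\<close> of the filtration.\<close>

lemma wedge_act_mats_below:
  assumes a: "a \<in> mats_below r k" and w: "w \<in> F m"
  shows "act a w \<in> Fp (k + m)"
proof (cases k)
  case 0
  then have "a = 0\<^sub>m r r" using a by (intro eq_matI) (auto simp: mats_below_def xy_below_0)
  then show ?thesis
    using wedge_act_zero_left[OF filt_V_closed[OF w]] submodD(3)[OF submod_filt_V_pred] by metis
next
  case (Suc k')
  then have "a \<in> filt_G r k'" using a mats_below_Suc by blast
  from wedge_act_filt_V[OF this w] Suc show ?thesis by (simp add: filt_V_pred_def)
qed

lemma lift_deg_in_filt_G: "a \<in> carrier_mat r r \<Longrightarrow> lift_deg b a \<in> filt_G r b"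
  using lift_deg_in_mats_below mats_below_Suc by blast

lemma submod_pred_in_filt: "submod (Fp m) (W\<lparr>carrier := F m\<rparr>)"
  by (rule submodI[OF W.submodule_is_module[OF submod_filt_V]])
    (use submodD[OF submod_filt_V_pred] filt_V_pred_subset in auto)

interpretation gr: module_quotient "W\<lparr>carrier := F m\<rparr>" "Fp m" for m
  by (intro module_quotient.intro module_quotient_axioms.intro W.submodule_is_module
      submod_filt_V submod_pred_in_filt)

lemma module_gr_V: "module class_ring (gr m)"
  unfolding gr_V_def by (rule gr.module_quot_module)

interpretation grm: Module.module class_ring "gr m" for m
  by (rule module_gr_V)

lemma gr_V_simps:
  "carrier (gr m) = {cls m x | x. x \<in> F m}"
  "\<zero>\<^bsub>gr m\<^esub> = Fp m"
  "x \<in> F m \<Longrightarrow> y \<in> F m \<Longrightarrow> cls m x \<oplus>\<^bsub>gr m\<^esub> cls m y = cls m (x \<oplus>\<^bsub>W\<^esub> y)"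
  "x \<in> F m \<Longrightarrow> c \<odot>\<^bsub>gr m\<^esub> cls m x = cls m (c \<odot>\<^bsub>W\<^esub> x)"
  "x \<in> F m \<Longrightarrow> cls m x = \<zero>\<^bsub>gr m\<^esub> \<longleftrightarrow> x \<in> Fp m"
  unfolding gr_V_def
  using gr.carrier_quot[of m] gr.quot_zero[of m] gr.quot_add[of x m y] gr.quot_smult[of x m c]
    gr.coset_eq_zero_iff[of x m]
  by simp_all

lemma cls_closed: "x \<in> F m \<Longrightarrow> cls m x \<in> carrier (gr m)"
  by (auto simp: gr_V_simps(1))

lemma filt_V_finsum:
  assumes "finite A" "\<And>b. b \<in> A \<Longrightarrow> g b \<in> F m"
  shows "(\<Oplus>\<^bsub>W\<^esub>b\<in>A. g b) \<in> F m \<and> cls m (\<Oplus>\<^bsub>W\<^esub>b\<in>A. g b) = (\<Oplus>\<^bsub>gr m\<^esub>b\<in>A. cls m (g b))"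
  using assms
proof (induction A)
  case empty
  then show ?case using submodD(3)[OF submod_filt_V, of m] submodD(3)[OF submod_filt_V_pred, of m]
    by (simp add: gr_V_simps(5))
next
  case (insert b A)
  have gb: "g b \<in> F m" using insert.prems by simp
  have IH: "(\<Oplus>\<^bsub>W\<^esub>b\<in>A. g b) \<in> F m"
      "cls m (\<Oplus>\<^bsub>W\<^esub>b\<in>A. g b) = (\<Oplus>\<^bsub>gr m\<^esub>b\<in>A. cls m (g b))"
    using insert by auto
  have W: "(\<Oplus>\<^bsub>W\<^esub>b\<in>insert b A. g b) = g b \<oplus>\<^bsub>W\<^esub> (\<Oplus>\<^bsub>W\<^esub>b\<in>A. g b)"
    using insert.prems filt_V_closed by (intro W.M.finsum_insert insert.hyps) auto
  have gr: "(\<Oplus>\<^bsub>gr m\<^esub>b\<in>insert b A. cls m (g b)) =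
      cls m (g b) \<oplus>\<^bsub>gr m\<^esub> (\<Oplus>\<^bsub>gr m\<^esub>b\<in>A. cls m (g b))"
    using insert.prems cls_closed by (intro grm.M.finsum_insert insert.hyps) auto
  show ?case
    unfolding W gr IH(2)[symmetric]
    using submodD(4)[OF submod_filt_V gb IH(1)] gr_V_simps(3)[OF gb IH(1)] by simp
qed

section \<open>The action on representatives\<close>

text \<open>Elements of the graded module are handled through sequences of representatives;
  \<open>conv_act a x\<close> represents the image under \<open>a\<close> of the element that \<open>x\<close> represents.\<close>

definition conv_act :: "poly2 mat \<Rightarrow> (nat \<Rightarrow> ((nat \<times> int) list \<Rightarrow>\<^sub>0 complex) set) \<Rightarrow>
    nat \<Rightarrow> ((nat \<times> int) list \<Rightarrow>\<^sub>0 complex) set" where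
  "conv_act a x m = (\<Oplus>\<^bsub>W\<^esub>b\<in>{..m}. act (lift_deg b a) (x (m - b)))"

lemma lift_deg_act_closed:
  assumes "a \<in> carrier_mat r r" "x \<in> F (m - b)" "b \<le> m"
  shows "act (lift_deg b a) x \<in> F m"
  using wedge_act_filt_V[OF lift_deg_in_filt_G[OF assms(1), of b] assms(2)] assms(3) by simp

lemma conv_act_closed:
  assumes "a \<in> carrier_mat r r" "\<And>i. x i \<in> F i"
  shows "conv_act a x m \<in> F m"
  unfolding conv_act_def using filt_V_finsum[of "{..m}"] lift_deg_act_closed assms by simp

lemma UN_cls_act:
  assumes a: "a \<in> carrier_mat r r" and x: "x \<in> F (m - b)" and b: "b \<le> m"
  shows "(\<Union>w\<in>cls (m - b) x. cls m (act (lift_deg b a) w)) = cls m (act (lift_deg b a) x)"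
proof -
  note L = lift_deg_in_filt_G[OF a, of b]
  have "(\<Union>w\<in>a_r_coset (W\<lparr>carrier := F (m - b)\<rparr>) (Fp (m - b)) x.
      a_r_coset (W\<lparr>carrier := F m\<rparr>) (Fp m) (act (lift_deg b a) w)) =
      a_r_coset (W\<lparr>carrier := F m\<rparr>) (Fp m) (act (lift_deg b a) x)"
  proof (rule UN_coset_eq)
    fix h assume h: "h \<in> Fp (m - b)"
    then have "h \<in> carrier W" using submodD(2)[OF submod_filt_V_pred] by blast
    then show "act (lift_deg b a) (h \<oplus>\<^bsub>W\<lparr>carrier := F (m - b)\<rparr>\<^esub> x) =
        act (lift_deg b a) h \<oplus>\<^bsub>W\<lparr>carrier := F m\<rparr>\<^esub> act (lift_deg b a) x"
      using wedge_act_add[OF filt_G_carrier[OF L]] filt_V_closed[OF x] by simp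
    show "act (lift_deg b a) h \<in> Fp m" using wedge_act_filt_V_pred[OF L h] b by simp
  qed (use x lift_deg_act_closed[OF a x b] gr.module_quotient_axioms in simp_all)
  then show ?thesis by simp
qed

lemma V_module_act_cls:
  assumes a: "a \<in> carrier_mat r r" and x: "\<And>i. x i \<in> F i"
  shows "V_module_act \<xi> N a (\<lambda>i. cls i (x i)) = (\<lambda>m. cls m (conv_act a x m))"
proof
  fix m
  have "V_module_act \<xi> N a (\<lambda>i. cls i (x i)) m =
      (\<Oplus>\<^bsub>gr m\<^esub>b\<in>{..m}. cls m (act (lift_deg b a) (x (m - b))))"
    unfolding V_module_act_def
  proof (rule grm.M.finsum_cong')
    show "(\<lambda>b. cls m (act (lift_deg b a) (x (m - b)))) \<in> {..m} \<rightarrow> carrier (gr m)"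
      using lift_deg_act_closed[OF a x] cls_closed by auto
  qed (use UN_cls_act[OF a x] in auto)
  also have "\<dots> = cls m (conv_act a x m)"
    unfolding conv_act_def using filt_V_finsum[of "{..m}" "\<lambda>b. act (lift_deg b a) (x (m - b))" m]
      lift_deg_act_closed[OF a x] by simp
  finally show "V_module_act \<xi> N a (\<lambda>i. cls i (x i)) m = cls m (conv_act a x m)" .
qed

lemma conv_act_add:
  assumes "a \<in> carrier_mat r r" "\<And>i. x i \<in> carrier W" "\<And>i. y i \<in> carrier W"
  shows "conv_act a (\<lambda>i. x i \<oplus>\<^bsub>W\<^esub> y i) m = conv_act a x m \<oplus>\<^bsub>W\<^esub> conv_act a y m"
proof -
  have c: "act (lift_deg b a) (x (m - b)) \<in> carrier W" "act (lift_deg b a) (y (m - b)) \<in> carrier W" for b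
    using assms wedge_act_closed lift_deg_carrier by auto
  show ?thesis
    unfolding conv_act_def wedge_act_add[OF lift_deg_carrier[OF assms(1)] assms(2,3)]
    by (intro W.M.finsum_addf) (use c in auto)
qed

lemma conv_act_smult:
  assumes "a \<in> carrier_mat r r" "\<And>i. x i \<in> carrier W"
  shows "conv_act a (\<lambda>i. c \<odot>\<^bsub>W\<^esub> x i) m = c \<odot>\<^bsub>W\<^esub> conv_act a x m"
proof -
  have "act (lift_deg b a) (x (m - b)) \<in> carrier W" for b
    using assms wedge_act_closed lift_deg_carrier by auto
  then show ?thesis
    unfolding conv_act_def wedge_act_smult[OF lift_deg_carrier[OF assms(1)] assms(2)]
    by (subst W.finsum_smult_ldistr) auto
qed

lemma conv_plus_act:
  assumes "a \<in> carrier_mat r r" "b \<in> carrier_mat r r" "\<And>i. x i \<in> carrier W"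
  shows "conv_act (a + b) x m = conv_act a x m \<oplus>\<^bsub>W\<^esub> conv_act b x m"
proof -
  have c: "act (lift_deg c a) (x (m - c)) \<in> carrier W" "act (lift_deg c b) (x (m - c)) \<in> carrier W" for c
    using assms wedge_act_closed lift_deg_carrier by auto
  have "lift_deg c (a + b) = lift_deg c a + lift_deg c b" for c
    using assms(1,2) by (intro eq_matI) (auto simp: lift_deg_eq poly_X_add distrib_right)
  then have "act (lift_deg c (a + b)) (x (m - c)) =
      act (lift_deg c a) (x (m - c)) \<oplus>\<^bsub>W\<^esub> act (lift_deg c b) (x (m - c))" for c
    using wedge_plus_act[OF lift_deg_carrier[OF assms(1)] lift_deg_carrier[OF assms(2)] assms(3)]
    by simp
  then show ?thesis
    unfolding conv_act_def by (simp only:) (intro W.M.finsum_addf, use c in auto)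
qed

lemma conv_smult_act:
  assumes "a \<in> carrier_mat r r" "\<And>i. x i \<in> carrier W"
  shows "conv_act ([:[:c:]:] \<cdot>\<^sub>m a) x m = c \<odot>\<^bsub>W\<^esub> conv_act a x m"
proof -
  have cl: "act (lift_deg b a) (x (m - b)) \<in> carrier W" for b
    using assms wedge_act_closed lift_deg_carrier by auto
  have "lift_deg b ([:[:c:]:] \<cdot>\<^sub>m a) = const_xy c \<cdot>\<^sub>m lift_deg b a" for b
    using assms(1) by (intro eq_matI) (auto simp: lift_deg_eq poly_X_smult mult.assoc)
  then have "act (lift_deg b ([:[:c:]:] \<cdot>\<^sub>m a)) (x (m - b)) = c \<odot>\<^bsub>W\<^esub> act (lift_deg b a) (x (m - b))" for b
    using wedge_smult_act[OF lift_deg_carrier[OF assms(1)] assms(2)] by simp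
  then show ?thesis
    unfolding conv_act_def using cl by (subst W.finsum_smult_ldistr) auto
qed

lemma act_matrix_sum:
  assumes "\<And>c. M c \<in> carrier_mat r r" "w \<in> carrier W"
  shows "act (mat r r (\<lambda>kl. \<Sum>c\<le>(n::nat). M c $$ kl)) w = (\<Oplus>\<^bsub>W\<^esub>c\<in>{..n}. act (M c) w)"
proof (induction n)
  case 0
  have "mat r r (\<lambda>kl. \<Sum>c\<le>0. M c $$ kl) = M 0" using assms(1)[of 0] by (intro eq_matI) auto
  then show ?case using wedge_act_closed[OF assms] by simp
next
  case (Suc n)
  let ?M = "mat r r (\<lambda>kl. \<Sum>c\<le>n. M c $$ kl)"
  have "mat r r (\<lambda>kl. \<Sum>c\<le>Suc n. M c $$ kl) = M (Suc n) + ?M"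
    using assms(1)[of "Suc n"] by (intro eq_matI) (auto simp: add.commute)
  then show ?case
    using wedge_plus_act[of "M (Suc n)" ?M w] assms Suc.IH wedge_act_closed[OF assms]
    by (simp add: W.M.finsum_Suc Pi_def)
qed

text \<open>The lift of a commutator differs from the commutator of the lifts by a matrix of lower degree
  \<open>R\<close>, which maps \<open>F (m - n)\<close> into \<open>Fp m\<close> and so becomes \<open>0\<close> in degree \<open>m\<close>.\<close>

lemma act_lift_deg_commutator:
  assumes a: "a \<in> carrier_mat r r" and b: "b \<in> carrier_mat r r" and n: "n \<le> m" and w: "w \<in> F (m - n)"
  defines "S \<equiv> \<Oplus>\<^bsub>W\<^esub>c\<in>{..n}. act (lift_deg c a) (act (lift_deg (n - c) b) w) \<oplus>\<^bsub>W\<^esub>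
      (- 1) \<odot>\<^bsub>W\<^esub> act (lift_deg (n - c) b) (act (lift_deg c a) w)"
  shows "S \<in> F m \<and> cls m (act (lift_deg n (a * b - b * a)) w) = cls m S"
proof -
  define M where "M c = lift_deg c a * lift_deg (n - c) b - lift_deg (n - c) b * lift_deg c a" for c
  define T where "T = mat r r (\<lambda>kl. \<Sum>c\<le>n. M c $$ kl)"
  define R where "R = lift_deg n (a * b - b * a) - T"
  have ab: "a * b - b * a \<in> carrier_mat r r"
    using a b by (intro minus_carrier_mat mult_carrier_mat)
  have L: "lift_deg c a \<in> carrier_mat r r" "lift_deg c b \<in> carrier_mat r r" for c
    using a b by simp_all
  have M: "M c \<in> carrier_mat r r" for c
    unfolding M_def using L by (intro minus_carrier_mat mult_carrier_mat)
  have T: "T \<in> carrier_mat r r" by (simp add: T_def)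
  have w': "w \<in> carrier W" by (rule filt_V_closed[OF w])
  have R_below: "R \<in> mats_below r n"
    unfolding mats_below_def
  proof (intro CollectI conjI allI impI)
    show "R \<in> carrier_mat r r" unfolding R_def by (rule minus_carrier_mat[OF T])
    fix k l assume kl: "k < r" "l < r"
    have rev: "(\<Sum>c\<le>n. (lift_deg (n - c) b * lift_deg c a) $$ (k, l)) =
        (\<Sum>c\<le>n. (lift_deg c b * lift_deg (n - c) a) $$ (k, l))"
      by (rule sum.reindex_bij_witness[of _ "\<lambda>c. n - c" "\<lambda>c. n - c"]) auto
    have "R $$ (k, l) =
        ((\<Sum>c\<le>n. (lift_deg c b * lift_deg (n - c) a) $$ (k, l)) - lift_deg n (b * a) $$ (k, l)) -
        ((\<Sum>c\<le>n. (lift_deg c a * lift_deg (n - c) b) $$ (k, l)) - lift_deg n (a * b) $$ (k, l))"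
    proof -
      have "M c $$ (k, l) = (lift_deg c a * lift_deg (n - c) b) $$ (k, l) -
          (lift_deg (n - c) b * lift_deg c a) $$ (k, l)" for c
        unfolding M_def using carrier_matD[OF L(1)] carrier_matD[OF L(2)] kl by (simp del: index_mult_mat(1))
      then have "T $$ (k, l) = (\<Sum>c\<le>n. (lift_deg c a * lift_deg (n - c) b) $$ (k, l)) -
          (\<Sum>c\<le>n. (lift_deg c b * lift_deg (n - c) a) $$ (k, l))"
        using kl by (simp add: T_def sum_subtractf rev del: index_mult_mat(1))
      moreover have "poly_X (p - q) = poly_X p - poly_X q" for p q
        using poly_X_add[of p "- q"] by (simp add: poly_X_uminus)
      then have "lift_deg n (a * b - b * a) $$ (k, l) = lift_deg n (a * b) $$ (k, l) - lift_deg n (b * a) $$ (k, l)"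
        using a b kl by (simp add: lift_deg_eq left_diff_distrib del: index_mult_mat(1))
      ultimately show ?thesis using T ab kl by (simp add: R_def del: index_mult_mat(1))
    qed
    then show "R $$ (k, l) \<in> xy_below n"
      using lift_deg_mult[OF a b kl] lift_deg_mult[OF b a kl] by (simp add: xy_below_diff)
  qed
  then have R: "R \<in> carrier_mat r r" "act R w \<in> Fp m"
    using wedge_act_mats_below[OF R_below w] n by (auto simp: mats_below_def)
  have "lift_deg n (a * b - b * a) = T + R"
    using T R(1) lift_deg_carrier[OF ab] by (intro eq_matI) (auto simp: R_def)
  then have split: "act (lift_deg n (a * b - b * a)) w = act T w \<oplus>\<^bsub>W\<^esub> act R w"
    using wedge_plus_act[OF T R(1) w'] by simp
  have "act (M c) w = act (lift_deg c a) (act (lift_deg (n - c) b) w) \<oplus>\<^bsub>W\<^esub>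
      (- 1) \<odot>\<^bsub>W\<^esub> act (lift_deg (n - c) b) (act (lift_deg c a) w)" for c
    unfolding M_def using wedge_commutator_act[OF L(1) L(2) w'] L w'
    by (simp add: module_minus_eq[OF module_ext_power] wedge_act_closed)
  then have TS: "act T w = S"
    unfolding T_def S_def using act_matrix_sum[OF M w', where n = n] by simp
  have SF: "act T w \<in> F m"
  proof -
    have "act (lift_deg n (a * b - b * a)) w \<in> F m" by (rule lift_deg_act_closed[OF ab w n])
    moreover have "act R w \<in> F m" using R(2) filt_V_pred_subset by blast
    ultimately have "act (lift_deg n (a * b - b * a)) w \<ominus>\<^bsub>W\<^esub> act R w \<in> F m"
      by (rule submod_minus[OF submod_filt_V])
    moreover have "act (lift_deg n (a * b - b * a)) w \<ominus>\<^bsub>W\<^esub> act R w = act T w"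
      unfolding split a_minus_def using wedge_act_closed[OF T w'] wedge_act_closed[OF R(1) w']
      by (simp add: W.M.a_assoc W.M.r_neg)
    ultimately show ?thesis by simp
  qed
  have RF: "act R w \<in> F m" using R(2) filt_V_pred_subset by blast
  have "cls m (act T w \<oplus>\<^bsub>W\<^esub> act R w) = cls m (act T w) \<oplus>\<^bsub>gr m\<^esub> cls m (act R w)"
    using gr_V_simps(3)[OF SF RF] ..
  also have "cls m (act R w) = \<zero>\<^bsub>gr m\<^esub>" using gr_V_simps(5)[OF RF] R(2) by simp
  finally have "cls m (act (lift_deg n (a * b - b * a)) w) = cls m (act T w)"
    using cls_closed[OF SF] by (simp add: split)
  then show ?thesis using TS SF by simp
qed

text \<open>Both sides sum over all ways to split the degree into three parts, the left one by first
  removing the part of \<open>a\<close>, the right one by first removing the parts of \<open>a\<close> and \<open>b\<close> together.\<close>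

lemma conv_act_twice:
  assumes "a \<in> carrier_mat r r" "b \<in> carrier_mat r r" "\<And>i. x i \<in> carrier W"
  shows "conv_act a (conv_act b x) m =
     (\<Oplus>\<^bsub>W\<^esub>n\<in>{..m}. \<Oplus>\<^bsub>W\<^esub>c\<in>{..n}. act (lift_deg c a) (act (lift_deg (n - c) b) (x (m - n))))"
proof -
  have cl: "act (lift_deg c b) (x i) \<in> carrier W" for c i
    using assms wedge_act_closed lift_deg_carrier by auto
  have cl2: "act (lift_deg c a) (act (lift_deg d b) (x i)) \<in> carrier W" for c d i
    using assms wedge_act_closed lift_deg_carrier cl by auto
  have sum: "act (lift_deg c a) (\<Oplus>\<^bsub>W\<^esub>d\<in>A. act (lift_deg d b) (y d)) =
      (\<Oplus>\<^bsub>W\<^esub>d\<in>A. act (lift_deg c a) (act (lift_deg d b) (y d)))"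
    if "finite A" "\<And>d. y d \<in> carrier W" for c y and A :: "nat set"
    using that(1)
  proof (induction A)
    case empty
    then show ?case using wedge_act_zero_right[OF lift_deg_carrier[OF assms(1)]] by simp
  next
    case (insert d A)
    have y: "act (lift_deg d b) (y d) \<in> carrier W"
        "act (lift_deg c a) (act (lift_deg d b) (y d)) \<in> carrier W" for d
      using assms wedge_act_closed lift_deg_carrier that(2) by auto
    then show ?case
      using insert wedge_act_add[OF lift_deg_carrier[OF assms(1)]] by (simp add: Pi_def)
  qed
  have "conv_act a (conv_act b x) m =
      (\<Oplus>\<^bsub>W\<^esub>c\<in>{..m}. \<Oplus>\<^bsub>W\<^esub>d\<in>{..m - c}. act (lift_deg c a) (act (lift_deg d b) (x (m - (c + d)))))"
    unfolding conv_act_def by (simp add: sum assms(3) diff_diff_left)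
  also have "\<dots> = (\<Oplus>\<^bsub>W\<^esub>n\<in>{..m}. \<Oplus>\<^bsub>W\<^esub>c\<in>{..n}.
      act (lift_deg c a) (act (lift_deg (n - c) b) (x (m - (c + (n - c))))))"
    by (rule W.M.finsum_triangle) (rule cl2)
  also have "\<dots> = (\<Oplus>\<^bsub>W\<^esub>n\<in>{..m}. \<Oplus>\<^bsub>W\<^esub>c\<in>{..n}.
      act (lift_deg c a) (act (lift_deg (n - c) b) (x (m - n))))"
    by (intro W.M.finsum_cong') (auto simp: Pi_def cl2 intro!: W.M.finsum_cong' W.M.finsum_closed)
  finally show ?thesis .
qed

lemma conv_act_commutator:
  assumes a: "a \<in> carrier_mat r r" and b: "b \<in> carrier_mat r r" and x: "\<And>i. x i \<in> F i"
  shows "cls m (conv_act (a * b - b * a) x m) =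
     cls m (conv_act a (conv_act b x) m \<oplus>\<^bsub>W\<^esub> (- 1) \<odot>\<^bsub>W\<^esub> conv_act b (conv_act a x) m)"
proof -
  have xW: "\<And>i. x i \<in> carrier W" using x filt_V_closed by blast
  have ab: "a * b - b * a \<in> carrier_mat r r"
    using a b by (intro minus_carrier_mat mult_carrier_mat)
  define P where "P n c = act (lift_deg c a) (act (lift_deg (n - c) b) (x (m - n)))" for n c
  define Q where "Q n c = act (lift_deg (n - c) b) (act (lift_deg c a) (x (m - n)))" for n c
  have cl: "P n c \<in> carrier W" "Q n c \<in> carrier W" for n c
    unfolding P_def Q_def using a b xW wedge_act_closed lift_deg_carrier by auto
  let ?S = "\<lambda>n. \<Oplus>\<^bsub>W\<^esub>c\<in>{..n}. P n c \<oplus>\<^bsub>W\<^esub> (- 1) \<odot>\<^bsub>W\<^esub> Q n c"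
  have S: "?S n \<in> F m" "cls m (act (lift_deg n (a * b - b * a)) (x (m - n))) = cls m (?S n)" if "n \<le> m" for n
    using act_lift_deg_commutator[OF a b that x] unfolding P_def Q_def by auto
  have "cls m (conv_act (a * b - b * a) x m) =
      (\<Oplus>\<^bsub>gr m\<^esub>n\<in>{..m}. cls m (act (lift_deg n (a * b - b * a)) (x (m - n))))"
    unfolding conv_act_def using filt_V_finsum[of "{..m}"] lift_deg_act_closed[OF ab x] by simp
  also have "\<dots> = (\<Oplus>\<^bsub>gr m\<^esub>n\<in>{..m}. cls m (?S n))"
    by (intro grm.M.finsum_cong') (use S cls_closed in auto)
  also have "\<dots> = cls m (\<Oplus>\<^bsub>W\<^esub>n\<in>{..m}. ?S n)"
    using filt_V_finsum[of "{..m}" ?S m] S(1) by simp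
  also have "(\<Oplus>\<^bsub>W\<^esub>n\<in>{..m}. ?S n) =
      (\<Oplus>\<^bsub>W\<^esub>n\<in>{..m}. \<Oplus>\<^bsub>W\<^esub>c\<in>{..n}. P n c) \<oplus>\<^bsub>W\<^esub> (- 1) \<odot>\<^bsub>W\<^esub> (\<Oplus>\<^bsub>W\<^esub>n\<in>{..m}. \<Oplus>\<^bsub>W\<^esub>c\<in>{..n}. Q n c)"
  proof -
    have smult: "(- 1) \<odot>\<^bsub>W\<^esub> (\<Oplus>\<^bsub>W\<^esub>i\<in>A. g i) = (\<Oplus>\<^bsub>W\<^esub>i\<in>A. (- 1) \<odot>\<^bsub>W\<^esub> g i)"
      if "finite A" "\<And>i. g i \<in> carrier W" for A :: "nat set" and g
      by (rule W.finsum_smult_ldistr) (use that in auto)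
    have "?S n = (\<Oplus>\<^bsub>W\<^esub>c\<in>{..n}. P n c) \<oplus>\<^bsub>W\<^esub> (\<Oplus>\<^bsub>W\<^esub>c\<in>{..n}. (- 1) \<odot>\<^bsub>W\<^esub> Q n c)" for n
      by (rule W.M.finsum_addf) (use cl complex_module_simps(6)[OF module_ext_power] in auto)
    then have "?S n = (\<Oplus>\<^bsub>W\<^esub>c\<in>{..n}. P n c) \<oplus>\<^bsub>W\<^esub> (- 1) \<odot>\<^bsub>W\<^esub> (\<Oplus>\<^bsub>W\<^esub>c\<in>{..n}. Q n c)" for n
      by (simp add: smult cl)
    then have "(\<Oplus>\<^bsub>W\<^esub>n\<in>{..m}. ?S n) = (\<Oplus>\<^bsub>W\<^esub>n\<in>{..m}. (\<Oplus>\<^bsub>W\<^esub>c\<in>{..n}. P n c) \<oplus>\<^bsub>W\<^esub>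
        (- 1) \<odot>\<^bsub>W\<^esub> (\<Oplus>\<^bsub>W\<^esub>c\<in>{..n}. Q n c))"
      by (simp only:)
    also have "\<dots> = (\<Oplus>\<^bsub>W\<^esub>n\<in>{..m}. \<Oplus>\<^bsub>W\<^esub>c\<in>{..n}. P n c) \<oplus>\<^bsub>W\<^esub>
        (\<Oplus>\<^bsub>W\<^esub>n\<in>{..m}. (- 1) \<odot>\<^bsub>W\<^esub> (\<Oplus>\<^bsub>W\<^esub>c\<in>{..n}. Q n c))"
      by (rule W.M.finsum_addf) (auto intro!: W.M.finsum_closed complex_module_simps(6)[OF module_ext_power] cl)
    also have "(\<Oplus>\<^bsub>W\<^esub>n\<in>{..m}. (- 1) \<odot>\<^bsub>W\<^esub> (\<Oplus>\<^bsub>W\<^esub>c\<in>{..n}. Q n c)) =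
        (- 1) \<odot>\<^bsub>W\<^esub> (\<Oplus>\<^bsub>W\<^esub>n\<in>{..m}. \<Oplus>\<^bsub>W\<^esub>c\<in>{..n}. Q n c)"
      by (rule smult[symmetric]) (auto intro!: W.M.finsum_closed cl)
    finally show ?thesis .
  qed
  also have "(\<Oplus>\<^bsub>W\<^esub>n\<in>{..m}. \<Oplus>\<^bsub>W\<^esub>c\<in>{..n}. P n c) = conv_act a (conv_act b x) m"
    unfolding P_def by (rule conv_act_twice[OF a b xW, symmetric])
  also have "(\<Oplus>\<^bsub>W\<^esub>n\<in>{..m}. \<Oplus>\<^bsub>W\<^esub>c\<in>{..n}. Q n c) = conv_act b (conv_act a x) m"
  proof -
    have "(\<Oplus>\<^bsub>W\<^esub>c\<in>{..n}. Q n c) =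
        (\<Oplus>\<^bsub>W\<^esub>c\<in>{..n}. act (lift_deg c b) (act (lift_deg (n - c) a) (x (m - n))))" for n
    proof -
      have "(\<Oplus>\<^bsub>W\<^esub>c\<in>{..n}. Q n c) = (\<Oplus>\<^bsub>W\<^esub>c\<in>{..n}. Q n (n - c))"
        by (rule W.M.finsum_atMost_rev[symmetric]) (rule cl)
      also have "\<dots> = (\<Oplus>\<^bsub>W\<^esub>c\<in>{..n}. act (lift_deg c b) (act (lift_deg (n - c) a) (x (m - n))))"
        by (rule W.M.finsum_cong') (use a b xW wedge_act_closed lift_deg_carrier in \<open>auto simp: Q_def\<close>)
      finally show ?thesis .
    qed
    then show ?thesis using conv_act_twice[OF b a xW, where m = m] by simp
  qed
  finally show ?thesis .
qed

private abbreviation (input) "V \<equiv> V_module \<xi> N"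

section \<open>Finite dimension\<close>

text \<open>The filtration is an increasing chain inside a finite-dimensional space, so it becomes stationary:
  finitely many vectors span its union, and they all lie in one step.\<close>

lemma filt_V_finitely_spanned:
  obtains G m0 where "\<And>m. finite (G m)" "\<And>m. G m \<subseteq> F m"
    "\<And>m. LinearCombinations.module.span class_ring W (G m) = F m" "\<And>m. m0 \<le> m \<Longrightarrow> F m = F m0"
proof -
  obtain A where A: "finite A" "A \<subseteq> carrier W" "v \<in> W.span A"
    and stable: "\<And>a w. a \<in> carrier_mat r r \<Longrightarrow> w \<in> W.span A \<Longrightarrow> act a w \<in> W.span A"
    using finite_dimensional_stable_subspace by blast
  note U = submod_span[OF module_ext_power A(2)]
  have gens: "foldr act as v \<in> W.span A" if "list_all2 (\<lambda>a k. a \<in> filt_G r k) as ms" for as ms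
    using that by (induction rule: list_all2_induct) (auto simp: A(3) stable filt_G_carrier)
  have FU: "F m \<subseteq> W.span A" for m
    unfolding filt_V_def by (rule span_minimal[OF U]) (use gens in blast)
  have "\<exists>B. finite B \<and> B \<subseteq> F m \<and> W.span B = F m" for m
    using finite_span_subspace[OF module_ext_power A(1,2) submod_filt_V FU] by metis
  then obtain G where G: "\<And>m. finite (G m)" "\<And>m. G m \<subseteq> F m" "\<And>m. W.span (G m) = F m" by metis
  have S: "submod (\<Union>m. F m) W"
  proof (rule submodI[OF module_ext_power])
    fix x y assume "x \<in> (\<Union>m. F m)" "y \<in> (\<Union>m. F m)"
    then obtain m m' where "x \<in> F m" "y \<in> F m'" by blast
    then have "x \<in> F (max m m')" "y \<in> F (max m m')"
      using filt_V_mono[of m "max m m'"] filt_V_mono[of m' "max m m'"] by auto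
    then have "x \<oplus>\<^bsub>W\<^esub> y \<in> F (max m m')" by (rule submodD(4)[OF submod_filt_V])
    then show "x \<oplus>\<^bsub>W\<^esub> y \<in> (\<Union>m. F m)" by (rule UN_I[OF UNIV_I])
  next
    show "(\<Union>m. F m) \<subseteq> carrier W" by (rule UN_least) (rule submodD(2)[OF submod_filt_V])
    show "\<zero>\<^bsub>W\<^esub> \<in> (\<Union>m. F m)" using submodD(3)[OF submod_filt_V] by (rule UN_I[OF UNIV_I])
    fix c x assume "x \<in> (\<Union>m. F m)"
    then obtain m where "x \<in> F m" by blast
    then have "c \<odot>\<^bsub>W\<^esub> x \<in> F m" by (rule submodD(5)[OF submod_filt_V])
    then show "c \<odot>\<^bsub>W\<^esub> x \<in> (\<Union>m. F m)" by (rule UN_I[OF UNIV_I])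
  qed
  have "(\<Union>m. F m) \<subseteq> W.span A" by (rule UN_least) (rule FU)
  from finite_span_subspace[OF module_ext_power A(1,2) S this]
  obtain B where B: "finite B" "B \<subseteq> (\<Union>m. F m)" "W.span B = (\<Union>m. F m)" .
  have "\<exists>m0. B' \<subseteq> F m0" if "finite B'" "B' \<subseteq> (\<Union>m. F m)" for B'
    using that
  proof (induction B')
    case (insert x B')
    then obtain m1 m2 where "x \<in> F m1" "B' \<subseteq> F m2" by auto
    then have "insert x B' \<subseteq> F (max m1 m2)"
      using filt_V_mono[of m1 "max m1 m2"] filt_V_mono[of m2 "max m1 m2"] by auto
    then show ?case by blast
  qed simp
  from this[OF B(1,2)] obtain m0 where "B \<subseteq> F m0" by blast
  from span_minimal[OF submod_filt_V this] have "(\<Union>m. F m) \<subseteq> F m0" using B(3) by simp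
  then have "F m = F m0" if "m0 \<le> m" for m using filt_V_mono[OF that] by auto
  then show thesis using that G by blast
qed

lemma finite_nonzero_gr_V: "finite {m. carrier (gr m) \<noteq> {\<zero>\<^bsub>gr m\<^esub>}}"
proof -
  obtain m0 where m0: "\<And>m. m0 \<le> m \<Longrightarrow> F m = F m0" using filt_V_finitely_spanned by metis
  have "carrier (gr m) = {\<zero>\<^bsub>gr m\<^esub>}" if "m0 < m" for m
  proof -
    have "Fp m = F m"
      using that m0[of m] m0[of "m - 1"] by (cases m) (auto simp: filt_V_pred_def)
    then have "cls m x = \<zero>\<^bsub>gr m\<^esub>" if "x \<in> F m" for x using that gr_V_simps(5) by blast
    then show ?thesis using submodD(3)[OF submod_filt_V[of m]] unfolding gr_V_simps(1) by blast
  qed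
  then have "{m. carrier (gr m) \<noteq> {\<zero>\<^bsub>gr m\<^esub>}} \<subseteq> {..m0}" by (auto simp: not_less[symmetric])
  then show ?thesis by (rule finite_subset) simp
qed

lemma carrier_V_module: "carrier V = {f. \<forall>m. f m \<in> carrier (gr m)}"
proof -
  have "finite {m. f m \<noteq> \<zero>\<^bsub>gr m\<^esub>}" if "\<forall>m. f m \<in> carrier (gr m)" for f
  proof (rule finite_subset[OF _ finite_nonzero_gr_V], intro subsetI CollectI)
    fix m assume "m \<in> {m. f m \<noteq> \<zero>\<^bsub>gr m\<^esub>}"
    then show "carrier (gr m) \<noteq> {\<zero>\<^bsub>gr m\<^esub>}" using spec[OF that, of m] by auto
  qed
  then show ?thesis by (auto simp: V_module_def carrier_direct_sum[where M = gr, OF module_gr_V])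
qed

lemma module_V_module: "module class_ring V"
  unfolding V_module_def by (rule module_direct_sum[where M = gr, OF module_gr_V])

lemmas V_module_simps = direct_sum_simps[where M = gr, OF module_gr_V, folded V_module_def]

lemma fin_dim_V_module: "vectorspace.fin_dim class_ring V"
proof -
  obtain G where G: "\<And>m. finite (G m)" "\<And>m. G m \<subseteq> F m" "\<And>m. W.span (G m) = F m"
    using filt_V_finitely_spanned by metis
  show ?thesis
    unfolding V_module_def
  proof (rule direct_sum_fin_dim[where M = gr, OF module_gr_V])
    fix m
    let ?C = "cls m ` G m"
    show "finite ?C" using G(1) by simp
    show C: "?C \<subseteq> carrier (gr m)" using G(2) cls_closed by blast
    note S = submod_span[OF module_gr_V C]
    have "F m \<subseteq> {x \<in> F m. cls m x \<in> grm.span m ?C}" (is "_ \<subseteq> ?H")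
      unfolding G(3)[of m, symmetric]
    proof (rule span_minimal)
      show "submod {x \<in> W.span (G m). cls m x \<in> grm.span m ?C} W"
        unfolding G(3)
      proof (rule submodI[OF module_ext_power])
        have "cls m \<zero>\<^bsub>W\<^esub> = \<zero>\<^bsub>gr m\<^esub>"
          using gr_V_simps(5) submodD(3)[OF submod_filt_V] submodD(3)[OF submod_filt_V_pred] by blast
        then show "\<zero>\<^bsub>W\<^esub> \<in> {x \<in> F m. cls m x \<in> grm.span m ?C}"
          using submodD(3)[OF submod_filt_V] submodD(3)[OF S] by simp
      qed (use submodD[OF submod_filt_V[of m]] submodD(4,5)[OF S]
          in \<open>auto simp: gr_V_simps(3,4)[symmetric]\<close>)
      show "G m \<subseteq> {x \<in> W.span (G m). cls m x \<in> grm.span m ?C}"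
        unfolding G(3) using G(2) span_superset[OF module_gr_V C] by blast
    qed
    then have "carrier (gr m) \<subseteq> grm.span m ?C" unfolding gr_V_simps(1) by blast
    then show "carrier (gr m) = grm.span m ?C" using submodD(2)[OF S] by blast
  qed (rule finite_nonzero_gr_V)
qed

section \<open>The graded module as a representation\<close>

lemma V_module_cases:
  assumes "f \<in> carrier V"
  obtains x where "f = (\<lambda>i. cls i (x i))" "\<And>i. x i \<in> F i" "\<And>i. x i \<in> carrier W"
proof -
  have "\<forall>i. \<exists>x. x \<in> F i \<and> f i = cls i x" using assms by (auto simp: carrier_V_module gr_V_simps(1))
  then obtain x where "\<And>i. x i \<in> F i" "\<And>i. f i = cls i (x i)" by metis
  then show thesis using that[of x] filt_V_closed by blast
qed

lemma cls_in_V_module: "(\<And>i. x i \<in> F i) \<Longrightarrow> (\<lambda>i. cls i (x i)) \<in> carrier V"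
  by (simp add: carrier_V_module cls_closed)

lemma V_module_cls_simps:
  "(\<And>i. x i \<in> F i) \<Longrightarrow> (\<And>i. y i \<in> F i) \<Longrightarrow>
     (\<lambda>i. cls i (x i)) \<oplus>\<^bsub>V\<^esub> (\<lambda>i. cls i (y i)) = (\<lambda>i. cls i (x i \<oplus>\<^bsub>W\<^esub> y i))"
  "(\<And>i. x i \<in> F i) \<Longrightarrow> c \<odot>\<^bsub>V\<^esub> (\<lambda>i. cls i (x i)) = (\<lambda>i. cls i (c \<odot>\<^bsub>W\<^esub> x i))"
  by (simp_all add: V_module_simps gr_V_simps(3,4))

lemma g_module_V_module: "g_module r V (V_module_act \<xi> N)"
proof (intro g_module.intro g_module_axioms.intro)
  show "vectorspace class_ring V" using module_V_module by (simp add: vectorspace_iff_module)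
  note closed = submodD(4)[OF submod_filt_V] submodD(5)[OF submod_filt_V]
  note act = V_module_act_cls
  fix a b :: "poly2 mat" and f g and c :: complex
  assume a: "a \<in> carrier_mat r r"
  note ca = conv_act_closed[OF a]
  show "V_module_act \<xi> N a f \<in> carrier V" if "f \<in> carrier V"
    using that by (rule V_module_cases) (simp add: act[OF a] cls_in_V_module ca)
  show "V_module_act \<xi> N a (f \<oplus>\<^bsub>V\<^esub> g) = V_module_act \<xi> N a f \<oplus>\<^bsub>V\<^esub> V_module_act \<xi> N a g"
    if "f \<in> carrier V" "g \<in> carrier V"
    using that by (elim V_module_cases)
      (simp add: act[OF a] V_module_cls_simps closed ca conv_act_add[OF a])
  show "V_module_act \<xi> N a (c \<odot>\<^bsub>V\<^esub> f) = c \<odot>\<^bsub>V\<^esub> V_module_act \<xi> N a f" if "f \<in> carrier V"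
    using that by (elim V_module_cases)
      (simp add: act[OF a] V_module_cls_simps closed ca conv_act_smult[OF a])
  show "V_module_act \<xi> N ([:[:c:]:] \<cdot>\<^sub>m a) f = c \<odot>\<^bsub>V\<^esub> V_module_act \<xi> N a f" if "f \<in> carrier V"
    using that by (elim V_module_cases)
      (simp add: act a V_module_cls_simps ca conv_smult_act[OF a])
  assume b: "b \<in> carrier_mat r r"
  note cb = conv_act_closed[OF b]
  show "V_module_act \<xi> N (a + b) f = V_module_act \<xi> N a f \<oplus>\<^bsub>V\<^esub> V_module_act \<xi> N b f" if "f \<in> carrier V"
    using that by (elim V_module_cases)
      (simp add: act a b V_module_cls_simps ca cb conv_plus_act[OF a b])
  show "V_module_act \<xi> N (a * b - b * a) f =
      V_module_act \<xi> N a (V_module_act \<xi> N b f) \<ominus>\<^bsub>V\<^esub> V_module_act \<xi> N b (V_module_act \<xi> N a f)"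
    if "f \<in> carrier V"
    using that
  proof (rule V_module_cases)
    fix x assume x: "f = (\<lambda>i. cls i (x i))" "\<And>i. x i \<in> F i"
    have ab: "a * b - b * a \<in> carrier_mat r r" using a b by (intro minus_carrier_mat mult_carrier_mat)
    have "V_module_act \<xi> N b (V_module_act \<xi> N a f) = (\<lambda>i. cls i (conv_act b (conv_act a x) i))"
      "V_module_act \<xi> N a (V_module_act \<xi> N b f) = (\<lambda>i. cls i (conv_act a (conv_act b x) i))"
      "V_module_act \<xi> N (a * b - b * a) f = (\<lambda>i. cls i (conv_act (a * b - b * a) x i))"
      using x(2) by (simp_all add: x(1) act a b ab ca cb)
    then show ?thesis
      using x(2) by (simp add: module_minus_eq[OF module_V_module] cls_in_V_module ca cb
          V_module_cls_simps closed conv_act_commutator[OF a b])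
  qed
qed

section \<open>The cyclic vector generates\<close>

lemma V_module_act_summand:
  assumes a: "a \<in> carrier_mat r r" and x: "x \<in> F d"
  shows "V_module_act \<xi> N a (summand_inj gr d (cls d x)) =
     (\<lambda>m. if d \<le> m then cls m (act (lift_deg (m - d) a) x) else \<zero>\<^bsub>gr m\<^esub>)"
proof -
  define y where "y i = (if i = d then x else \<zero>\<^bsub>W\<^esub>)" for i
  have y: "y i \<in> F i" for i using x submodD(3)[OF submod_filt_V] by (simp add: y_def)
  have zero: "cls m \<zero>\<^bsub>W\<^esub> = \<zero>\<^bsub>gr m\<^esub>" for m
    using gr_V_simps(5) submodD(3)[OF submod_filt_V] submodD(3)[OF submod_filt_V_pred] by blast
  have "summand_inj gr d (cls d x) = (\<lambda>i. cls i (y i))"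
    by (intro ext) (simp add: summand_inj_def y_def zero)
  moreover have "conv_act a y m = (if d \<le> m then act (lift_deg (m - d) a) x else \<zero>\<^bsub>W\<^esub>)" for m
  proof -
    have cl: "act (lift_deg b a) x \<in> carrier W" for b
      using wedge_act_closed[OF lift_deg_carrier[OF a] filt_V_closed[OF x]] .
    have "conv_act a y m = (\<Oplus>\<^bsub>W\<^esub>b\<in>{..m}. if m - d = b \<and> d \<le> m then act (lift_deg b a) x else \<zero>\<^bsub>W\<^esub>)"
      unfolding conv_act_def
      by (rule W.M.finsum_cong') (use cl in \<open>auto simp: y_def wedge_act_zero_right[OF lift_deg_carrier[OF a]]\<close>)
    also have "\<dots> = (if d \<le> m then act (lift_deg (m - d) a) x else \<zero>\<^bsub>W\<^esub>)"
    proof (cases "d \<le> m")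
      case True
      then show ?thesis
        using W.M.finsum_singleton[of "m - d" "{..m}" "\<lambda>b. act (lift_deg b a) x"] cl by auto
    next
      case False
      then show ?thesis by simp
    qed
    finally show ?thesis .
  qed
  ultimately have "V_module_act \<xi> N a (summand_inj gr d (cls d x)) =
      (\<lambda>m. cls m (if d \<le> m then act (lift_deg (m - d) a) x else \<zero>\<^bsub>W\<^esub>))"
    using V_module_act_cls[OF a y] by simp
  then show ?thesis by (simp only:) (intro ext, simp add: zero)
qed

lemma V_cyclic_eq: "V_cyclic \<xi> N = summand_inj gr 0 (cls 0 v)"
  by (auto simp: V_cyclic_def summand_inj_def)

text \<open>A factor of degree \<open>k\<close> in a product \<open>a\<^sub>1 \<cdots> a\<^sub>l v\<close> matters, after passing to the graded module, only
  through its symbol, and the symbol is a polynomial matrix. So the classes of all these products are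
  reached from the class of \<open>v\<close>.\<close>

lemma generated_by_V_cyclic: "generated_by r V (V_module_act \<xi> N) (V_cyclic \<xi> N)"
  unfolding generated_by_def
proof (intro conjI allI impI; (elim conjE)?)
  have inj_closed: "summand_inj gr m (cls m x) \<in> carrier V" if "x \<in> F m" for m x
    unfolding V_module_def using summand_inj_closed[where M = gr, OF module_gr_V cls_closed[OF that]] .
  show "V_cyclic \<xi> N \<in> carrier V" unfolding V_cyclic_eq by (rule inj_closed[OF v_vec_in_filt_V])
  fix S assume S: "submod S V" "V_cyclic \<xi> N \<in> S"
    and stable: "\<forall>a\<in>carrier_mat r r. \<forall>w\<in>S. V_module_act \<xi> N a w \<in> S"
  have pred_in_S: "summand_inj gr m (cls m x) \<in> S" if "x \<in> Fp m" for m x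
  proof -
    have "cls m x = \<zero>\<^bsub>gr m\<^esub>" using that gr_V_simps(5) filt_V_pred_subset by blast
    then show ?thesis
      using summand_inj_zero[where M = gr, OF module_gr_V, of m] submodD(3)[OF S(1)] by (simp add: V_module_def)
  qed
  have add_in_S: "summand_inj gr m (cls m (x \<oplus>\<^bsub>W\<^esub> y)) \<in> S"
    if "x \<in> F m" "y \<in> F m" "summand_inj gr m (cls m x) \<in> S" "summand_inj gr m (cls m y) \<in> S" for m x y
    using submodD(4)[OF S(1) that(3,4)] summand_inj_add[where M = gr, OF module_gr_V, of m "cls m x" "cls m y"]
      gr_V_simps(3)[OF that(1,2)] by (simp add: V_module_def)
  have smult_in_S: "summand_inj gr m (cls m (c \<odot>\<^bsub>W\<^esub> x)) \<in> S"
    if "x \<in> F m" "summand_inj gr m (cls m x) \<in> S" for m c x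
    using submodD(5)[OF S(1) that(2)] summand_inj_smult[where M = gr, OF module_gr_V, of m c "cls m x"]
      gr_V_simps(4)[OF that(1)] by (simp add: V_module_def)
  have step: "summand_inj gr (k + m) (cls (k + m) (act a x)) \<in> S"
    if a: "a \<in> filt_G r k" and x: "x \<in> F m" "summand_inj gr m (cls m x) \<in> S" for a k m x
    using a
  proof (induction rule: filt_G.induct)
    case zero
    show ?case
      using wedge_act_zero_left[OF filt_V_closed[OF x(1)]] submodD(3)[OF submod_filt_V_pred] pred_in_S
      by simp
  next
    case (add A g j i)
    let ?B = "map_mat (\<lambda>c. const_xy c * gen_X ^ i * gen_Y ^ j) g"
    have B: "?B \<in> filt_G r j"
      using filt_G.add[OF filt_G.zero add.hyps(2) order_refl, of i] add.hyps(2)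
      by (metis left_add_zero_mat map_carrier_mat)
    \<comment> \<open>A term of \<open>Y\<close>-degree below \<open>k\<close> dies in degree \<open>k + m\<close>; one of \<open>Y\<close>-degree \<open>k\<close> acts there as
      the polynomial matrix \<open>b\<close> with the same coefficients.\<close>
    have "summand_inj gr (k + m) (cls (k + m) (act ?B x)) \<in> S"
    proof (cases "j = k")
      case False
      then have "j + m \<le> k + m - 1" "k + m = Suc (k + m - 1)" using add.hyps(3) by auto
      then have "act ?B x \<in> Fp (k + m)"
        using wedge_act_filt_V[OF B x(1)] filt_V_mono[of "j + m" "k + m - 1"]
        by (metis filt_V_pred_def nat.case(2) subsetD)
      then show ?thesis by (rule pred_in_S)
    next
      case True
      define b where "b = map_mat (\<lambda>c. monom (monom c i) k) g"
      have b: "b \<in> carrier_mat r r" using add.hyps(2) by (simp add: b_def)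
      have lift: "lift_deg d b = (if d = k then ?B else 0\<^sub>m r r)" for d
        using add.hyps(2) True
        by (intro eq_matI) (auto simp: b_def lift_deg_eq poly_X_monom)
      have "V_module_act \<xi> N b (summand_inj gr m (cls m x)) = summand_inj gr (k + m) (cls (k + m) (act ?B x))"
        unfolding V_module_act_summand[OF b x(1)]
      proof
        fix d
        have "cls d \<zero>\<^bsub>W\<^esub> = \<zero>\<^bsub>gr d\<^esub>"
          using gr_V_simps(5) submodD(3)[OF submod_filt_V] submodD(3)[OF submod_filt_V_pred] by blast
        then show "(if m \<le> d then cls d (act (lift_deg (d - m) b) x) else \<zero>\<^bsub>gr d\<^esub>) =
            summand_inj gr (k + m) (cls (k + m) (act ?B x)) d"
          using wedge_act_zero_left[OF filt_V_closed[OF x(1)]] by (auto simp: summand_inj_def lift)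
      qed
      then show ?thesis using stable b x(2) by metis
    qed
    moreover have "act A x \<in> F (k + m)" by (rule wedge_act_filt_V[OF add.hyps(1) x(1)])
    moreover have "act ?B x \<in> F (k + m)"
      by (rule wedge_act_filt_V[OF filt_G_mono[OF B add.hyps(3)] x(1)])
    moreover have "act (A + ?B) x = act A x \<oplus>\<^bsub>W\<^esub> act ?B x"
      by (rule wedge_plus_act[OF filt_G_carrier[OF add.hyps(1)] filt_G_carrier[OF B] filt_V_closed[OF x(1)]])
    ultimately show ?case using add.IH add_in_S by simp
  qed
  have gens: "foldr act as v \<in> F m \<and> summand_inj gr m (cls m (foldr act as v)) \<in> S"
    if "list_all2 (\<lambda>a k. a \<in> filt_G r k) as ms" "sum_list ms \<le> m" for as ms m
    using that
  proof (induction as ms arbitrary: m rule: list_all2_induct)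
    case Nil
    show ?case
    proof (cases m)
      case 0
      then show ?thesis using S(2) v_vec_in_filt_V by (simp add: V_cyclic_eq)
    next
      case (Suc m')
      then have "v \<in> Fp m" using v_vec_in_filt_V by (simp add: filt_V_pred_def)
      then show ?thesis using pred_in_S v_vec_in_filt_V by simp
    qed
  next
    case (Cons a as k ks)
    then have "foldr act as v \<in> F (m - k)" "summand_inj gr (m - k) (cls (m - k) (foldr act as v)) \<in> S"
      by auto
    from step[OF Cons.hyps(1) this] wedge_act_filt_V[OF Cons.hyps(1) this(1)] Cons.prems
    show ?case by simp
  qed
  show "S = carrier V"
    unfolding V_module_def
  proof (rule direct_sum_generated_by_summands[where M = gr, OF module_gr_V])
    show "submod S (direct_sum_module gr)" using S(1) by (simp add: V_module_def)
    fix m X assume "X \<in> carrier (gr m)"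
    then obtain x where x: "X = cls m x" "x \<in> F m" by (auto simp: gr_V_simps(1))
    let ?H = "{x \<in> F m. summand_inj gr m (cls m x) \<in> S}"
    have "submod ?H W"
    proof (rule submodI[OF module_ext_power])
      show "\<zero>\<^bsub>W\<^esub> \<in> ?H" using pred_in_S submodD(3)[OF submod_filt_V] submodD(3)[OF submod_filt_V_pred] by blast
      show "?H \<subseteq> carrier W" using filt_V_closed by blast
    qed (use add_in_S smult_in_S submodD(4,5)[OF submod_filt_V] in auto)
    then have "F m \<subseteq> ?H"
      unfolding filt_V_def[of \<xi> N m] by (rule span_minimal) (use gens in \<open>auto simp: filt_V_def\<close>)
    then show "summand_inj gr m X \<in> S" using x by blast
  qed
qed

section \<open>The cyclic vector is a highest weight vector\<close>

lemma act_v_vec: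
  assumes "a \<in> carrier_mat r r"
  shows "act a v = ext_class B (sum_list \<xi>)
    (\<Sum>t<sum_list \<xi>. pure_tensor ((map basis_vec v_word)[t := V_act N a (basis_vec (v_word ! t))]))"
  unfolding v_vec_eq using wedge_act_class[OF assms, of "basis_vec v_word"] v_word_in_words
  by (simp add: tensor_der_basis length_v_word)

lemma nth_v_word:
  assumes "t < sum_list \<xi>"
  obtains q s where "v_word ! t = (q, s)" "q < r" "N - int (\<xi> ! q) \<le> s" "s < N"
proof -
  obtain q s where qs: "v_word ! t = (q, s)" by (rule prod.exhaust)
  have "v_word ! t \<in> set v_word" using assms by (simp add: length_v_word)
  then show thesis using that[OF qs] by (simp add: qs set_v_word)
qed

text \<open>The exponents occurring in \<open>v\<^sub>\<xi>\<close> together with \<open>u\<^sub>i\<close> form the interval from \<open>N - \<xi>\<^sub>i\<close> to \<open>N - 1\<close>. It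
  contains the interval for \<open>u\<^sub>j\<close>, and adding \<open>k\<close> leads out of it only at the top, where \<open>x\<^sup>N\<close> is \<open>0\<close>.
  So every summand of the Leibniz rule is \<open>0\<close> or has a repeated factor.\<close>

lemma raising_act_v_vec:
  assumes ij: "i < r" "j < r" "\<xi> ! j \<le> \<xi> ! i" and neq: "i \<noteq> j \<or> 0 < k"
  shows "act (mat_unit r i j (gen_X ^ k * gen_Y ^ b)) v = \<zero>\<^bsub>W\<^esub>"
proof -
  let ?E = "mat_unit r i j (gen_X ^ k * gen_Y ^ b)"
  have "pure_tensor ((map basis_vec v_word)[t := V_act N ?E (basis_vec (v_word ! t))]) \<in> alt_relations B (sum_list \<xi>)"
    if t: "t < sum_list \<xi>" for t
    using t
  proof (rule nth_v_word)
    fix q s assume qs: "v_word ! t = (q, s)" "q < r" "N - int (\<xi> ! q) \<le> s" "s < N"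
    have t': "t < length (map basis_vec v_word)" using t by (simp add: length_v_word)
    show ?thesis
    proof (cases "q = j \<and> s + int k < N")
      case True
      have "pure_tensor ((map basis_vec v_word)[t := basis_vec (i, s + int k)]) \<in> alt_relations B (length v_word)"
      proof (rule pure_tensor_repeated_basis)
        show "(i, s + int k) \<in> set v_word" using True qs ij by (auto simp: set_v_word)
        show "(i, s + int k) \<noteq> v_word ! t" using True qs neq by auto
      qed (use v_word_in_words t in \<open>auto simp: length_v_word\<close>)
      then have "scale (of_int s ^ b) (pure_tensor ((map basis_vec v_word)[t := basis_vec (i, s + int k)]))
          \<in> alt_relations B (sum_list \<xi>)"
        by (simp only: length_v_word alt_relations_closed(3))
      moreover have "V_act N ?E (basis_vec (v_word ! t)) = scale (of_int s ^ b) (basis_vec (i, s + int k))"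
        unfolding qs(1) V_act_mat_unit[OF ij(1) qs(2)] by (rule if_P[OF True])
      ultimately show ?thesis by (simp only: pure_tensor_update_scale[OF t'])
    next
      case False
      have "V_act N ?E (basis_vec (v_word ! t)) = 0"
        unfolding qs(1) V_act_mat_unit[OF ij(1) qs(2)] by (rule if_not_P[OF False])
      then show ?thesis by (simp only: pure_tensor_update_zero[OF t'] alt_relations_closed(1))
    qed
  qed
  then have sum: "(\<Sum>t<sum_list \<xi>. pure_tensor ((map basis_vec v_word)[t := V_act N ?E (basis_vec (v_word ! t))]))
      \<in> alt_relations B (sum_list \<xi>)"
    by (intro alt_relations_sum) simp
  then show ?thesis
    unfolding act_v_vec[OF mat_unit_carrier] using ext_class_eq_zero_iff alt_relations_closed(4) by blast
qed

text \<open>The eigenvalue of \<open>E\<^sub>i\<^sub>i \<otimes> Y\<^sup>b\<close> on \<open>v\<^sub>\<xi>\<close>: the sum of \<open>s\<^sup>b\<close> over the exponents \<open>s\<close> that occur with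
  \<open>u\<^sub>i\<close>.\<close>

definition weight :: "nat \<Rightarrow> nat \<Rightarrow> complex" where
  "weight i b = (\<Sum>t<sum_list \<xi>. if fst (v_word ! t) = i then of_int (snd (v_word ! t)) ^ b else 0)"

lemma weight_0:
  assumes "i < r"
  shows "weight i 0 = of_nat (\<xi> ! i)"
proof -
  let ?f = "\<lambda>e :: nat \<times> int. if fst e = i then 1 else 0 :: complex"
  have concat: "sum_list (map ?f (concat (map g js))) = (\<Sum>j\<leftarrow>js. sum_list (map ?f (g j)))" for g js
    by (induction js) auto
  have col: "sum_list (map ?f (map (Pair j) xs)) = (if j = i then of_nat (length xs) else 0)" for j xs
    by (induction xs) auto
  have "weight i 0 = (\<Sum>t<length v_word. ?f (v_word ! t))" by (simp add: weight_def length_v_word cong: if_cong)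
  also have "\<dots> = sum_list (map ?f v_word)" by (simp add: sum_list_sum_nth atLeast0LessThan)
  also have "\<dots> = (\<Sum>j\<leftarrow>[0..<r]. if j = i then of_nat (\<xi> ! j) else 0)"
    unfolding v_word_def concat col by (intro arg_cong[of _ _ sum_list] map_cong) auto
  also have "\<dots> = (\<Sum>j<r. if j = i then of_nat (\<xi> ! j) else 0)"
    by (simp add: interv_sum_list_conv_sum_set_nat atLeast0LessThan)
  also have "\<dots> = of_nat (\<xi> ! i)" using assms by (simp add: sum.delta)
  finally show ?thesis .
qed

lemma diagonal_act_v_vec:
  assumes i: "i < r"
  shows "act (mat_unit r i i (gen_Y ^ b)) v = weight i b \<odot>\<^bsub>W\<^esub> v"
proof -
  let ?E = "mat_unit r i i (gen_Y ^ b)"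
  have "pure_tensor ((map basis_vec v_word)[t := V_act N ?E (basis_vec (v_word ! t))]) =
      scale (if fst (v_word ! t) = i then of_int (snd (v_word ! t)) ^ b else 0) (basis_vec v_word)"
    if t: "t < sum_list \<xi>" for t
    using t
  proof (rule nth_v_word)
    fix q s assume qs: "v_word ! t = (q, s)" "q < r" "N - int (\<xi> ! q) \<le> s" "s < N"
    have t': "t < length (map basis_vec v_word)" using t by (simp add: length_v_word)
    have "V_act N ?E (basis_vec (v_word ! t)) = scale (if q = i then of_int s ^ b else 0) (basis_vec (v_word ! t))"
      using V_act_mat_unit[OF i qs(2), of N i 0 b s] qs by simp
    moreover have "(map basis_vec v_word)[t := basis_vec (v_word ! t)] = map basis_vec v_word"
      using t' by (metis length_map list_update_id nth_map)
    ultimately show ?thesis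
      using qs(1) by (simp only: pure_tensor_update_scale[OF t'] pure_tensor_basis fst_conv snd_conv)
  qed
  then have "(\<Sum>t<sum_list \<xi>. pure_tensor ((map basis_vec v_word)[t := V_act N ?E (basis_vec (v_word ! t))])) =
      scale (weight i b) (basis_vec v_word)"
    unfolding weight_def pm.scale_sum_left by (intro sum.cong) auto
  then show ?thesis
    unfolding act_v_vec[OF mat_unit_carrier] using v_word_in_words
    by (simp add: v_vec_eq ext_class_smult)
qed

lemma act_mat_unit_poly:
  assumes "\<And>k. act (mat_unit r i j (gen_X ^ k * gen_Y ^ b)) v = c k \<odot>\<^bsub>W\<^esub> v"
  shows "act (mat_unit r i j (poly_X p * gen_Y ^ b)) v = (\<Sum>k\<le>degree p. coeff p k * c k) \<odot>\<^bsub>W\<^esub> v"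
proof -
  note M = module_ext_power[of B boxes] and v = v_vec_closed
  have "act (mat_unit r i j (\<Sum>k<d. const_xy (coeff p k) * (gen_X ^ k * gen_Y ^ b))) v =
      (\<Sum>k<d. coeff p k * c k) \<odot>\<^bsub>W\<^esub> v" for d
  proof (induction d)
    case 0
    have "mat_unit r i j 0 = (0\<^sub>m r r :: xy_alg mat)" by (intro eq_matI) (auto simp: mat_unit_def)
    then show ?case using wedge_act_zero_left[OF v] complex_module_simps(4)[OF M v] by simp
  next
    case (Suc d)
    let ?t = "const_xy (coeff p d) * (gen_X ^ d * gen_Y ^ b)"
    have "act (mat_unit r i j ?t) v = (coeff p d * c d) \<odot>\<^bsub>W\<^esub> v"
      unfolding mat_unit_const_xy using wedge_smult_act[OF mat_unit_carrier v] assms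
        complex_module_simps(1)[OF M v] by simp
    then show ?case
      unfolding sum.lessThan_Suc mat_unit_add complex_module_simps(2)[OF M v]
      using wedge_plus_act[OF mat_unit_carrier mat_unit_carrier v] Suc by simp
  qed
  from this[of "Suc (degree p)"] show ?thesis
    by (simp only: poly_X_def sum_distrib_right mult.assoc lessThan_Suc_atMost)
qed

lemma V_module_act_cyclic:
  assumes "a \<in> carrier_mat r r"
  shows "V_module_act \<xi> N a (V_cyclic \<xi> N) =
     (\<lambda>m. a_r_coset W (filt_V_pred \<xi> N m) (act (lift_deg m a) v))"
  unfolding V_cyclic_eq using V_module_act_summand[OF assms v_vec_in_filt_V, of 0] by simp

lemma cartan_act_V_cyclic:
  assumes i: "i < r"
  shows "V_module_act \<xi> N (mat_unit r i i P) (V_cyclic \<xi> N) =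
     (of_nat (\<xi> ! i) * poly (poly P 0) 0) \<odot>\<^bsub>V\<^esub> V_cyclic \<xi> N"
proof
  fix m
  note M = module_ext_power[of B boxes] and v = v_vec_closed
  let ?c = "of_nat (\<xi> ! i) * poly (poly P 0) 0"
  interpret gr: Module.module class_ring "gr_V \<xi> N m" by (rule module_gr_V)
  have "act (mat_unit r i i (gen_X ^ k * gen_Y ^ m)) v = (if k = 0 then weight i m else 0) \<odot>\<^bsub>W\<^esub> v" for k
    using raising_act_v_vec[OF i i order_refl, of k m] diagonal_act_v_vec[OF i, of m]
      complex_module_simps(4)[OF M v] by auto
  then have "act (lift_deg m (mat_unit r i i P)) v =
      (\<Sum>k\<le>degree (coeff P m). coeff (coeff P m) k * (if k = 0 then weight i m else 0)) \<odot>\<^bsub>W\<^esub> v"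
    unfolding lift_deg_mat_unit by (rule act_mat_unit_poly)
  also have "(\<Sum>k\<le>degree (coeff P m). coeff (coeff P m) k * (if k = 0 then weight i m else 0)) =
      coeff (coeff P m) 0 * weight i m"
    by (subst sum.remove[of _ 0]) auto
  finally have act: "act (lift_deg m (mat_unit r i i P)) v = (coeff (coeff P m) 0 * weight i m) \<odot>\<^bsub>W\<^esub> v" .
  have F: "v \<in> filt_V \<xi> N m" by (rule v_vec_in_filt_V)
  have rhs: "(?c \<odot>\<^bsub>V\<^esub> V_cyclic \<xi> N) m = ?c \<odot>\<^bsub>gr_V \<xi> N m\<^esub> V_cyclic \<xi> N m"
    by (simp add: V_module_simps)
  show "V_module_act \<xi> N (mat_unit r i i P) (V_cyclic \<xi> N) m = (?c \<odot>\<^bsub>V\<^esub> V_cyclic \<xi> N) m"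
  proof (cases m)
    case 0
    then have "coeff (coeff P m) 0 * weight i m = ?c"
      using weight_0[OF i] by (simp add: poly_0_coeff_0)
    then show ?thesis
      unfolding V_module_act_cyclic[OF mat_unit_carrier] rhs act
      using gr_V_simps(4)[OF F, of ?c] 0 by (simp add: V_cyclic_def)
  next
    case (Suc m')
    \<comment> \<open>\<open>v\<close> already lies in degree \<open>0\<close>, so its multiples vanish in higher degree.\<close>
    have "v \<in> filt_V_pred \<xi> N m" using v_vec_in_filt_V by (simp add: Suc filt_V_pred_def)
    from submodD(5)[OF submod_filt_V_pred this]
    have "a_r_coset W (filt_V_pred \<xi> N m) ((coeff (coeff P m) 0 * weight i m) \<odot>\<^bsub>W\<^esub> v) = \<zero>\<^bsub>gr_V \<xi> N m\<^esub>"
      using gr_V_simps(5) filt_V_pred_subset by blast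
    moreover have "V_cyclic \<xi> N m = \<zero>\<^bsub>gr_V \<xi> N m\<^esub>" by (simp add: V_cyclic_def Suc)
    moreover have "?c \<odot>\<^bsub>gr_V \<xi> N m\<^esub> \<zero>\<^bsub>gr_V \<xi> N m\<^esub> = \<zero>\<^bsub>gr_V \<xi> N m\<^esub>"
      using gr.smult_r_null[of ?c] by simp
    ultimately show ?thesis
      unfolding V_module_act_cyclic[OF mat_unit_carrier] rhs act by (simp only:)
  qed
qed

lemma nilpotent_act_V_cyclic:
  assumes sorted: "sorted_wrt (\<ge>) \<xi>" and ij: "i < j" "j < r"
  shows "V_module_act \<xi> N (mat_unit r i j P) (V_cyclic \<xi> N) = \<zero>\<^bsub>V\<^esub>"
proof
  fix m
  note M = module_ext_power[of B boxes] and v = v_vec_closed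
  have "\<xi> ! j \<le> \<xi> ! i" using sorted ij by (simp add: sorted_wrt_iff_nth_less)
  then have "act (mat_unit r i j (gen_X ^ k * gen_Y ^ m)) v = 0 \<odot>\<^bsub>W\<^esub> v" for k
    using raising_act_v_vec[of i j k m] ij complex_module_simps(4)[OF M v] by simp
  then have "act (lift_deg m (mat_unit r i j P)) v = (\<Sum>k\<le>degree (coeff P m). coeff (coeff P m) k * 0) \<odot>\<^bsub>W\<^esub> v"
    unfolding lift_deg_mat_unit by (rule act_mat_unit_poly)
  then have "act (lift_deg m (mat_unit r i j P)) v = \<zero>\<^bsub>W\<^esub>"
    using complex_module_simps(4)[OF M v] by simp
  moreover have "a_r_coset W (filt_V_pred \<xi> N m) \<zero>\<^bsub>W\<^esub> = \<zero>\<^bsub>gr_V \<xi> N m\<^esub>"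
    using gr_V_simps(5) submodD(3)[OF submod_filt_V] submodD(3)[OF submod_filt_V_pred] by blast
  ultimately show "V_module_act \<xi> N (mat_unit r i j P) (V_cyclic \<xi> N) m = \<zero>\<^bsub>V\<^esub> m"
    by (simp add: V_module_act_cyclic V_module_simps)
qed

lemma fd_hw_module_V_module:
  assumes "sorted_wrt (\<ge>) \<xi>"
  shows "fd_hw_module \<xi> V (V_module_act \<xi> N) (V_cyclic \<xi> N)"
  unfolding fd_hw_module_def Let_def
  using g_module_V_module fin_dim_V_module generated_by_V_cyclic cartan_act_V_cyclic
    nilpotent_act_V_cyclic[OF assms] by blast

end

section \<open>Transport of structure\<close>

text \<open>An injective map carries the structure of a module to its image.\<close>

definition transport :: "('a \<Rightarrow> 'b) \<Rightarrow> (complex, 'a) module \<Rightarrow> (complex, 'b) module" where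
  "transport h M = (let g = inv_into (carrier M) h in
     \<lparr>carrier = h ` carrier M, mult = undefined, one = undefined, zero = h \<zero>\<^bsub>M\<^esub>,
      add = (\<lambda>x y. h (g x \<oplus>\<^bsub>M\<^esub> g y)), smult = (\<lambda>c x. h (c \<odot>\<^bsub>M\<^esub> g x))\<rparr>)"

definition transport_act :: "('a \<Rightarrow> 'b) \<Rightarrow> (complex, 'a) module \<Rightarrow> (poly2 mat \<Rightarrow> 'a \<Rightarrow> 'a) \<Rightarrow>
    poly2 mat \<Rightarrow> 'b \<Rightarrow> 'b" where
  "transport_act h M \<rho> a x = h (\<rho> a (inv_into (carrier M) h x))"

context
  fixes M :: "(complex, 'a) module" and h :: "'a \<Rightarrow> 'b"
  assumes M: "module class_ring M" and h: "inj_on h (carrier M)"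
begin

interpretation M: Module.module class_ring M by (rule M)

lemma transport_simps:
  "carrier (transport h M) = h ` carrier M" "\<zero>\<^bsub>transport h M\<^esub> = h \<zero>\<^bsub>M\<^esub>"
  "x \<in> carrier M \<Longrightarrow> y \<in> carrier M \<Longrightarrow> h x \<oplus>\<^bsub>transport h M\<^esub> h y = h (x \<oplus>\<^bsub>M\<^esub> y)"
  "x \<in> carrier M \<Longrightarrow> c \<odot>\<^bsub>transport h M\<^esub> h x = h (c \<odot>\<^bsub>M\<^esub> x)"
  "x \<in> carrier M \<Longrightarrow> transport_act h M \<rho> a (h x) = h (\<rho> a x)"
  by (simp_all add: transport_def transport_act_def Let_def inv_into_f_f[OF h])

lemma module_transport: "module class_ring (transport h M)"
proof (rule module_criteria)
  let ?T = "transport h M"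
  show "cring (class_ring :: complex ring)" by (rule domain.axioms(1)[OF field.axioms(1)[OF class_field]])
  show "\<forall>x\<in>carrier ?T. \<exists>y\<in>carrier ?T. x \<oplus>\<^bsub>?T\<^esub> y = \<zero>\<^bsub>?T\<^esub>"
  proof
    fix x assume "x \<in> carrier ?T"
    then obtain z where z: "z \<in> carrier M" "x = h z" by (auto simp: transport_simps)
    then have "x \<oplus>\<^bsub>?T\<^esub> h (\<ominus>\<^bsub>M\<^esub> z) = \<zero>\<^bsub>?T\<^esub>" by (simp add: transport_simps M.M.r_neg)
    then show "\<exists>y\<in>carrier ?T. x \<oplus>\<^bsub>?T\<^esub> y = \<zero>\<^bsub>?T\<^esub>"
      using z by (intro bexI[of _ "h (\<ominus>\<^bsub>M\<^esub> z)"]) (auto simp: transport_simps)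
  qed
qed (auto simp: transport_simps M.M.a_ac M.smult_r_distr complex_module_simps[OF M])

lemma transport_minus:
  assumes "x \<in> carrier M" "y \<in> carrier M"
  shows "h x \<ominus>\<^bsub>transport h M\<^esub> h y = h (x \<ominus>\<^bsub>M\<^esub> y)"
  using assms module_minus_eq[OF module_transport, of "h y" "h x"] module_minus_eq[OF M assms(2), of x]
  by (simp add: transport_simps complex_module_simps[OF M])

lemma g_module_transport:
  assumes "g_module r M \<rho>"
  shows "g_module r (transport h M) (transport_act h M \<rho>)"
proof -
  interpret \<rho>: g_module r M \<rho> by fact
  show ?thesis
  proof (intro g_module.intro g_module_axioms.intro)
    show "vectorspace class_ring (transport h M)"
      using module_transport by (simp add: vectorspace_iff_module)
  qed (auto simp: transport_simps transport_minus \<rho>.act_closed \<rho>.act_add \<rho>.act_smult \<rho>.add_act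
      \<rho>.smult_act \<rho>.bracket_act complex_module_simps[OF M])
qed

lemma generated_by_transport:
  assumes g: "g_module r M \<rho>" and gen: "generated_by r M \<rho> v"
  shows "generated_by r (transport h M) (transport_act h M \<rho>) (h v)"
  unfolding generated_by_def
proof (intro conjI allI impI; (elim conjE)?)
  interpret \<rho>: g_module r M \<rho> by (rule g)
  have v: "v \<in> carrier M" using gen by (simp add: generated_by_def)
  then show "h v \<in> carrier (transport h M)" by (simp add: transport_simps)
  fix S assume S: "submod S (transport h M)" "h v \<in> S"
    "\<forall>a\<in>carrier_mat r r. \<forall>w\<in>S. transport_act h M \<rho> a w \<in> S"
  let ?S = "{x \<in> carrier M. h x \<in> S}"
  have "submod ?S M"
    by (rule submodI[OF M])
      (use submodD(3-5)[OF S(1)] in \<open>auto simp: transport_simps complex_module_simps[OF M]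
        simp flip: transport_simps(3,4)\<close>)
  moreover have "\<forall>a\<in>carrier_mat r r. \<forall>w\<in>?S. \<rho> a w \<in> ?S"
    using S(3) by (auto simp: \<rho>.act_closed simp flip: transport_simps(5)[of _ \<rho>])
  ultimately have "?S = carrier M" using gen S(2) v unfolding generated_by_def by blast
  then show "S = carrier (transport h M)"
    using submodD(2)[OF S(1)] by (auto simp: transport_simps)
qed

lemma transport_hom: "h \<in> LinearCombinations.module_hom class_ring M (transport h M)"
  by (auto simp: LinearCombinations.module_hom_def transport_simps)

lemma fin_dim_transport:
  assumes "vectorspace.fin_dim class_ring M"
  shows "vectorspace.fin_dim class_ring (transport h M)"
proof -
  interpret h: linear_map class_ring M "transport h M" h
    by (intro linear_map.intro mod_hom.intro mod_hom_axioms.intro transport_hom M module_transport)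
      (simp_all add: vectorspace_iff_module M module_transport)
  show ?thesis by (rule h.surj_fin_dim[OF assms]) (simp add: transport_simps)
qed

lemma fd_hw_module_transport:
  assumes "fd_hw_module \<xi> M \<rho> v"
  shows "fd_hw_module \<xi> (transport h M) (transport_act h M \<rho>) (h v)"
proof -
  have v: "v \<in> carrier M" using assms by (simp add: fd_hw_module_def Let_def generated_by_def)
  then show ?thesis
    using assms g_module_transport generated_by_transport fin_dim_transport
    by (auto simp: fd_hw_module_def Let_def transport_simps)
qed

end

text \<open>A choice of coefficients with respect to a finite spanning set, independent or not, determines the
  vector.\<close>

lemma finite_dimensional_embedding:
  fixes M :: "(complex, 'a) module"
  assumes "vectorspace class_ring M" "vectorspace.fin_dim class_ring M"
  obtains h :: "'a \<Rightarrow> complex vec" where "inj_on h (carrier M)"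
proof -
  interpret V: vectorspace class_ring M by fact
  obtain A where A: "finite A" "A \<subseteq> carrier M" "V.span A = carrier M"
    using assms(2) unfolding V.fin_dim_def by blast
  obtain l where l: "set l = A" using finite_list[OF A(1)] by blast
  have "\<forall>x\<in>carrier M. \<exists>c. V.lincomb c A = x"
    using V.finite_in_span[OF A(1,2)] A(3) by metis
  then obtain c where c: "\<And>x. x \<in> carrier M \<Longrightarrow> V.lincomb (c x) A = x" by metis
  define h where "h x = vec (length l) (\<lambda>i. c x (l ! i))" for x
  have "inj_on h (carrier M)"
  proof
    fix x y assume xy: "x \<in> carrier M" "y \<in> carrier M" and eq: "h x = h y"
    have "c x a = c y a" if "a \<in> A" for a
    proof -
      from that l obtain i where i: "i < length l" "a = l ! i" by (auto simp: in_set_conv_nth)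
      then have "h x $ i = c x a" "h y $ i = c y a" by (simp_all add: h_def)
      then show ?thesis using eq by simp
    qed
    then have "V.lincomb (c x) A = V.lincomb (c y) A"
      by (intro V.lincomb_cong refl A(2)) auto
    then show "x = y" using c xy by simp
  qed
  then show thesis by (rule that)
qed

section \<open>Homomorphisms out of Weyl modules\<close>

text \<open>A copy of \<open>M\<close> inside the type of complex vectors is a quotient of \<open>W\<close>; following the quotient map
  by the inverse of the embedding gives the map to \<open>M\<close>.\<close>

lemma weyl_module_surjects:
  assumes W: "weyl_module \<xi> W \<rho> w" and M: "fd_hw_module \<xi> M \<sigma> v"
  obtains f where "g_hom (length \<xi>) W \<rho> M \<sigma> f" "f ` carrier W = carrier M" "f w = v"
proof -
  have gM: "g_module (length \<xi>) M \<sigma>" and fin: "vectorspace.fin_dim class_ring M" and v: "v \<in> carrier M"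
    using M by (simp_all add: fd_hw_module_def Let_def generated_by_def)
  interpret M: g_module "length \<xi>" M \<sigma> by (rule gM)
  have vs: "vectorspace class_ring M" ..
  then have mod: "module class_ring M" by (simp add: vectorspace_iff_module)
  obtain h :: "'b \<Rightarrow> complex vec" where h: "inj_on h (carrier M)"
    using finite_dimensional_embedding[OF vs fin] by blast
  note simps = transport_simps[OF mod h]
  from W fd_hw_module_transport[OF mod h M] obtain f
    where f: "g_hom (length \<xi>) W \<rho> (transport h M) (transport_act h M \<sigma>) f"
      "f ` carrier W = carrier (transport h M)" "f w = h v"
    unfolding weyl_module_def by blast
  define g where "g = inv_into (carrier M) h"
  have gh: "g (h x) = x" if "x \<in> carrier M" for x using that h by (simp add: g_def)
  have fx: "\<exists>y\<in>carrier M. f x = h y" if "x \<in> carrier W" for x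
    using f(2) that by (auto simp: simps)
  have hom: "f \<in> LinearCombinations.module_hom class_ring W (transport h M)"
    and gW: "g_module (length \<xi>) W \<rho>"
    and equi: "\<And>a x. a \<in> carrier_mat (length \<xi>) (length \<xi>) \<Longrightarrow> x \<in> carrier W \<Longrightarrow>
      f (\<rho> a x) = transport_act h M \<sigma> a (f x)"
    using f(1) by (auto simp: g_hom_def)
  have "g \<circ> f \<in> LinearCombinations.module_hom class_ring W M"
    unfolding LinearCombinations.module_hom_def
  proof (intro CollectI conjI allI impI; (elim conjE)?)
    show "g \<circ> f \<in> carrier W \<rightarrow> carrier M" using fx gh by fastforce
    fix x y assume "x \<in> carrier W" "y \<in> carrier W"
    then show "(g \<circ> f) (x \<oplus>\<^bsub>W\<^esub> y) = (g \<circ> f) x \<oplus>\<^bsub>M\<^esub> (g \<circ> f) y"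
      using fx[of x] fx[of y] hom by (auto simp: LinearCombinations.module_hom_def simps gh)
  next
    fix c :: complex and x assume "x \<in> carrier W"
    then show "(g \<circ> f) (c \<odot>\<^bsub>W\<^esub> x) = c \<odot>\<^bsub>M\<^esub> (g \<circ> f) x"
      using fx[of x] hom by (auto simp: LinearCombinations.module_hom_def simps gh)
  qed
  moreover have "(g \<circ> f) (\<rho> a x) = \<sigma> a ((g \<circ> f) x)"
    if "a \<in> carrier_mat (length \<xi>) (length \<xi>)" "x \<in> carrier W" for a x
    using fx[OF that(2)] equi[OF that] by (auto simp: simps gh M.act_closed that(1))
  ultimately have "g_hom (length \<xi>) W \<rho> M \<sigma> (g \<circ> f)"
    using gW gM by (auto simp: g_hom_def)
  moreover have "(g \<circ> f) ` carrier W = carrier M"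
    unfolding image_comp[symmetric] f(2) simps by (force simp: gh image_iff)
  moreover have "(g \<circ> f) w = v" using f(3) gh[OF v] by simp
  ultimately show thesis by (rule that)
qed

text \<open>The vectors on which two homomorphisms agree form a submodule.\<close>

lemma g_hom_unique:
  assumes gen: "generated_by r M \<rho> v" and f: "g_hom r M \<rho> M' \<rho>' f" and g: "g_hom r M \<rho> M' \<rho>' g"
    and eq: "f v = g v" and x: "x \<in> carrier M"
  shows "f x = g x"
proof -
  have gM: "g_module r M \<rho>" using f by (simp add: g_hom_def)
  interpret M: g_module r M \<rho> by (rule gM)
  have mod: "module class_ring M" ..
  let ?S = "{x \<in> carrier M. f x = g x}"
  interpret f: mod_hom class_ring M M' f
    using f mod g_module.axioms(1)[of r M' \<rho>'] unfolding g_hom_def vectorspace_iff_module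
    by (intro mod_hom.intro mod_hom_axioms.intro) auto
  interpret g: mod_hom class_ring M M' g
    using g mod g_module.axioms(1)[of r M' \<rho>'] unfolding g_hom_def vectorspace_iff_module
    by (intro mod_hom.intro mod_hom_axioms.intro) auto
  have "submod ?S M"
    by (rule submodI[OF mod]) (auto simp: complex_module_simps[OF mod])
  moreover have "\<forall>a\<in>carrier_mat r r. \<forall>x\<in>?S. \<rho> a x \<in> ?S"
    using f g M.act_closed by (auto simp: g_hom_def)
  moreover have "v \<in> ?S" using gen eq by (simp add: generated_by_def)
  ultimately have "?S = carrier M" using gen unfolding generated_by_def by blast
  then show ?thesis using x by blast
qed

lemma g_hom_restrict:
  assumes "g_hom r M \<rho> M' \<rho>' f"
  shows "g_hom r M \<rho> M' \<rho>' (restrict f (carrier M))"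
proof -
  have "g_module r M \<rho>" using assms by (simp add: g_hom_def)
  then interpret M: g_module r M \<rho> .
  have mod: "module class_ring M" ..
  show ?thesis
    using assms by (auto simp: g_hom_def LinearCombinations.module_hom_def M.act_closed
        complex_module_simps[OF mod])
qed

theorem proposition6:
  fixes \<xi> :: "nat list" and N :: int
    and W :: "(complex, 'w) module" and \<rho> :: "poly2 mat \<Rightarrow> 'w \<Rightarrow> 'w" and w :: 'w
  assumes "sorted_wrt (\<ge>) \<xi>"
    and "weyl_module \<xi> W \<rho> w"
  shows "\<exists>!f. f \<in> extensional (carrier W) \<and>
    g_hom (length \<xi>) W \<rho> (V_module \<xi> N) (V_module_act \<xi> N) f \<and>
    f ` carrier W = carrier (V_module \<xi> N) \<and> f w = V_cyclic \<xi> N"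
proof -
  have gen: "generated_by (length \<xi>) W \<rho> w"
    using assms(2) by (simp add: weyl_module_def fd_hw_module_def Let_def)
  then have w: "w \<in> carrier W" by (simp add: generated_by_def)
  obtain f where f: "g_hom (length \<xi>) W \<rho> (V_module \<xi> N) (V_module_act \<xi> N) f"
    "f ` carrier W = carrier (V_module \<xi> N)" "f w = V_cyclic \<xi> N"
    using weyl_module_surjects[OF assms(2) fd_hw_module_V_module[OF assms(1)]] by blast
  show ?thesis
  proof (rule ex1I[of _ "restrict f (carrier W)"])
    show "restrict f (carrier W) \<in> extensional (carrier W) \<and>
      g_hom (length \<xi>) W \<rho> (V_module \<xi> N) (V_module_act \<xi> N) (restrict f (carrier W)) \<and>
      restrict f (carrier W) ` carrier W = carrier (V_module \<xi> N) \<and>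
      restrict f (carrier W) w = V_cyclic \<xi> N"
      using f w g_hom_restrict by simp
    fix g assume g: "g \<in> extensional (carrier W) \<and>
      g_hom (length \<xi>) W \<rho> (V_module \<xi> N) (V_module_act \<xi> N) g \<and>
      g ` carrier W = carrier (V_module \<xi> N) \<and> g w = V_cyclic \<xi> N"
    then have "g x = f x" if "x \<in> carrier W" for x
      using g_hom_unique[OF gen _ f(1) _ that, of g] f(3) by simp
    then show "g = restrict f (carrier W)"
      using g by (intro extensionalityI[of _ "carrier W"]) auto
  qed
qed

end
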